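(* Let $0<q<1$ and let $A:\Omega\to\mathbb{R}$ be a $(2-q)$-normalizable Lipschitz continuous potential. Then there exists a unique $q$-equilibrium state $\mu_{q,A}$ for $A$ in $\mathcal{G}$. Moreover, $\mu_{q,A}$ is exact, has exponential decay of correlations for Lipschitz observables, and varies differentiably with respect to $A$.
   Context: $\Omega=\{1,\dots,d\}^{\mathbb N}$ with its usual distance $\mathrm{dist}$ (normalized to have diameter one), $\sigma$ is the one-sided shift, and $ax$ denotes the sequence obtained by placing the symbol $a$ in front of $x$. $\mathrm{Lip}(\Omega)$ is the space of real Lipschitz functions with norm $\|f\|_{C^0}+\sup_{x\neq y}\frac{|f(x)-f(y)|}{\mathrm{dist}(x,y)}$. For $0<q<1$: $\log_q(u)=\frac1{1-q}(u^{1-q}-1)$ for $u>0$, and $e_{2-q}^u=(1+(q-1)u)^{\frac{1}{q-1}}$ for $1+(q-1)u>0$. A Lipschitz potential $A$ is $(2-q)$-normalizable if there are a Lipschitz function $\varphi_A$ and $c_A\in\mathbb{R}$ with $\sum_{a=1}^d e_{2-q}^{A(ax)+\varphi_A(ax)-\varphi_A(x)-c_A}=1$ for every $x\in\Omega$, all summands being well defined and strictly positive. A Jacobian is a positive Lipschitz function $J$ with $\sum_{a=1}^dJ(ax)=1$ for all $x$. For each Jacobian $J$ there is a unique probability measure $\mu_{\log J}$ fixed by the dual of $\mathcal{L}_{\log J}(f)(x)=\sum_{a=1}^dJ(ax)f(ax)$; it is $\sigma$-invariant and $J$ is called its Jacobian. $\mathcal{G}=\{\mu_{\log J}:J\text{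 a Jacobian}\}$. For $\mu\in\mathcal{G}$ with Jacobian $J$, $H_q(\mu)=\int\log_q(1/J)\,d\mu$. A $q$-equilibrium state for $A$ in $\mathcal{G}$ is a measure in $\mathcal{G}$ attaining $\sup\{H_q(\mu)+\int A\,d\mu:\mu\in\mathcal{G}\}$. Measures in $\mathcal{G}$ are parameterized by their Jacobians (the correspondence $J\leftrightarrow\mu_{\log J}$ is bijective), and differentiability of $A\mapsto\mu_{q,A}$ is understood as differentiability of the map from $(2-q)$-normalizable potentials in $\mathrm{Lip}(\Omega)$ to the Jacobian of $\mu_{q,A}$ in $\mathrm{Lip}(\Omega)$. Exactness means that $\bigcap_{n\ge0}\sigma^{-n}\mathcal{B}$ is trivial modulo $\mu_{q,A}$, with $\mathcal{B}$ the Borel $\sigma$-algebra. *)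

theory Defs
  imports "HOL-Probability.Probability"
begin

text \<open>
  The full shift on \<open>d\<close> symbols is the type of streams over a finite type of symbols
  with \<open>d\<close> elements; the shift is \<^const>\<open>stl\<close> and the sequence \<open>ax\<close> is \<open>a ## x\<close>.
  The distance is \<open>2 ^ (- N)\<close>, where \<open>N\<close> is the first index, counted from \<open>0\<close>, at which
  the two sequences differ. It has diameter one as soon as there are two symbols.
\<close>

instantiation stream :: (finite) metric_space
begin

definition dist_stream :: "'a stream \<Rightarrow> 'a stream \<Rightarrow> real" where
  "dist_stream x y = (if x = y then 0 else (1 / 2) ^ (LEAST n. x !! n \<noteq> y !! n))"

definition uniformity_stream :: "('a stream \<times> 'a stream) filter" where
  "uniformity_stream = (INF e\<in>{0<..}. principal {(x, y). dist x y < e})"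

definition open_stream :: "'a stream set \<Rightarrow> bool" where
  "open_stream S = (\<forall>x\<in>S. \<forall>\<^sub>F (x', y) in uniformity. x' = x \<longrightarrow> y \<in> S)"

instance
proof
  fix x y z :: "'a stream"
  show "dist x y = 0 \<longleftrightarrow> x = y"
    by (simp add: dist_stream_def)
  show "dist x y \<le> dist x z + dist y z"
  proof (cases "x = y \<or> x = z \<or> y = z")
    case True
    then show ?thesis
      by (auto simp: dist_stream_def neq_commute[of "z !! _"])
  next
    case False
    define N where "N = (LEAST n. x !! n \<noteq> y !! n)"
    have ex: "\<exists>n. x !! n \<noteq> y !! n"
      using False by (metis smap_alt stream.map_id0 id_apply)
    have N: "x !! N \<noteq> y !! N"
      unfolding N_def by (rule LeastI_ex[OF ex])
    then consider "x !! N \<noteq> z !! N" | "y !! N \<noteq> z !! N"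
      by metis
    then show ?thesis
    proof cases
      case 1
      then have "(LEAST n. x !! n \<noteq> z !! n) \<le> N"
        by (rule Least_le)
      then have "(1 / 2 :: real) ^ N \<le> (1 / 2) ^ (LEAST n. x !! n \<noteq> z !! n)"
        by (intro power_decreasing) auto
      then have "dist x y \<le> dist x z"
        using False by (simp add: dist_stream_def N_def)
      moreover have "0 \<le> dist y z"
        by (simp add: dist_stream_def)
      ultimately show ?thesis by linarith
    next
      case 2
      then have "(LEAST n. y !! n \<noteq> z !! n) \<le> N"
        by (rule Least_le)
      then have "(1 / 2 :: real) ^ N \<le> (1 / 2) ^ (LEAST n. y !! n \<noteq> z !! n)"
        by (intro power_decreasing) auto
      then have "dist x y \<le> dist y z"
        using False by (simp add: dist_stream_def N_def)
      moreover have "0 \<le> dist x z"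
        by (simp add: dist_stream_def)
      ultimately show ?thesis by linarith
    qed
  qed
qed (rule uniformity_stream_def open_stream_def)+

end

lemma dist_stream_le_1: "dist x y \<le> 1" for x y :: "'a::finite stream"
  by (simp add: dist_stream_def power_le_one)

section \<open>The space of Lipschitz functions\<close>

typedef (overloaded) 'a lip = "{f :: 'a::finite stream \<Rightarrow> real. \<exists>C. C-lipschitz_on UNIV f}"
  morphisms apply_lip Lip
proof -
  have "0-lipschitz_on UNIV (\<lambda>_ :: 'a stream. 0 :: real)"
    by (rule lipschitz_intros)
  then show ?thesis by blast
qed

setup_lifting type_definition_lip

lemma lip_eqI: "(\<And>x. apply_lip f x = apply_lip g x) \<Longrightarrow> f = g"
  by transfer auto

lemma lip_diff_le:
  obtains C where "0 \<le> C" "\<And>x y. \<bar>apply_lip f x - apply_lip f y\<bar> \<le> C * dist x y"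
  using apply_lip[of f] by (auto simp: lipschitz_on_def dist_real_def)

lemma bdd_above_lip: "bdd_above (range (\<lambda>x. \<bar>apply_lip f x\<bar>))"
proof -
  obtain C where C: "0 \<le> C" "\<And>x y. \<bar>apply_lip f x - apply_lip f y\<bar> \<le> C * dist x y"
    using lip_diff_le by blast
  have "\<bar>apply_lip f x\<bar> \<le> \<bar>apply_lip f (sconst undefined)\<bar> + C" for x
  proof -
    have "C * dist x (sconst undefined) \<le> C * 1"
      using C(1) by (intro mult_left_mono dist_stream_le_1)
    then show ?thesis
      using C(2)[of x "sconst undefined"] by linarith
  qed
  then show ?thesis
    by (intro bdd_aboveI2)
qed

lemma bdd_above_lip_quotient:
  "bdd_above (range (\<lambda>(x, y). \<bar>apply_lip f x - apply_lip f y\<bar> / dist x y))"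
proof -
  obtain C where C: "0 \<le> C" "\<And>x y. \<bar>apply_lip f x - apply_lip f y\<bar> \<le> C * dist x y"
    using lip_diff_le by blast
  have "\<bar>apply_lip f x - apply_lip f y\<bar> / dist x y \<le> C" for x y
    using C by (cases "x = y") (simp_all add: pos_divide_le_eq)
  then show ?thesis
    by (intro bdd_aboveI2[of _ _ C]) auto
qed

instantiation lip :: (finite) real_vector
begin

lift_definition uminus_lip :: "'a lip \<Rightarrow> 'a lip" is "\<lambda>f x. - f x"
  by (auto intro: lipschitz_intros)

lift_definition plus_lip :: "'a lip \<Rightarrow> 'a lip \<Rightarrow> 'a lip" is "\<lambda>f g x. f x + g x"
  by (auto intro: lipschitz_intros)

lift_definition minus_lip :: "'a lip \<Rightarrow> 'a lip \<Rightarrow> 'a lip" is "\<lambda>f g x. f x - g x"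
  by (auto intro: lipschitz_intros)

lift_definition zero_lip :: "'a lip" is "\<lambda>_. 0"
  by (rule exI[of _ 0]) (rule lipschitz_intros)

lift_definition scaleR_lip :: "real \<Rightarrow> 'a lip \<Rightarrow> 'a lip" is "\<lambda>r f x. r * f x"
proof -
  fix r :: real and f :: "'a stream \<Rightarrow> real"
  assume "\<exists>C. C-lipschitz_on UNIV f"
  then obtain C where "C-lipschitz_on UNIV f" by blast
  then have "(\<bar>r\<bar> * C)-lipschitz_on UNIV (\<lambda>x. r *\<^sub>R f x)"
    by (rule lipschitz_on_cmult)
  then show "\<exists>C. C-lipschitz_on UNIV (\<lambda>x. r * f x)"
    by auto
qed

lemmas lip_simps [simp] =
  uminus_lip.rep_eq plus_lip.rep_eq minus_lip.rep_eq zero_lip.rep_eq scaleR_lip.rep_eq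

instance
  by standard (auto intro!: lip_eqI simp: algebra_simps)

end

instantiation lip :: (finite) real_normed_vector
begin

text \<open>
  The second supremum ranges over all pairs: a pair with \<open>x = y\<close> contributes \<open>0 / 0 = 0\<close>.
  This changes nothing except that it avoids a supremum over the empty set
  when there is only one symbol.
\<close>

definition norm_lip :: "'a lip \<Rightarrow> real" where
  "norm_lip f = (SUP x. \<bar>apply_lip f x\<bar>) +
     (SUP (x, y). \<bar>apply_lip f x - apply_lip f y\<bar> / dist x y)"

definition dist_lip :: "'a lip \<Rightarrow> 'a lip \<Rightarrow> real" where
  "dist_lip f g = norm (f - g)"

definition sgn_lip :: "'a lip \<Rightarrow> 'a lip" where
  "sgn_lip f = f /\<^sub>R norm f"

definition uniformity_lip :: "('a lip \<times> 'a lip) filter" where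
  "uniformity_lip = (INF e\<in>{0<..}. principal {(f, g). dist f g < e})"

definition open_lip :: "'a lip set \<Rightarrow> bool" where
  "open_lip S = (\<forall>f\<in>S. \<forall>\<^sub>F (f', g) in uniformity. f' = f \<longrightarrow> g \<in> S)"

lemma norm_lip_upper:
  "\<bar>apply_lip f x\<bar> \<le> (SUP x. \<bar>apply_lip f x\<bar>)"
  "\<bar>apply_lip f x - apply_lip f y\<bar> / dist x y
     \<le> (SUP (x, y). \<bar>apply_lip f x - apply_lip f y\<bar> / dist x y)"
  using cSUP_upper[OF _ bdd_above_lip, of x f]
    cSUP_upper[OF _ bdd_above_lip_quotient, of "(x, y)" f] by simp_all

lemma norm_lip_least:
  assumes "\<And>x. \<bar>apply_lip f x\<bar> \<le> a"
    and "\<And>x y. \<bar>apply_lip f x - apply_lip f y\<bar> / dist x y \<le> b"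
  shows "norm f \<le> a + b"
  unfolding norm_lip_def using assms by (intro add_mono cSUP_least) auto

lemma norm_lip_scaleR_le: "norm (r *\<^sub>R f) \<le> \<bar>r\<bar> * norm f" for f :: "'a lip"
proof -
  have "norm (r *\<^sub>R f) \<le> \<bar>r\<bar> * (SUP x. \<bar>apply_lip f x\<bar>) +
     \<bar>r\<bar> * (SUP (x, y). \<bar>apply_lip f x - apply_lip f y\<bar> / dist x y)"
  proof (rule norm_lip_least)
    fix x y :: "'a stream"
    show "\<bar>apply_lip (r *\<^sub>R f) x\<bar> \<le> \<bar>r\<bar> * (SUP x. \<bar>apply_lip f x\<bar>)"
      using norm_lip_upper(1)[of f x] by (simp add: abs_mult mult_left_mono)
    have "\<bar>apply_lip (r *\<^sub>R f) x - apply_lip (r *\<^sub>R f) y\<bar> / dist x y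
        = \<bar>r\<bar> * (\<bar>apply_lip f x - apply_lip f y\<bar> / dist x y)"
      by (simp add: abs_mult flip: right_diff_distrib)
    also have "\<dots> \<le> \<bar>r\<bar> * (SUP (x, y). \<bar>apply_lip f x - apply_lip f y\<bar> / dist x y)"
      by (intro mult_left_mono norm_lip_upper) simp
    finally show "\<bar>apply_lip (r *\<^sub>R f) x - apply_lip (r *\<^sub>R f) y\<bar> / dist x y
        \<le> \<bar>r\<bar> * (SUP (x, y). \<bar>apply_lip f x - apply_lip f y\<bar> / dist x y)" .
  qed
  then show ?thesis
    by (simp add: norm_lip_def distrib_left)
qed

instance
proof
  fix r :: real and f g :: "'a lip"
  have pos: "0 \<le> (SUP x. \<bar>apply_lip f x\<bar>)"
    "0 \<le> (SUP (x, y). \<bar>apply_lip f x - apply_lip f y\<bar> / dist x y)"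
    using norm_lip_upper(1)[of f undefined] norm_lip_upper(2)[of f undefined undefined]
    by simp_all
  show "norm f = 0 \<longleftrightarrow> f = 0"
  proof
    assume "norm f = 0"
    then have "(SUP x. \<bar>apply_lip f x\<bar>) = 0"
      using pos by (simp add: norm_lip_def)
    then show "f = 0"
      using norm_lip_upper(1)[of f] by (intro lip_eqI) simp
  qed (simp add: norm_lip_def case_prod_unfold)
  show "norm (f + g) \<le> norm f + norm g"
  proof -
    have "norm (f + g) \<le> ((SUP x. \<bar>apply_lip f x\<bar>) + (SUP x. \<bar>apply_lip g x\<bar>)) +
      ((SUP (x, y). \<bar>apply_lip f x - apply_lip f y\<bar> / dist x y) +
       (SUP (x, y). \<bar>apply_lip g x - apply_lip g y\<bar> / dist x y))"
    proof (rule norm_lip_least)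
      fix x y :: "'a stream"
      show "\<bar>apply_lip (f + g) x\<bar> \<le> (SUP x. \<bar>apply_lip f x\<bar>) + (SUP x. \<bar>apply_lip g x\<bar>)"
        using norm_lip_upper(1)[of f x] norm_lip_upper(1)[of g x] by simp
      have "\<bar>apply_lip (f + g) x - apply_lip (f + g) y\<bar> / dist x y
          \<le> (\<bar>apply_lip f x - apply_lip f y\<bar> + \<bar>apply_lip g x - apply_lip g y\<bar>) / dist x y"
        by (intro divide_right_mono) auto
      also have "\<dots> = \<bar>apply_lip f x - apply_lip f y\<bar> / dist x y +
          \<bar>apply_lip g x - apply_lip g y\<bar> / dist x y"
        by (rule add_divide_distrib)
      finally show "\<bar>apply_lip (f + g) x - apply_lip (f + g) y\<bar> / dist x y
          \<le> (SUP (x, y). \<bar>apply_lip f x - apply_lip f y\<bar> / dist x y) +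
             (SUP (x, y). \<bar>apply_lip g x - apply_lip g y\<bar> / dist x y)"
        using norm_lip_upper(2)[of f x y] norm_lip_upper(2)[of g x y] by linarith
    qed
    then show ?thesis by (simp add: norm_lip_def)
  qed
  show "norm (r *\<^sub>R f) = \<bar>r\<bar> * norm f"
  proof (cases "r = 0")
    case False
    have "norm f \<le> \<bar>inverse r\<bar> * norm (r *\<^sub>R f)"
      using norm_lip_scaleR_le[of "inverse r" "r *\<^sub>R f"] False by simp
    then have "\<bar>r\<bar> * norm f \<le> norm (r *\<^sub>R f)"
      using False by (simp add: field_simps)
    then show ?thesis
      using norm_lip_scaleR_le[of r f] by simp
  qed (simp add: norm_lip_def case_prod_unfold)
qed (rule dist_lip_def sgn_lip_def uniformity_lip_def open_lip_def)+

end

section \<open>Normalizable potentials\<close>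

definition log_q :: "real \<Rightarrow> real \<Rightarrow> real" where
  "log_q q u = (u powr (1 - q) - 1) / (1 - q)"

text \<open>The function \<open>e\<close> with index \<open>2 - q\<close>; it is meaningful only for \<open>1 + (q - 1) * u > 0\<close>.\<close>

definition exp_2mq :: "real \<Rightarrow> real \<Rightarrow> real" where
  "exp_2mq q u = (1 + (q - 1) * u) powr (1 / (q - 1))"

text \<open>Strict positivity of the summands is automatic once they are well defined.\<close>

definition normalizable :: "real \<Rightarrow> 'a::finite lip \<Rightarrow> bool" where
  "normalizable q A \<longleftrightarrow> (\<exists>(\<phi> :: 'a lip) (c :: real).
     \<forall>x. (\<forall>a. 1 + (q - 1) * (apply_lip A (a ## x) + apply_lip \<phi> (a ## x) - apply_lip \<phi> x - c) > 0) \<and>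
         (\<Sum>a\<in>UNIV. exp_2mq q (apply_lip A (a ## x) + apply_lip \<phi> (a ## x) - apply_lip \<phi> x - c)) = 1)"

section \<open>Jacobians and their measures\<close>

definition is_jacobian :: "'a::finite lip \<Rightarrow> bool" where
  "is_jacobian J \<longleftrightarrow> (\<forall>x. apply_lip J x > 0) \<and> (\<forall>x. (\<Sum>a\<in>UNIV. apply_lip J (a ## x)) = 1)"

definition transfer_log :: "'a::finite lip \<Rightarrow> ('a stream \<Rightarrow> real) \<Rightarrow> 'a stream \<Rightarrow> real" where
  "transfer_log J f x = (\<Sum>a\<in>UNIV. apply_lip J (a ## x) * f (a ## x))"

text \<open>
  The Borel probability measures fixed by the dual of the transfer operator of \<open>J\<close>
  acting on continuous functions; for a Jacobian \<open>J\<close> there is exactly one.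
\<close>

definition has_jacobian :: "'a::finite stream measure \<Rightarrow> 'a lip \<Rightarrow> bool" where
  "has_jacobian \<mu> J \<longleftrightarrow> is_jacobian J \<and> prob_space \<mu> \<and> sets \<mu> = sets borel \<and>
     (\<forall>f. continuous_on UNIV f \<longrightarrow> (\<integral>x. transfer_log J f x \<partial>\<mu>) = (\<integral>x. f x \<partial>\<mu>))"

definition jacobian_measures :: "'a::finite stream measure set" where
  "jacobian_measures = {\<mu>. \<exists>J. has_jacobian \<mu> J}"

text \<open>The description is legitimate because a measure has at most one Jacobian.\<close>

definition jacobian_of :: "'a::finite stream measure \<Rightarrow> 'a lip" where
  "jacobian_of \<mu> = (THE J. has_jacobian \<mu> J)"

section \<open>Equilibrium states\<close>

definition entropy_q :: "real \<Rightarrow> 'a::finite stream measure \<Rightarrow> real" where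
  "entropy_q q \<mu> = (\<integral>x. log_q q (1 / apply_lip (jacobian_of \<mu>) x) \<partial>\<mu>)"

definition pressure_functional :: "real \<Rightarrow> 'a::finite lip \<Rightarrow> 'a stream measure \<Rightarrow> real" where
  "pressure_functional q A \<mu> = entropy_q q \<mu> + (\<integral>x. apply_lip A x \<partial>\<mu>)"

text \<open>The supremum is taken in the extended reals, so that it always exists.\<close>

definition equilibrium_state :: "real \<Rightarrow> 'a::finite lip \<Rightarrow> 'a stream measure \<Rightarrow> bool" where
  "equilibrium_state q A \<mu> \<longleftrightarrow> \<mu> \<in> jacobian_measures \<and>
     ereal (pressure_functional q A \<mu>) =
       (SUP \<nu>\<in>jacobian_measures. ereal (pressure_functional q A \<nu>))"

definition the_equilibrium_state :: "real \<Rightarrow> 'a::finite lip \<Rightarrow> 'a stream measure" where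
  "the_equilibrium_state q A = (THE \<mu>. equilibrium_state q A \<mu>)"

section \<open>Ergodic properties\<close>

text \<open>\<open>vimage_algebra UNIV (stl ^^ n) borel\<close> is the pullback of the Borel sets under the \<open>n\<close>-th shift.\<close>

definition exact_measure :: "'a::finite stream measure \<Rightarrow> bool" where
  "exact_measure \<mu> \<longleftrightarrow>
     (\<forall>E \<in> (\<Inter>n. sets (vimage_algebra UNIV (stl ^^ n) borel)).
        measure \<mu> E = 0 \<or> measure \<mu> E = 1)"

definition exp_decay_of_correlations :: "'a::finite stream measure \<Rightarrow> bool" where
  "exp_decay_of_correlations \<mu> \<longleftrightarrow>
     (\<exists>C \<rho>. 0 \<le> C \<and> 0 < \<rho> \<and> \<rho> < 1 \<and>
       (\<forall>(f :: 'a lip) (g :: 'a lip) n.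
          \<bar>(\<integral>x. apply_lip f x * apply_lip g ((stl ^^ n) x) \<partial>\<mu>) -
            (\<integral>x. apply_lip f x \<partial>\<mu>) * (\<integral>x. apply_lip g x \<partial>\<mu>)\<bar>
            \<le> C * norm f * norm g * \<rho> ^ n))"

end

theory Submission
  imports Defs
begin

text \<open>
  Write \<open>b = 1 - q\<close>. For \<open>\<nu>\<close> with Jacobian \<open>K\<close>, invariance of \<open>\<nu>\<close> under the dual of the transfer
  operator turns \<open>H_q(\<nu>) + \<integral> A d\<nu>\<close> into the integral of
  \<open>(\<Sum>\<^sub>a K(ax)\<^sup>1\<^sup>-\<^sup>b - 1) / b + \<Sum>\<^sub>a K(ax) A(ax)\<close>. Let \<open>\<Psi>(v)\<close> be the maximum of
  \<open>(\<Sum>\<^sub>a r\<^sub>a\<^sup>1\<^sup>-\<^sup>b - 1) / b + \<Sum>\<^sub>a r\<^sub>a v\<^sub>a\<close> over probability vectors \<open>r\<close>. If \<open>\<phi>\<close> and \<open>c\<close> solve the Bellman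
  equation \<open>\<Psi>(((A + \<phi>)(ax))\<^sub>a) = \<phi>(x) + c\<close>, the pressure of \<open>\<nu>\<close> is at most \<open>c\<close>, with equality exactly
  when \<open>K(ax)\<close> is the unique maximiser for every \<open>x\<close>; so the equilibrium state is the measure of
  that Jacobian. It differs in general from \<open>e\<^sub>2\<^sub>-\<^sub>q\<close> of the normalisation of \<open>A\<close>: for a potential
  depending on one coordinate it is \<open>e\<^sub>2\<^sub>-\<^sub>q\<close> of the normalisation of \<open>A / q\<close>.

  A convex function \<open>F\<close> whose subgradients are probability vectors is nonexpansive and commutes with
  adding constants, which is all that solving \<open>F(((A + \<phi>)(ax))\<^sub>a) = \<phi>(x) + c\<close> requires. With
  \<open>F = \<Psi>\<close> this is the Bellman equation; with \<open>F(v)\<close> the number \<open>t\<close> such that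
  \<open>\<Sum>\<^sub>a e\<^sub>2\<^sub>-\<^sub>q(v\<^sub>a - t) = 1\<close> it shows that every Lipschitz potential is \<open>(2 - q)\<close>-normalizable.

  Exactness and decay of correlations hold for every Jacobian, by the spectral gap of its transfer
  operator on Lipschitz functions. For the differentiability, the increment \<open>h\<close> of \<open>\<phi>\<close> between \<open>A\<close> and
  \<open>A + k\<close> satisfies \<open>h - L h = L k + const + O(\<parallel>k\<parallel>\<^sup>2)\<close>, which the spectral gap inverts modulo constants.
\<close>

section \<open>The full shift as a metric space\<close>

text \<open>Both nonlinear functions come from one construction, the number \<open>l\<close> for
  which the powers \<open>- 1 / b\<close> of \<open>\<gamma> * (l - v a)\<close> sum to 1. Only the
  scale differs: \<open>\<gamma> = b\<close> for the normalisation,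
  \<open>\<gamma> = b / (1 - b)\<close> for the maximisation. The bases are always at least 1, where
  negative powers have bounded derivatives, so no constant degenerates.

  Differentiability meets two obstacles. The error must be small in the Lipschitz norm, not only
  uniformly, so Taylor remainders of powers are estimated together with their own Lipschitz
  constants. Moreover the increment \<open>h\<close> is at first known only to have the Lipschitz
  constant \<open>norm B + norm A\<close>, which does not tend to 0; a bound linear in
  \<open>norm (B - A)\<close> has to precede any linearisation. It rests on a mixed second
  difference of the maximum, for which a Lipschitz gradient suffices. Since the Bellman equation
  leaves an additive constant in \<open>\<phi>\<close> free, the estimates concern quantities blind
  to constants: oscillations, Lipschitz constants and the bases above.\<close>

lemma dist_stream_le_iff:
  fixes x y :: "'a::finite stream"
  shows "dist x y \<le> (1/2)^n \<longleftrightarrow> stake n x = stake n y"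
proof (cases "x = y")
  case False
  define N where "N = (LEAST n. x !! n \<noteq> y !! n)"
  have ex: "\<exists>n. x !! n \<noteq> y !! n"
    using False by (metis smap_alt stream.map_id0 id_apply)
  have N: "x !! N \<noteq> y !! N"
    unfolding N_def by (rule LeastI_ex[OF ex])
  have less: "x !! i = y !! i" if "i < N" for i
    using that not_less_Least[of i "\<lambda>n. x !! n \<noteq> y !! n"] unfolding N_def by blast
  have "dist x y = (1/2)^N"
    using False by (simp add: dist_stream_def N_def)
  then have "dist x y \<le> (1/2)^n \<longleftrightarrow> n \<le> N"
    by simp
  also have "\<dots> \<longleftrightarrow> (\<forall>i<n. x !! i = y !! i)"
    using N less by (meson leI less_le_trans)
  also have "\<dots> \<longleftrightarrow> stake n x = stake n y"
    by (simp add: list_eq_iff_nth_eq)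
  finally show ?thesis .
qed simp

lemma dist_Stream_neq:
  fixes x y :: "'a::finite stream"
  assumes "a \<noteq> b" shows "dist (a ## x) (b ## y) = 1"
proof -
  have "(LEAST n. (a ## x) !! n \<noteq> (b ## y) !! n) = 0"
    using assms by (intro Least_equality) auto
  then show ?thesis using assms by (simp add: dist_stream_def)
qed

text \<open>The source of the factors 1/2 in all Lipschitz estimates for averages over
  preimages.\<close>

lemma dist_Stream_same:
  fixes x y :: "'a::finite stream"
  shows "dist (a ## x) (a ## y) = dist x y / 2"
proof (cases "x = y")
  case False
  have ex: "\<exists>n. x !! n \<noteq> y !! n"
    using False by (metis smap_alt stream.map_id0 id_apply)
  then obtain n where "(a ## x) !! (Suc n) \<noteq> (a ## y) !! (Suc n)"
    by auto
  then have "(LEAST n. (a ## x) !! n \<noteq> (a ## y) !! n) =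
      Suc (LEAST n. (a ## x) !! Suc n \<noteq> (a ## y) !! Suc n)"
    by (intro Least_Suc[of _ "Suc n"]) auto
  then show ?thesis using False by (simp add: dist_stream_def)
qed simp

lemma dist_shift: "dist (w @- x) (w @- y) = (1/2) ^ length w * dist x y"
  for x y :: "'a::finite stream"
  by (induction w) (auto simp: dist_Stream_same)

lemma dist_shift_le: "dist (w @- x) (w @- y) \<le> (1/2) ^ length w"
  for x y :: "'a::finite stream"
  by (simp add: dist_shift mult_left_le dist_stream_le_1)

lemma dist_stream_shd_neq: "shd x \<noteq> shd y \<Longrightarrow> dist x y = 1" for x y :: "'a::finite stream"
  by (metis dist_Stream_neq stream.collapse)

lemma dist_stl_same: "shd x = shd y \<Longrightarrow> dist (stl x) (stl y) = 2 * dist x y"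
  for x y :: "'a::finite stream"
  using dist_Stream_same[of "shd x" "stl x" "stl y"] by (metis (no_types) field_sum_of_halves mult_2 stream.collapse)

lemma dist_stl_le: "dist (stl x) (stl y) \<le> 2 * dist x y" for x y :: "'a::finite stream"
  using dist_stl_same[of x y] dist_stream_shd_neq[of x y] dist_stream_le_1[of "stl x" "stl y"]
  by (cases "shd x = shd y") auto

section \<open>Cylinders, Borel sets and compactness\<close>

abbreviation cyl :: "'a list \<Rightarrow> 'a stream set" where "cyl \<equiv> sstart UNIV"

lemma in_sstart_iff: "x \<in> cyl w \<longleftrightarrow> stake (length w) x = w"
  by (auto simp: sstart_eq list_eq_iff_nth_eq)

lemma shift_in_sstart: "w @- x \<in> cyl w"
  by (simp add: in_sstart_iff stake_shift)

lemma open_sstart: "open (cyl w :: 'a::finite stream set)"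
  unfolding open_dist
proof
  fix x :: "'a stream" assume "x \<in> cyl w"
  then have *: "stake (length w) x = w" by (simp add: in_sstart_iff)
  have "y \<in> cyl w" if "dist y x < (1/2) ^ length w" for y
    using that * dist_stream_le_iff[of y x "length w"] by (simp add: in_sstart_iff)
  then show "\<exists>e>0. \<forall>y. dist y x < e \<longrightarrow> y \<in> cyl w"
    by (intro exI[of _ "(1/2) ^ length w"]) auto
qed

lemma open_stream_contains_sstart:
  fixes U :: "'a::finite stream set"
  assumes "open U" "x \<in> U"
  obtains n where "cyl (stake n x) \<subseteq> U"
proof -
  obtain e where e: "e > 0" "\<And>y. dist y x < e \<Longrightarrow> y \<in> U"
    using assms by (auto simp: open_dist)
  obtain n where n: "(1/2 :: real) ^ n < e"
    using real_arch_pow_inv[of e "1/2"] e by auto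
  have "y \<in> U" if "y \<in> cyl (stake n x)" for y
    using that dist_stream_le_iff[of y x n] n by (intro e) (auto simp: in_sstart_iff)
  then show ?thesis by (intro that[of n]) auto
qed

text \<open>Open sets are unions of cylinders, and there are only countably many finite words;
  conversely cylinders are open. Cylinders thereby become a generator for uniqueness and
  measurability arguments.\<close>

lemma sets_borel_stream:
  "sets (borel :: 'a::finite stream measure) = sets (stream_space (count_space UNIV))"
proof
  have "sigma_sets UNIV {S :: 'a stream set. open S} \<subseteq> sets (stream_space (count_space UNIV))"
  proof (rule sets.sigma_sets_subset[where M="stream_space (count_space UNIV)", simplified space_stream_space, simplified], safe)
    fix U :: "'a stream set" assume U: "open U"
    have "U = (\<Union>w\<in>{w. cyl w \<subseteq> U}. cyl w)"
    proof (intro equalityI subsetI)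
      fix x assume "x \<in> U"
      with U obtain n where "cyl (stake n x) \<subseteq> U"
        by (rule open_stream_contains_sstart)
      moreover have "x \<in> cyl (stake n x)" by (simp add: in_sstart_iff)
      ultimately show "x \<in> (\<Union>w\<in>{w. cyl w \<subseteq> U}. cyl w)" by blast
    qed auto
    also have "\<dots> \<in> sets (stream_space (count_space UNIV))"
      by (intro sets.countable_UN') (auto intro: sets_sstart)
    finally show "U \<in> sets (stream_space (count_space UNIV))" .
  qed
  then show "sets (borel :: 'a stream measure) \<subseteq> sets (stream_space (count_space UNIV))"
    by (simp add: borel_def)
next
  have *: "sets (stream_space (count_space UNIV)) = sigma_sets UNIV (range (sstart (UNIV :: 'a set)) \<union> {{}})"
    by (subst sets_stream_space_sstart) auto
  show "sets (stream_space (count_space UNIV)) \<subseteq> sets (borel :: 'a stream measure)"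
    unfolding * by (rule sets.sigma_sets_subset[where M=borel, simplified]) (auto intro!: borel_open open_sstart)
qed

lemma sigma_sets_sstart:
  "sets (borel :: 'a::finite stream measure) = sigma_sets UNIV (range (sstart (UNIV :: 'a set)) \<union> {{}})"
  unfolding sets_borel_stream by (subst sets_stream_space_sstart) auto

lemma complete_UNIV_stream: "Topological_Spaces.complete (UNIV :: 'a::finite stream set)"
  unfolding complete_def
proof (intro allI impI)
  fix X :: "nat \<Rightarrow> 'a stream"
  assume "(\<forall>n. X n \<in> UNIV) \<and> Cauchy X"
  then have "\<exists>M. \<forall>m\<ge>M. \<forall>n\<ge>M. dist (X m) (X n) < (1/2)^k" for k
    unfolding Cauchy_def by simp
  then have "\<forall>k. \<exists>M. \<forall>m\<ge>M. stake k (X m) = stake k (X M)"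
    by (metis dist_stream_le_iff less_le_not_le order.refl)
  then obtain M where M: "\<And>k m. m \<ge> M k \<Longrightarrow> stake k (X m) = stake k (X (M k))"
    by metis
  define x where "x = to_stream (\<lambda>n. X (M (Suc n)) !! n)"
  have nth: "X m !! i = x !! i" if "m \<ge> M (Suc i)" for m i
    using arg_cong[OF M[OF that], of "\<lambda>l. l ! i"]
    by (simp add: x_def to_stream_def stake_nth del: stake.simps)
  have "X \<longlonglongrightarrow> x"
  proof (rule metric_LIMSEQ_I)
    fix e :: real assume "e > 0"
    then obtain k where k: "(1/2 :: real) ^ k < e"
      using real_arch_pow_inv[of e "1/2"] by auto
    have "dist (X m) x < e" if "m \<ge> Max (M ` {..k})" for m
    proof -
      have "stake k (X m) = stake k x"
        using that by (auto simp: list_eq_iff_nth_eq intro!: nth)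
      then show ?thesis using k dist_stream_le_iff[of "X m" x k] by simp
    qed
    then show "\<exists>no. \<forall>n\<ge>no. dist (X n) x < e" by blast
  qed
  then show "\<exists>l\<in>UNIV. X \<longlonglongrightarrow> l" by blast
qed

lemma compact_UNIV_stream: "compact (UNIV :: 'a::finite stream set)"
  unfolding compact_eq_totally_bounded
proof (intro conjI allI impI complete_UNIV_stream)
  fix e :: real assume "e > 0"
  then obtain k where k: "(1/2 :: real) ^ k < e"
    using real_arch_pow_inv[of e "1/2"] by auto
  let ?K = "(\<lambda>w. w @- undefined) ` {w :: 'a list. length w = k}"
  have "finite ?K"
    using finite_lists_length_eq[of "UNIV :: 'a set" k] by simp
  moreover have "(UNIV :: 'a stream set) \<subseteq> (\<Union>x\<in>?K. ball x e)"
  proof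
    fix x :: "'a stream"
    have "dist (stake k x @- undefined) x < e"
      using k dist_stream_le_iff[of "stake k x @- undefined" x k] by (simp add: stake_shift)
    then show "x \<in> (\<Union>x\<in>?K. ball x e)"
      by (auto intro!: exI[of _ "stake k x"])
  qed
  ultimately show "\<exists>k. finite k \<and> (UNIV :: 'a stream set) \<subseteq> (\<Union>x\<in>k. ball x e)"
    by blast
qed

lemma continuous_on_Stream: "continuous_on S (\<lambda>x. a ## x)" for S :: "'a::finite stream set"
  by (intro lipschitz_on_continuous_on[of "1/2"] lipschitz_onI) (auto simp: dist_Stream_same)

lemma continuous_on_stl: "continuous_on S stl" for S :: "'a::finite stream set"
  by (intro lipschitz_on_continuous_on[of 2] lipschitz_onI) (auto simp: dist_stl_le)

lemma continuous_on_apply_lip: "continuous_on S (apply_lip f)"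
  using apply_lip[of f] lipschitz_on_continuous_on continuous_on_subset by blast

lemma apply_Lip: "\<exists>C. C-lipschitz_on UNIV f \<Longrightarrow> apply_lip (Lip f) = f"
  by (rule Lip_inverse) auto

section \<open>Spectral gap of the transfer operator of a Jacobian\<close>

lemma lipschitz_on_real_iff:
  fixes f :: "'b::metric_space \<Rightarrow> real"
  shows "C-lipschitz_on UNIV f \<longleftrightarrow> 0 \<le> C \<and> (\<forall>x y. \<bar>f x - f y\<bar> \<le> C * dist x y)"
  by (auto simp: lipschitz_on_def dist_real_def)

lemma lipschitz_stream_osc:
  fixes f :: "'a::finite stream \<Rightarrow> real"
  assumes "C-lipschitz_on UNIV f" shows "\<bar>f x - f y\<bar> \<le> C"
proof -
  have "\<bar>f x - f y\<bar> \<le> C * dist x y" "0 \<le> C"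
    using assms by (auto simp: lipschitz_on_real_iff)
  then show ?thesis
    using mult_left_mono[OF dist_stream_le_1[of x y], of C] by simp
qed

text \<open>Points with different prefixes of length \<open>n\<close> are more than
  \<open>(1/2)^n\<close> apart, so an oscillation of at most \<open>D\<close> costs only the factor
  \<open>2^n\<close>.\<close>

lemma lipschitz_locally_constant:
  fixes f :: "'a::finite stream \<Rightarrow> real"
  assumes "\<And>x y. stake n x = stake n y \<Longrightarrow> f x = f y" and D: "\<And>x y. \<bar>f x - f y\<bar> \<le> D"
  shows "(D * 2 ^ n)-lipschitz_on UNIV f"
  unfolding lipschitz_on_real_iff
proof (intro conjI allI)
  have "0 \<le> D" using D[of undefined undefined] by simp
  then show "0 \<le> D * 2 ^ n" by simp
  fix x y :: "'a stream"
  show "\<bar>f x - f y\<bar> \<le> D * 2 ^ n * dist x y"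
  proof (cases "stake n x = stake n y")
    case False
    then have "(1/2) ^ n \<le> dist x y"
      using dist_stream_le_iff[of x y n] by linarith
    then have "1 \<le> 2 ^ n * dist x y"
      by (simp add: field_simps power_one_over)
    then have "D * 1 \<le> D * (2 ^ n * dist x y)"
      using \<open>0 \<le> D\<close> by (intro mult_left_mono)
    then show ?thesis using D[of x y] by (simp add: mult.assoc)
  qed (use assms(1)[of x y] \<open>0 \<le> D\<close> in simp)
qed

lemma lipschitz_indicator_sstart:
  "(2 ^ length w)-lipschitz_on UNIV (indicator (cyl w) :: 'a::finite stream \<Rightarrow> real)"
  using lipschitz_locally_constant[of "length w" "indicator (cyl w) :: 'a stream \<Rightarrow> real" 1]
  by (simp add: in_sstart_iff indicator_def)

section \<open>The averaging operator of a Jacobian\<close>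

locale jacobian =
  fixes J :: "'a::finite lip"
  assumes J: "is_jacobian J"
begin

abbreviation "L \<equiv> transfer_log J"

lemma J_pos: "0 < apply_lip J x"
  using J by (simp add: is_jacobian_def)

lemma J_nonneg: "0 \<le> apply_lip J x"
  using J_pos[of x] by simp

lemma sum_J: "(\<Sum>a\<in>UNIV. apply_lip J (a ## x)) = 1"
  using J by (simp add: is_jacobian_def)

lemma J_le_1: "apply_lip J x \<le> 1"
proof -
  have "apply_lip J (shd x ## stl x) \<le> (\<Sum>a\<in>UNIV. apply_lip J (a ## stl x))"
    by (rule member_le_sum) (auto intro: J_nonneg)
  then show ?thesis by (simp add: sum_J)
qed

lemma J_bounded_below: obtains \<delta> where "0 < \<delta>" "\<delta> \<le> 1" "\<And>x. \<delta> \<le> apply_lip J x"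
proof -
  obtain x where "\<And>y. apply_lip J x \<le> apply_lip J y"
    using continuous_attains_inf[OF compact_UNIV_stream _ continuous_on_apply_lip, of J] by auto
  then show ?thesis using that[of "apply_lip J x"] J_pos J_le_1 by blast
qed

lemma transfer_const: "L (\<lambda>_. c) = (\<lambda>_. c)"
  by (simp add: transfer_log_def fun_eq_iff sum_J flip: sum_distrib_right)

lemma transfer_add: "L (\<lambda>x. f x + g x) = (\<lambda>x. L f x + L g x)"
  by (simp add: transfer_log_def fun_eq_iff sum.distrib algebra_simps)

lemma transfer_diff: "L (\<lambda>x. f x - g x) = (\<lambda>x. L f x - L g x)"
  by (simp add: transfer_log_def fun_eq_iff sum_subtractf algebra_simps)

lemma transfer_cmult: "L (\<lambda>x. c * f x) = (\<lambda>x. c * L f x)"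
  by (simp add: transfer_log_def fun_eq_iff sum_distrib_left algebra_simps)

lemma transfer_mono: "(\<And>x. f x \<le> g x) \<Longrightarrow> L f x \<le> L g x"
  unfolding transfer_log_def by (intro sum_mono mult_left_mono J_nonneg)

lemma iter_const: "(L ^^ n) (\<lambda>_. c) = (\<lambda>_. c)"
  by (induction n) (auto simp: transfer_const)

lemma iter_add: "(L ^^ n) (\<lambda>x. f x + g x) = (\<lambda>x. (L ^^ n) f x + (L ^^ n) g x)"
  by (induction n) (auto simp: transfer_add)

lemma iter_diff: "(L ^^ n) (\<lambda>x. f x - g x) = (\<lambda>x. (L ^^ n) f x - (L ^^ n) g x)"
  by (induction n) (auto simp: transfer_diff)

lemma iter_cmult: "(L ^^ n) (\<lambda>x. c * f x) = (\<lambda>x. c * (L ^^ n) f x)"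
  by (induction n) (auto simp: transfer_cmult)

lemma iter_sum: "finite S \<Longrightarrow> (L ^^ n) (\<lambda>x. \<Sum>i\<in>S. f i x) = (\<lambda>x. \<Sum>i\<in>S. (L ^^ n) (f i) x)"
  by (induction S rule: finite_induct) (simp_all add: iter_const iter_add)

lemma iter_mono: "(\<And>x. f x \<le> g x) \<Longrightarrow> (L ^^ n) f x \<le> (L ^^ n) g x"
  by (induction n arbitrary: x) (auto intro: transfer_mono)

lemma iter_le_const: "(\<And>x. f x \<le> c) \<Longrightarrow> (L ^^ n) f x \<le> c"
  using iter_mono[of f "\<lambda>_. c"] by (simp add: iter_const)

lemma iter_ge_const: "(\<And>x. c \<le> f x) \<Longrightarrow> c \<le> (L ^^ n) f x"
  using iter_mono[of "\<lambda>_. c" f] by (simp add: iter_const)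

lemma iter_abs_le: "(\<And>x. \<bar>f x\<bar> \<le> c) \<Longrightarrow> \<bar>(L ^^ n) f x\<bar> \<le> c"
  using iter_le_const[of f c n x] iter_ge_const[of "- c" f n x] by (simp add: abs_le_iff minus_le_iff)

text \<open>The iterate is a sum of nonnegative terms over words; keeping only the word
  \<open>w\<close>, whose weight is at least \<open>\<delta>\<close> per letter, gives the
  bound.\<close>

lemma iter_lower_bound:
  assumes "0 \<le> \<delta>" "\<And>x. \<delta> \<le> apply_lip J x" and "\<And>x. 0 \<le> f x"
  shows "\<delta> ^ length w * f (w @- x) \<le> (L ^^ length w) f x"
  using assms(3)
proof (induction w arbitrary: f)
  case (Cons a w)
  have Lf: "\<delta> * f (a ## y) \<le> L f y" for y
  proof -
    have "\<delta> * f (a ## y) \<le> apply_lip J (a ## y) * f (a ## y)"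
      by (intro mult_right_mono assms Cons)
    also have "\<dots> \<le> L f y"
      unfolding transfer_log_def
      by (rule member_le_sum) (auto intro!: mult_nonneg_nonneg J_nonneg Cons.prems)
    finally show ?thesis .
  qed
  have "0 \<le> L f y" for y
    unfolding transfer_log_def by (intro sum_nonneg mult_nonneg_nonneg J_nonneg Cons.prems)
  then have "\<delta> ^ length w * L f (w @- x) \<le> (L ^^ length w) (L f) x"
    by (rule Cons.IH)
  moreover have "\<delta> ^ length w * (\<delta> * f (a ## w @- x)) \<le> \<delta> ^ length w * L f (w @- x)"
    by (intro mult_left_mono Lf) (simp add: assms)
  ultimately show ?case
    by (simp add: funpow_swap1 mult.assoc mult.left_commute)
qed simp

text \<open>Lasota-Yorke inequality with the oscillation as weak seminorm: the inverse branches
  halve the Lipschitz constant, and the variation of \<open>J\<close> costs a multiple of the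
  oscillation.\<close>

lemma transfer_lasota_yorke:
  obtains K where "1 \<le> K"
    "\<And>f C D. C-lipschitz_on UNIV f \<Longrightarrow> (\<And>x y. f x - f y \<le> D) \<Longrightarrow> (C / 2 + K * D)-lipschitz_on UNIV (L f)"
proof -
  obtain KJ where KJ: "0 \<le> KJ" "\<And>x y. \<bar>apply_lip J x - apply_lip J y\<bar> \<le> KJ * dist x y"
    using lip_diff_le by blast
  define K where "K = 1 + real CARD('a) * KJ"
  have "(C / 2 + K * D)-lipschitz_on UNIV (L f)"
    if f: "C-lipschitz_on UNIV f" and D: "\<And>x y. f x - f y \<le> D" for f C D
    unfolding lipschitz_on_real_iff
  proof (intro conjI allI)
    have C: "0 \<le> C" "\<And>x y. \<bar>f x - f y\<bar> \<le> C * dist x y"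
      using f by (auto simp: lipschitz_on_real_iff)
    have D0: "0 \<le> D" using D[of undefined undefined] by simp
    show "0 \<le> C / 2 + K * D"
      using C D0 KJ by (simp add: K_def)
    fix x y
    let ?z = "undefined :: 'a stream"
    \<comment> \<open>The weights sum to one at \<open>x\<close> and at \<open>y\<close>, so
      subtracting \<open>f ?z\<close> changes nothing; this is why an oscillation appears instead of
      a sup norm.\<close>
    have "L f x - L f y = (\<Sum>a\<in>UNIV. apply_lip J (a ## x) * (f (a ## x) - f ?z)) - (\<Sum>a\<in>UNIV. apply_lip J (a ## y) * (f (a ## y) - f ?z))"
      by (simp add: transfer_log_def right_diff_distrib sum_subtractf sum_J flip: sum_distrib_right)
    also have "\<dots> = (\<Sum>a\<in>UNIV. apply_lip J (a ## x) * (f (a ## x) - f (a ## y))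
        + (apply_lip J (a ## x) - apply_lip J (a ## y)) * (f (a ## y) - f ?z))"
      by (simp add: algebra_simps sum_subtractf sum.distrib)
    finally have "\<bar>L f x - L f y\<bar> \<le> (\<Sum>a\<in>UNIV. \<bar>apply_lip J (a ## x) * (f (a ## x) - f (a ## y))
        + (apply_lip J (a ## x) - apply_lip J (a ## y)) * (f (a ## y) - f ?z)\<bar>)"
      by simp
    also have "\<dots> \<le> (\<Sum>a\<in>UNIV. apply_lip J (a ## x) * (C * (dist x y / 2)) + KJ * (dist x y / 2) * D)"
    proof (rule sum_mono)
      fix a
      have "\<bar>apply_lip J (a ## x) * (f (a ## x) - f (a ## y))\<bar> \<le> apply_lip J (a ## x) * (C * (dist x y / 2))"
        using C(2)[of "a ## x" "a ## y"] J_pos[of "a ## x"]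
        by (simp add: abs_mult dist_Stream_same)
      moreover have "\<bar>(apply_lip J (a ## x) - apply_lip J (a ## y)) * (f (a ## y) - f ?z)\<bar> \<le> KJ * (dist x y / 2) * D"
        unfolding abs_mult using KJ(2)[of "a ## x" "a ## y"] D[of "a ## y" ?z] D[of ?z "a ## y"] D0 KJ(1)
        by (intro mult_mono) (auto simp: dist_Stream_same)
      ultimately show "\<bar>apply_lip J (a ## x) * (f (a ## x) - f (a ## y)) + (apply_lip J (a ## x) - apply_lip J (a ## y)) * (f (a ## y) - f ?z)\<bar>
          \<le> apply_lip J (a ## x) * (C * (dist x y / 2)) + KJ * (dist x y / 2) * D"
        by linarith
    qed
    also have "\<dots> = C * (dist x y / 2) + real CARD('a) * KJ * D * (dist x y / 2)"
      by (simp only: sum.distrib sum_J sum_constant flip: sum_distrib_right) simp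
    also have "\<dots> \<le> (C / 2 + K * D) * dist x y"
    proof -
      have "0 \<le> real CARD('a) * KJ * D * dist x y" "0 \<le> D * dist x y"
        using KJ D0 by simp_all
      then show ?thesis by (simp add: K_def algebra_simps)
    qed
    finally show "\<bar>L f x - L f y\<bar> \<le> (C / 2 + K * D) * dist x y" .
  qed
  then show ?thesis
    using KJ by (intro that[of K]) (auto simp: K_def)
qed

text \<open>Doeblin minorisation: a branch \<open>w\<close> common to \<open>x\<close> and
  \<open>y\<close> has weight at least \<open>\<delta>^n\<close> in both averages. On it the values
  of \<open>f\<close> differ by at most \<open>C (1/2)^n\<close>, and only the remaining mass can
  see the full oscillation.\<close>

lemma iter_osc:
  assumes "0 \<le> \<delta>" "\<And>x. \<delta> \<le> apply_lip J x"
    and f: "C-lipschitz_on UNIV f" and D: "\<And>x y. f x - f y \<le> D"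
  shows "(L ^^ n) f x - (L ^^ n) f y \<le> (1 - \<delta> ^ n) * D + \<delta> ^ n * (1/2) ^ n * C"
proof -
  have bdd: "bdd_above (range f)" "bdd_below (range f)"
    using D[of _ undefined] D[of undefined] by (auto intro!: bdd_aboveI2[of _ _ "f undefined + D"]
      bdd_belowI2[of _ "f undefined - D"] simp: algebra_simps)
  define M where "M = Sup (range f)"
  define m where "m = Inf (range f)"
  have M: "f x \<le> M" and m: "m \<le> f x" for x
    unfolding M_def m_def using bdd by (auto intro: cSUP_upper cINF_lower)
  have "f x \<le> m + D" for x
    unfolding m_def using D[of x] by (subst diff_le_eq[symmetric], intro cINF_greatest) (auto simp: algebra_simps)
  then have MD: "M - m \<le> D"
    unfolding M_def diff_le_eq by (intro cSUP_least) (auto simp: algebra_simps)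
  define w where "w = replicate n (undefined :: 'a)"
  have w: "length w = n" by (simp add: w_def)
  have 1: "(L ^^ n) f x \<le> M - \<delta> ^ n * (M - f (w @- x))"
    using iter_lower_bound[of \<delta> "\<lambda>x. M - f x" w x] assms M by (simp add: iter_diff iter_const w)
  have 2: "m + \<delta> ^ n * (f (w @- y) - m) \<le> (L ^^ n) f y"
    using iter_lower_bound[of \<delta> "\<lambda>x. f x - m" w y] assms m by (simp add: iter_diff iter_const w)
  have "\<bar>f (w @- x) - f (w @- y)\<bar> \<le> C * dist (w @- x) (w @- y)" "0 \<le> C"
    using f by (auto simp: lipschitz_on_real_iff)
  then have 3: "f (w @- x) - f (w @- y) \<le> C * (1/2) ^ n"
    using mult_left_mono[OF dist_shift_le[of w x y], of C] w by auto
  have "\<delta> ^ n \<le> 1"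
    using assms(1) order.trans[OF assms(2) J_le_1] by (intro power_le_one)
  then have "(1 - \<delta> ^ n) * (M - m) \<le> (1 - \<delta> ^ n) * D"
    using MD by (intro mult_left_mono) auto
  moreover have "\<delta> ^ n * (f (w @- x) - f (w @- y)) \<le> \<delta> ^ n * (C * (1/2) ^ n)"
    using 3 assms by (intro mult_left_mono) auto
  ultimately show ?thesis using 1 2 by (simp add: algebra_simps)
qed

text \<open>Oscillation \<open>D\<close> and Lipschitz constant \<open>C\<close> each contract up to
  a leak from the other. For large \<open>n\<close> and suitably small \<open>\<epsilon>\<close> the
  combination \<open>D + \<epsilon> C\<close> contracts strictly under \<open>L^n\<close>.\<close>

theorem spectral_gap:
  obtains C \<rho> where "0 \<le> C" "0 < \<rho>" "\<rho> < 1"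
    "\<And>f M n. M-lipschitz_on UNIV f \<Longrightarrow> (C * \<rho> ^ n * M)-lipschitz_on UNIV ((L ^^ n) f)"
proof -
  obtain \<delta> where \<delta>: "0 < \<delta>" "\<delta> \<le> 1" "\<And>x. \<delta> \<le> apply_lip J x"
    using J_bounded_below by blast
  obtain K where K: "1 \<le> K"
    "\<And>f C D. C-lipschitz_on UNIV f \<Longrightarrow> (\<And>x y. f x - f y \<le> D) \<Longrightarrow> (C / 2 + K * D)-lipschitz_on UNIV (L f)"
    using transfer_lasota_yorke by blast
  define bnd where "bnd D C f \<longleftrightarrow> C-lipschitz_on UNIV f \<and> (\<forall>x y. f x - f y \<le> D)" for D C and f :: "'a stream \<Rightarrow> real"
  have bnd_D: "0 \<le> D" if "bnd D C f" for D C f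
    using that by (auto simp: bnd_def dest!: spec[of _ undefined])
  have bnd_C: "0 \<le> C" if "bnd D C f" for D C f
    using that by (auto simp: bnd_def lipschitz_on_def)
  have iter: "((1/2) ^ n * C + 2 * K * D)-lipschitz_on UNIV ((L ^^ n) f)"
    "\<And>x y. (L ^^ n) f x - (L ^^ n) f y \<le> D" if f: "bnd D C f" for n D C f
  proof (induction n)
    case 0
    have "C \<le> C + 2 * K * D" using bnd_D[OF f] K by simp
    then show "((1/2) ^ 0 * C + 2 * K * D)-lipschitz_on UNIV ((L ^^ 0) f)"
      using f by (auto simp: bnd_def intro: lipschitz_on_mono)
    show "(L ^^ 0) f x - (L ^^ 0) f y \<le> D" for x y
      using f by (simp add: bnd_def)
  next
    case (Suc n)
    have "(((1/2) ^ n * C + 2 * K * D) / 2 + K * D)-lipschitz_on UNIV ((L ^^ Suc n) f)"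
      using K(2)[OF Suc.IH(1,2)] by simp
    then show "((1/2) ^ Suc n * C + 2 * K * D)-lipschitz_on UNIV ((L ^^ Suc n) f)"
      by (simp add: field_simps)
    fix x y
    have "(L ^^ Suc n) f x \<le> (L ^^ n) f z + D" for z
      using iter_le_const[of "(L ^^ n) f" "(L ^^ n) f z + D" 1 x] Suc.IH(2)[of _ z]
      by (simp add: algebra_simps)
    then have "(L ^^ Suc n) f x - D \<le> (L ^^ n) f z" for z
      by (simp add: algebra_simps)
    from iter_ge_const[of "(L ^^ Suc n) f x - D" "(L ^^ n) f" 1 y, OF this]
    show "(L ^^ Suc n) f x - (L ^^ Suc n) f y \<le> D"
      by (simp add: algebra_simps)
  qed
  \<comment> \<open>This makes \<open>(4 K + 1) (1/2)^n\<close> at most \<open>1/2\<close>. The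
    \<open>4 K\<close> is \<open>\<delta>^n / \<epsilon>\<close>: it arises when the leak
    \<open>\<delta>^n (1/2)^n C\<close> is rewritten as a multiple of
    \<open>\<epsilon> C\<close>.\<close>
  obtain n :: nat where n: "(1/2) ^ n < 1 / (2 * (4 * K + 1))"
    using real_arch_pow_inv[of "1 / (2 * (4 * K + 1))" "1/2"] K by auto
  have n_pos: "n > 0"
    using n K by (cases n) auto
  \<comment> \<open>With this choice the leak \<open>\<epsilon> 2 K D\<close> consumes exactly half
    of the gain \<open>\<delta>^n D\<close>, which leaves
    \<open>\<theta> = 1 - \<delta>^n / 2\<close>.\<close>
  define \<epsilon> where "\<epsilon> = \<delta> ^ n / (4 * K)"
  define \<theta> where "\<theta> = 1 - \<delta> ^ n / 2"
  have \<delta>n: "0 < \<delta> ^ n" "\<delta> ^ n \<le> 1" using \<delta> by (auto intro: power_le_one)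
  have \<epsilon>: "0 < \<epsilon>" using \<delta>n K by (simp add: \<epsilon>_def)
  have \<theta>: "1/2 \<le> \<theta>" "\<theta> < 1" using \<delta>n by (auto simp: \<theta>_def)
  have step: "\<exists>D' C'. bnd D' C' ((L ^^ n) f) \<and> D' + \<epsilon> * C' \<le> \<theta> * (D + \<epsilon> * C)" if f: "bnd D C f" for D C f
  proof (intro exI conjI)
    show "bnd ((1 - \<delta> ^ n) * D + \<delta> ^ n * (1/2) ^ n * C) ((1/2) ^ n * C + 2 * K * D) ((L ^^ n) f)"
      using iter(1)[OF f, of n] iter_osc[of \<delta> C f D n] \<delta> f by (auto simp: bnd_def)
    have "\<epsilon> * (2 * K * D) = \<delta> ^ n / 2 * D" "\<delta> ^ n = 4 * K * \<epsilon>"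
      using K by (simp_all add: \<epsilon>_def)
    then have "(1 - \<delta> ^ n) * D + \<delta> ^ n * (1/2) ^ n * C + \<epsilon> * ((1/2) ^ n * C + 2 * K * D)
        = \<theta> * D + (4 * K + 1) * (1/2) ^ n * (\<epsilon> * C)"
      by (simp add: \<theta>_def algebra_simps)
    also have "\<dots> \<le> \<theta> * D + 1/2 * (\<epsilon> * C)"
    proof -
      have "(4 * K + 1) * (1/2) ^ n \<le> 1/2"
        using n K by (simp add: field_simps)
      then show ?thesis
        using \<epsilon> bnd_C[OF f] by (intro add_left_mono mult_right_mono) auto
    qed
    also have "\<dots> \<le> \<theta> * D + \<theta> * (\<epsilon> * C)"
      using \<theta> \<epsilon> bnd_C[OF f] by (intro add_left_mono mult_right_mono) auto
    finally show "(1 - \<delta> ^ n) * D + \<delta> ^ n * (1/2) ^ n * C + \<epsilon> * ((1/2) ^ n * C + 2 * K * D) \<le> \<theta> * (D + \<epsilon> * C)"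
      by (simp add: algebra_simps)
  qed
  have steps: "\<exists>D' C'. bnd D' C' ((L ^^ (n * k)) f) \<and> D' + \<epsilon> * C' \<le> \<theta> ^ k * (D + \<epsilon> * C)" if f: "bnd D C f" for D C f k
  proof (induction k)
    case (Suc k)
    then obtain D1 C1 where 1: "bnd D1 C1 ((L ^^ (n * k)) f)" "D1 + \<epsilon> * C1 \<le> \<theta> ^ k * (D + \<epsilon> * C)"
      by blast
    obtain D2 C2 where 2: "bnd D2 C2 ((L ^^ n) ((L ^^ (n * k)) f))" "D2 + \<epsilon> * C2 \<le> \<theta> * (D1 + \<epsilon> * C1)"
      using step[OF 1(1)] by blast
    have "\<theta> * (D1 + \<epsilon> * C1) \<le> \<theta> * (\<theta> ^ k * (D + \<epsilon> * C))"
      using 1 \<theta> by (intro mult_left_mono) auto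
    with 2 show ?case
      by (intro exI[of _ D2] exI[of _ C2]) (auto simp: funpow_add mult.assoc)
  qed (use f in auto)
  define \<rho> where "\<rho> = root n \<theta>"
  have \<rho>: "0 < \<rho>" "\<rho> < 1" "\<rho> ^ n = \<theta>"
    using \<theta> n_pos by (auto simp: \<rho>_def)
  define B where "B = (1 + \<epsilon> * (1 + 2 * K)) / \<epsilon>"
  have B: "0 \<le> B" using \<epsilon> K by (simp add: B_def)
  have "(B / \<theta> * \<rho> ^ m * M)-lipschitz_on UNIV ((L ^^ m) f)" if f: "M-lipschitz_on UNIV f" for f M m
  proof -
    have M: "0 \<le> M" using f by (auto simp: lipschitz_on_def)
    define r where "r = m mod n"
    define k where "k = m div n"
    have bf: "bnd M M f"
      using f lipschitz_stream_osc[OF f] by (auto simp: bnd_def abs_le_iff)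
    have "((1/2) ^ r * M + 2 * K * M) \<le> (1 + 2 * K) * M"
      using M mult_right_mono[of "(1/2) ^ r" 1 M] by (simp add: algebra_simps power_le_one)
    then have "bnd M ((1 + 2 * K) * M) ((L ^^ r) f)"
      using iter[OF bf, of r] by (auto simp: bnd_def intro: lipschitz_on_mono)
    from steps[OF this, of k] obtain D' C' where
      *: "bnd D' C' ((L ^^ (n * k)) ((L ^^ r) f))" "D' + \<epsilon> * C' \<le> \<theta> ^ k * (M + \<epsilon> * ((1 + 2 * K) * M))"
      by blast
    have eq: "(L ^^ (n * k)) ((L ^^ r) f) = (L ^^ m) f"
      unfolding comp_apply[symmetric, of "L ^^ (n * k)"] funpow_add[symmetric] by (simp add: r_def k_def)
    \<comment> \<open>The incomplete block of \<open>r < n\<close> steps costs at most one factor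
      \<open>\<theta>\<close>, since \<open>\<rho>^r\<close> is at least
      \<open>\<rho>^n = \<theta>\<close>.\<close>
    have "\<theta> ^ k * \<theta> \<le> \<rho> ^ m"
    proof -
      have "m = n * k + r" by (simp add: r_def k_def)
      then have "\<rho> ^ m = \<theta> ^ k * \<rho> ^ r"
        by (simp add: power_add power_mult \<rho>)
      moreover have "\<theta> \<le> \<rho> ^ r"
        unfolding \<rho>(3)[symmetric] using \<rho> n_pos by (intro power_decreasing) (auto simp: r_def less_imp_le)
      ultimately show ?thesis using \<theta> by (simp add: mult_left_mono)
    qed
    then have le: "\<theta> ^ k \<le> \<rho> ^ m / \<theta>"
      using \<theta> by (simp add: field_simps)
    have "\<epsilon> * C' \<le> \<theta> ^ k * (M + \<epsilon> * ((1 + 2 * K) * M))"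
      using *(2) bnd_D[OF *(1)] by linarith
    also have "\<dots> = \<epsilon> * (\<theta> ^ k * B * M)"
      using \<epsilon> by (simp add: B_def field_simps)
    finally have "C' \<le> \<theta> ^ k * B * M"
      using \<epsilon> by simp
    also have "\<dots> \<le> \<rho> ^ m / \<theta> * B * M"
      using le B M by (intro mult_right_mono)
    finally show ?thesis
      using *(1) unfolding eq bnd_def by (auto intro: lipschitz_on_mono simp: mult.commute mult.left_commute)
  qed
  then show ?thesis
    using \<rho> B \<theta> by (intro that[of "B / \<theta>" \<rho>]) auto
qed

end

section \<open>The measure of a Jacobian\<close>

lemma zero_if_abs_le_double:
  fixes x :: real
  assumes "\<And>e. 0 < e \<Longrightarrow> \<bar>x\<bar> \<le> 2 * e" shows "x = 0"
  using assms[of "\<bar>x\<bar> / 4"] by (cases "x = 0") auto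

lemma geometric_null: "0 < r \<Longrightarrow> r < 1 \<Longrightarrow> (\<lambda>n. C * r ^ n * M) \<longlonglongrightarrow> 0" for r :: real
  using LIMSEQ_realpow_zero[of r] by (auto intro!: tendsto_mult_left_zero tendsto_mult_right_zero)

lemma bounded_continuous_stream:
  fixes f :: "'a::finite stream \<Rightarrow> real"
  assumes "continuous_on UNIV f" obtains B where "0 \<le> B" "\<And>x. \<bar>f x\<bar> \<le> B"
proof -
  have "continuous_on UNIV (\<lambda>x. \<bar>f x\<bar>)"
    using assms by (intro continuous_intros)
  then obtain x where "\<And>y. \<bar>f y\<bar> \<le> \<bar>f x\<bar>"
    using continuous_attains_sup[OF compact_UNIV_stream UNIV_not_empty, of "\<lambda>x. \<bar>f x\<bar>"] by auto
  then show ?thesis by (intro that[of "\<bar>f x\<bar>"]) auto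
qed

lemma integrable_continuous_stream:
  fixes f :: "'a::finite stream \<Rightarrow> real"
  assumes "finite_measure \<mu>" "sets \<mu> = sets borel" "continuous_on UNIV f"
  shows "integrable \<mu> f"
proof -
  interpret finite_measure \<mu> by fact
  obtain B where "\<And>x. \<bar>f x\<bar> \<le> B"
    using bounded_continuous_stream[OF assms(3)] by blast
  moreover have "f \<in> borel_measurable \<mu>"
    using borel_measurable_continuous_onI[OF assms(3)] assms(2) by (simp cong: measurable_cong_sets)
  ultimately show ?thesis
    by (intro integrable_const_bound[of _ B]) auto
qed

lemma continuous_on_lipschitz: "C-lipschitz_on UNIV f \<Longrightarrow> continuous_on UNIV f"
  by (rule lipschitz_on_continuous_on)

lemma cylinder_approximation:
  fixes f :: "'a::finite stream \<Rightarrow> real"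
  assumes "continuous_on UNIV f" "0 < e"
  obtains n where "\<And>x. \<bar>f x - f (stake n x @- z)\<bar> < e"
proof -
  obtain d where d: "d > 0" "\<And>x y. x \<in> UNIV \<Longrightarrow> y \<in> UNIV \<Longrightarrow> dist y x < d \<Longrightarrow> dist (f y) (f x) < e"
    by (rule uniformly_continuous_onE[OF compact_uniformly_continuous[OF assms(1) compact_UNIV_stream] assms(2)]) blast
  obtain n where n: "(1/2 :: real) ^ n < d"
    using real_arch_pow_inv[of d "1/2"] d by auto
  have "dist x (stake n x @- z) < d" for x
    using dist_stream_le_iff[of x "stake n x @- z" n] n by (simp add: stake_shift)
  from d(2)[OF UNIV_I UNIV_I this] have "\<bar>f x - f (stake n x @- z)\<bar> < e" for x
    by (simp add: dist_real_def)
  then show ?thesis by (rule that)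
qed

lemma lipschitz_cylinder_function:
  fixes f :: "'a::finite stream \<Rightarrow> real"
  assumes "continuous_on UNIV f"
  shows "\<exists>C. C-lipschitz_on UNIV (\<lambda>x. f (stake n x @- z))"
proof -
  obtain B where B: "\<And>x. \<bar>f x\<bar> \<le> B"
    using bounded_continuous_stream[OF assms] by blast
  have "\<bar>f x - f y\<bar> \<le> 2 * B" for x y
    using B[of x] B[of y] by linarith
  then have "(2 * B * 2 ^ n)-lipschitz_on UNIV (\<lambda>x. f (stake n x @- z))"
    by (intro lipschitz_locally_constant) (simp_all only:)
  then show ?thesis by blast
qed

lemma cylinder_function_eq_sum:
  fixes f :: "'a::finite stream \<Rightarrow> real"
  shows "f (stake n x @- z) = (\<Sum>w | length w = n. f (w @- z) * indicator (cyl w) x)"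
proof -
  have "(\<Sum>w | length w = n. f (w @- z) * indicator (cyl w) x)
      = (\<Sum>w | length w = n. if w = stake n x then f (w @- z) else 0)"
    by (intro sum.cong) (auto simp: in_sstart_iff)
  then show ?thesis
    using finite_lists_length_eq[of "UNIV :: 'a set" n] by simp
qed

lemma indicator_sstart_split:
  "indicator (cyl w) x = (\<Sum>a\<in>UNIV. indicator (cyl (w @ [a])) (x :: 'a::finite stream) :: real)"
proof -
  have "(\<Sum>a\<in>UNIV. indicator (cyl (w @ [a])) x :: real)
     = (\<Sum>a\<in>UNIV. if a = x !! length w then indicator (cyl w) x else 0)"
  proof (intro sum.cong refl)
    fix a
    have "x \<in> cyl (w @ [a]) \<longleftrightarrow> x \<in> cyl w \<and> x !! length w = a"
      by (simp add: in_sstart_iff stake_Suc del: stake.simps)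
    then show "(indicator (cyl (w @ [a])) x :: real) = (if a = x !! length w then indicator (cyl w) x else 0)"
      by (auto simp: indicator_def)
  qed
  then show ?thesis by simp
qed

section \<open>Probability measures with prescribed cylinder masses\<close>

primrec sample_word :: "('a list \<Rightarrow> 'a) \<Rightarrow> nat \<Rightarrow> 'a list" where
  "sample_word s 0 = []"
| "sample_word s (Suc n) = sample_word s n @ [s (sample_word s n)]"

definition sample_path :: "('a list \<Rightarrow> 'a) \<Rightarrow> 'a stream" where
  "sample_path s = to_stream (\<lambda>n. s (sample_word s n))"

lemma stake_sample_path: "stake n (sample_path s) = sample_word s n"
  by (induction n) (simp_all add: stake_Suc sample_path_def to_stream_def del: stake.simps(2))

text \<open>Membership constrains the rule \<open>s\<close> only at the finitely many proper
  prefixes of \<open>w\<close>, so a cylinder pulls back to a finite-dimensional product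
  event.\<close>

lemma sample_path_in_sstart:
  "sample_path s \<in> cyl w \<longleftrightarrow> (\<forall>i<length w. s (take i w) = w ! i)"
proof
  assume "sample_path s \<in> cyl w"
  then have *: "sample_word s (length w) = w"
    by (simp add: in_sstart_iff stake_sample_path)
  have take: "sample_word s i = take i w" if "i \<le> length w" for i
    using arg_cong[OF *, of "take i"] that
    unfolding stake_sample_path[symmetric] take_stake by (simp add: min_def)
  have "s (take i w) = w ! i" if "i < length w" for i
    using take[of "Suc i"] take[of i] that by (simp add: take_Suc_conv_app_nth)
  then show "\<forall>i<length w. s (take i w) = w ! i"
    by blast
next
  assume *: "\<forall>i<length w. s (take i w) = w ! i"
  have "sample_word s i = take i w" if "i \<le> length w" for i
    using that by (induction i) (simp_all add: * take_Suc_conv_app_nth)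
  from this[of "length w"] show "sample_path s \<in> cyl w"
    by (simp add: in_sstart_iff stake_sample_path)
qed

text \<open>
  Independently for every word \<open>w\<close>, draw a letter from the conditional distribution of the next
  letter given \<open>w\<close>; the letters met along the path then have the prescribed cylinder masses.
\<close>

lemma cylinder_measure_exists:
  fixes m :: "'a::finite list \<Rightarrow> real"
  assumes m0: "m [] = 1" and pos: "\<And>w. 0 < m w" and split: "\<And>w. m w = (\<Sum>a\<in>UNIV. m (w @ [a]))"
  shows "\<exists>\<mu>. prob_space \<mu> \<and> sets \<mu> = sets borel \<and> (\<forall>w. measure \<mu> (cyl w) = m w)"
proof -
  define K where "K w = embed_pmf (\<lambda>a. m (w @ [a]) / m w)" for w
  have K: "pmf (K w) a = m (w @ [a]) / m w" for w a
    unfolding K_def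
  proof (rule pmf_embed_pmf)
    show "0 \<le> m (w @ [a]) / m w" for a
      using pos by (simp add: less_imp_le)
    have "(\<Sum>a\<in>UNIV. m (w @ [a]) / m w) = 1"
      using split[of w] pos[of w] by (simp flip: sum_divide_distrib)
    then show "(\<integral>\<^sup>+ a. ennreal (m (w @ [a]) / m w) \<partial>count_space UNIV) = 1"
      using pos by (simp add: nn_integral_count_space_finite sum_ennreal less_imp_le)
  qed
  let ?M = "\<lambda>w. measure_pmf (K w)"
  interpret product_prob_space ?M UNIV
    by unfold_locales
  let ?P = "PiM UNIV ?M"
  have vimage: "sample_path -` cyl w \<inter> space ?P
      = prod_emb UNIV ?M ((\<lambda>i. take i w) ` {..<length w}) (PiE ((\<lambda>i. take i w) ` {..<length w}) (\<lambda>u. {w ! length u}))" for w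
    by (auto simp: sample_path_in_sstart prod_emb_def space_PiM restrict_def PiE_def extensional_def Pi_def)
  have sets: "sample_path -` cyl w \<inter> space ?P \<in> sets ?P" for w
    unfolding vimage by (intro sets_PiM_I) auto
  have meas: "sample_path \<in> measurable ?P borel"
  proof (rule measurable_sigma_sets[OF sigma_sets_sstart])
    show "sample_path -` A \<inter> space ?P \<in> sets ?P" if "A \<in> range (cyl) \<union> {{}}" for A
      using that sets by auto
  qed auto
  let ?\<mu> = "distr ?P borel sample_path"
  have "measure ?\<mu> (cyl w) = m w" for w
  proof -
    \<comment> \<open>Distinct prefixes are distinct coordinates of the product, so the mass of the
      cylinder is a product over positions; it telescopes to \<open>m w\<close>.\<close>
    have inj: "inj_on (\<lambda>i. take i w) {..<length w}"
      by (rule inj_on_inverseI[of _ length]) auto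
    have ne: "m u \<noteq> 0" for u using pos[of u] by simp
    have tel: "k \<le> length w \<Longrightarrow> (\<Prod>i<k. m (take (Suc i) w) / m (take i w)) = m (take k w)" for k
      by (induction k) (simp_all add: m0 ne)
    have "emeasure ?\<mu> (cyl w) = emeasure ?P (sample_path -` cyl w \<inter> space ?P)"
      by (intro emeasure_distr meas) (auto intro: borel_open open_sstart)
    also have "\<dots> = (\<Prod>u\<in>(\<lambda>i. take i w) ` {..<length w}. emeasure (?M u) {w ! length u})"
      unfolding vimage by (rule emeasure_PiM_emb) auto
    also have "\<dots> = (\<Prod>i<length w. emeasure (?M (take i w)) {w ! i})"
      by (simp add: prod.reindex[OF inj])
    also have "\<dots> = (\<Prod>i<length w. ennreal (m (take (Suc i) w) / m (take i w)))"
      by (intro prod.cong) (auto simp: emeasure_pmf_single K take_Suc_conv_app_nth)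
    also have "\<dots> = ennreal (\<Prod>i<length w. m (take (Suc i) w) / m (take i w))"
      using pos by (intro prod_ennreal) (auto simp: less_imp_le)
    also have "\<dots> = ennreal (m w)"
      using tel[of "length w"] by simp
    finally show ?thesis
      using pos[of w] by (simp add: measure_def)
  qed
  moreover have "prob_space ?\<mu>"
    by (rule P.prob_space_distr[OF meas])
  ultimately show ?thesis
    by (intro exI[of _ ?\<mu>]) simp
qed

lemma continuous_on_branch:
  "continuous_on UNIV f \<Longrightarrow> continuous_on UNIV (\<lambda>x. f (a ## x))" for a :: "'a::finite"
  by (rule continuous_on_compose2[OF _ continuous_on_Stream]) auto

lemma (in prob_space) integral_diff_le:
  fixes f g :: "'a \<Rightarrow> real"
  assumes "integrable M f" "integrable M g" "\<And>x. \<bar>f x - g x\<bar> \<le> e"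
  shows "\<bar>(\<integral>x. f x \<partial>M) - (\<integral>x. g x \<partial>M)\<bar> \<le> e"
proof -
  have "\<bar>(\<integral>x. f x - g x \<partial>M)\<bar> \<le> (\<integral>x. \<bar>f x - g x\<bar> \<partial>M)"
    by (rule integral_abs_bound)
  also have "\<dots> \<le> (\<integral>x. e \<partial>M)"
    using assms by (intro integral_mono) auto
  finally show ?thesis
    using assms by (simp add: prob_space)
qed

section \<open>Limits of iterated averages and the measure representing them\<close>

context jacobian
begin

text \<open>For \<open>m \<ge> n\<close>, \<open>L^m f\<close> averages values of
  \<open>L^n f\<close> and so stays within the oscillation of \<open>L^n f\<close>, which decays
  exponentially. Hence the iterates are Cauchy, with a limit independent of the point.\<close>

lemma iter_tendsto:
  assumes f: "M-lipschitz_on UNIV f"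
  shows "\<exists>c. \<forall>x. (\<lambda>n. (L ^^ n) f x) \<longlonglongrightarrow> c"
proof -
  obtain C \<rho> where C: "0 \<le> C" "0 < \<rho>" "\<rho> < 1"
    "\<And>f M n. M-lipschitz_on UNIV f \<Longrightarrow> (C * \<rho> ^ n * M)-lipschitz_on UNIV ((L ^^ n) f)"
    using spectral_gap by blast
  have bound: "\<bar>(L ^^ m) f x - (L ^^ n) f y\<bar> \<le> C * \<rho> ^ n * M" if "n \<le> m" for m n x y
  proof -
    have "\<bar>(L ^^ n) f z - (L ^^ n) f y\<bar> \<le> C * \<rho> ^ n * M" for z
      using lipschitz_stream_osc[OF C(4)[OF f]] .
    then have "\<bar>(L ^^ (m - n)) (\<lambda>z. (L ^^ n) f z - (L ^^ n) f y) x\<bar> \<le> C * \<rho> ^ n * M"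
      by (rule iter_abs_le)
    moreover have "(L ^^ (m - n)) ((L ^^ n) f) = (L ^^ m) f"
      unfolding comp_apply[symmetric, of "L ^^ (m - n)"] funpow_add[symmetric] using that by simp
    ultimately show ?thesis by (simp add: iter_diff iter_const)
  qed
  have lim0: "(\<lambda>n. C * \<rho> ^ n * M) \<longlonglongrightarrow> 0"
    using C by (intro geometric_null)
  have "Cauchy (\<lambda>n. (L ^^ n) f undefined)"
  proof (rule metric_CauchyI)
    fix e :: real assume "0 < e"
    then obtain N where N: "\<And>n. n \<ge> N \<Longrightarrow> C * \<rho> ^ n * M < e"
      using order_tendstoD(2)[OF lim0] by (auto simp: eventually_sequentially)
    have "dist ((L ^^ m) f undefined) ((L ^^ n) f undefined) < e" if "m \<ge> N" "n \<ge> N" for m n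
      using bound[of n m undefined undefined] bound[of m n undefined undefined] N[OF that(1)] N[OF that(2)]
      by (cases "n \<le> m") (auto simp: dist_real_def abs_minus_commute)
    then show "\<exists>N. \<forall>m\<ge>N. \<forall>n\<ge>N. dist ((L ^^ m) f undefined) ((L ^^ n) f undefined) < e" by blast
  qed
  then obtain c where c: "(\<lambda>n. (L ^^ n) f undefined) \<longlonglongrightarrow> c"
    by (auto simp: Cauchy_convergent_iff convergent_def)
  have "(\<lambda>n. (L ^^ n) f x) \<longlonglongrightarrow> c" for x
  proof -
    have "(\<lambda>n. (L ^^ n) f x - (L ^^ n) f undefined) \<longlonglongrightarrow> 0"
      by (rule Lim_null_comparison[OF _ lim0]) (auto intro!: always_eventually bound)
    from tendsto_add[OF this c] show ?thesis by simp
  qed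
  then show ?thesis by blast
qed

text \<open>For Lipschitz \<open>f\<close> the limit is the same at every point and will be the
  integral of \<open>f\<close>; it is available before the invariant measure is.\<close>

definition lim_functional :: "('a stream \<Rightarrow> real) \<Rightarrow> real" where
  "lim_functional f = lim (\<lambda>n. (L ^^ n) f undefined)"

lemma lim_functional:
  assumes "M-lipschitz_on UNIV f"
  shows "(\<lambda>n. (L ^^ n) f x) \<longlonglongrightarrow> lim_functional f"
  using iter_tendsto[OF assms] limI unfolding lim_functional_def by metis

lemma lim_functional_transfer:
  assumes "M-lipschitz_on UNIV f"
  shows "lim_functional (L f) = lim_functional f"
proof -
  have "(\<lambda>n. (L ^^ n) (L f) undefined) \<longlonglongrightarrow> lim_functional f"
    using LIMSEQ_Suc[OF lim_functional[OF assms]] by (simp add: funpow_swap1)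
  then show ?thesis by (simp add: lim_functional_def limI)
qed

lemma transfer_lipschitz:
  assumes "M-lipschitz_on UNIV f" shows "\<exists>M. M-lipschitz_on UNIV (L f)"
proof -
  obtain C \<rho> where "\<And>n. (C * \<rho> ^ n * M)-lipschitz_on UNIV ((L ^^ n) f)"
    using spectral_gap assms by metis
  from this[of 1] show ?thesis by auto
qed

text \<open>Strict positivity permits the conditional probabilities
  \<open>m (w @ [a]) / m w\<close>. It holds because the word \<open>w\<close> alone contributes a
  power of \<open>\<delta>\<close> to one iterate, and further averaging preserves this lower
  bound.\<close>

lemma cylinder_mass:
  defines "m \<equiv> \<lambda>w. lim_functional (indicator (cyl w))"
  shows "m [] = 1" "0 < m w" "m w = (\<Sum>a\<in>UNIV. m (w @ [a]))"
proof -
  note lims = lim_functional[OF lipschitz_indicator_sstart]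
  have "indicator (cyl []) = (\<lambda>_ :: 'a stream. 1 :: real)"
    by (simp add: fun_eq_iff)
  then show "m [] = 1"
    using lims[of "[]" undefined] by (simp add: m_def iter_const tendsto_const_iff del: sstart.simps)
  have "(indicator (cyl w) :: 'a stream \<Rightarrow> real) = (\<lambda>x. \<Sum>a\<in>UNIV. indicator (cyl (w @ [a])) x)"
    by (rule ext) (rule indicator_sstart_split)
  then have "(\<lambda>n. (L ^^ n) (indicator (cyl w)) undefined) = (\<lambda>n. \<Sum>a\<in>UNIV. (L ^^ n) (indicator (cyl (w @ [a]))) undefined)"
    by (simp add: iter_sum)
  then have "(\<lambda>n. (L ^^ n) (indicator (cyl w)) undefined) \<longlonglongrightarrow> (\<Sum>a\<in>UNIV. m (w @ [a]))"
    unfolding m_def by (auto intro!: tendsto_sum lims)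
  then show "m w = (\<Sum>a\<in>UNIV. m (w @ [a]))"
    unfolding m_def using LIMSEQ_unique lims by blast
  obtain \<delta> where \<delta>: "0 < \<delta>" "\<delta> \<le> 1" "\<And>x. \<delta> \<le> apply_lip J x"
    using J_bounded_below by blast
  have "\<delta> ^ length w \<le> (L ^^ length w) (indicator (cyl w)) x" for x
    using iter_lower_bound[of \<delta> "indicator (cyl w)" w x] \<delta> shift_in_sstart[of w x] by auto
  from iter_ge_const[of _ "(L ^^ length w) (indicator (cyl w))", OF this]
  have "\<delta> ^ length w \<le> (L ^^ (k + length w)) (indicator (cyl w)) undefined" for k
    by (simp add: funpow_add)
  moreover have "(\<lambda>k. (L ^^ (k + length w)) (indicator (cyl w)) undefined) \<longlonglongrightarrow> m w"
    unfolding m_def by (rule LIMSEQ_ignore_initial_segment[OF lims])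
  ultimately have "\<delta> ^ length w \<le> m w"
    by (intro LIMSEQ_le_const) auto
  then show "0 < m w" using \<delta>(1) by (meson less_le_trans zero_less_power)
qed

text \<open>Both sides are 1-Lipschitz for the uniform norm and agree on functions of finitely many
  letters, which are combinations of cylinder indicators.\<close>

lemma integral_eq_lim_functional:
  assumes "prob_space \<mu>" and sets: "sets \<mu> = sets borel"
    and m: "\<And>w. measure \<mu> (cyl w) = lim_functional (indicator (cyl w))"
    and f: "M-lipschitz_on UNIV f"
  shows "(\<integral>x. f x \<partial>\<mu>) = lim_functional f"
proof -
  interpret prob_space \<mu> by fact
  note cont = continuous_on_lipschitz[OF f]
  have "\<bar>(\<integral>x. f x \<partial>\<mu>) - lim_functional f\<bar> \<le> 2 * e" if "e > 0" for e
  proof -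
    obtain n where n: "\<And>x. \<bar>f x - f (stake n x @- undefined)\<bar> < e"
      using cylinder_approximation[OF cont \<open>e > 0\<close>] by blast
    define g where "g x = f (stake n x @- undefined)" for x
    obtain N where g: "N-lipschitz_on UNIV g"
      using lipschitz_cylinder_function[OF cont] unfolding g_def by blast
    have g_eq: "g = (\<lambda>x. \<Sum>w | length w = n. f (w @- undefined) * indicator (cyl w) x)"
      unfolding g_def by (rule ext) (rule cylinder_function_eq_sum)
    have fin: "finite {w :: 'a list. length w = n}"
      using finite_lists_length_eq[of "UNIV :: 'a set" n] by simp
    have ms: "cyl w \<in> sets \<mu>" for w
      using sets by (auto intro: borel_open open_sstart)
    have "(\<lambda>k. (L ^^ k) g undefined) \<longlonglongrightarrow> (\<Sum>w | length w = n. f (w @- undefined) * lim_functional (indicator (cyl w)))"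
      unfolding g_eq iter_sum[OF fin] iter_cmult
      by (intro tendsto_intros lim_functional[OF lipschitz_indicator_sstart])
    then have "lim_functional g = (\<Sum>w | length w = n. f (w @- undefined) * lim_functional (indicator (cyl w)))"
      using lim_functional[OF g] LIMSEQ_unique by blast
    moreover have "(\<integral>x. g x \<partial>\<mu>) = (\<Sum>w | length w = n. f (w @- undefined) * lim_functional (indicator (cyl w)))"
      unfolding g_eq using ms m
      by (subst Bochner_Integration.integral_sum) (auto intro!: integrable_mult_right integrable_real_indicator simp: emeasure_eq_measure)
    ultimately have eq: "(\<integral>x. g x \<partial>\<mu>) = lim_functional g" by simp
    have fg: "\<bar>f x - g x\<bar> \<le> e" for x
      using n[of x] by (simp add: g_def less_imp_le)
    have "\<bar>(\<integral>x. f x \<partial>\<mu>) - (\<integral>x. g x \<partial>\<mu>)\<bar> \<le> e"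
      using fg cont continuous_on_lipschitz[OF g] sets finite_measure_axioms
      by (intro integral_diff_le integrable_continuous_stream)
    moreover have "\<bar>lim_functional f - lim_functional g\<bar> \<le> e"
    proof -
      have "(\<lambda>k. \<bar>(L ^^ k) f undefined - (L ^^ k) g undefined\<bar>) \<longlonglongrightarrow> \<bar>lim_functional f - lim_functional g\<bar>"
        by (intro tendsto_intros lim_functional[OF f] lim_functional[OF g])
      moreover have "\<bar>(L ^^ k) f undefined - (L ^^ k) g undefined\<bar> \<le> e" for k
        using iter_abs_le[of "\<lambda>x. f x - g x", OF fg] by (simp add: iter_diff)
      ultimately show ?thesis
        by (intro LIMSEQ_le_const2) auto
    qed
    ultimately show ?thesis using eq by linarith
  qed
  then show ?thesis
    using zero_if_abs_le_double[of "(\<integral>x. f x \<partial>\<mu>) - lim_functional f"] by simp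
qed

lemma continuous_on_transfer:
  assumes "continuous_on UNIV f" shows "continuous_on UNIV (L f)"
  unfolding transfer_log_def
  by (intro continuous_intros continuous_on_branch continuous_on_apply_lip assms)

theorem has_jacobian_exists: "\<exists>\<mu>. has_jacobian \<mu> J"
proof -
  obtain \<mu> where \<mu>: "prob_space \<mu>" "sets \<mu> = sets borel"
    "\<And>w. measure \<mu> (cyl w) = lim_functional (indicator (cyl w))"
    using cylinder_measure_exists[OF cylinder_mass] by blast
  interpret prob_space \<mu> by fact
  have lip: "(\<integral>x. L f x \<partial>\<mu>) = (\<integral>x. f x \<partial>\<mu>)" if f: "M-lipschitz_on UNIV f" for f M
  proof -
    obtain M' where "M'-lipschitz_on UNIV (L f)"
      using transfer_lipschitz f by blast
    then show ?thesis
      using integral_eq_lim_functional[OF \<mu> f] lim_functional_transfer[OF f]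
      by (simp add: integral_eq_lim_functional[OF \<mu>])
  qed
  \<comment> \<open>Cylinder functions are Lipschitz and uniformly dense, and \<open>L\<close> does
    not increase uniform distances, so invariance passes from Lipschitz to continuous
    functions.\<close>
  have "(\<integral>x. L f x \<partial>\<mu>) = (\<integral>x. f x \<partial>\<mu>)" if cont: "continuous_on UNIV f" for f
  proof -
    note int = integrable_continuous_stream[OF finite_measure_axioms \<mu>(2)]
    have "\<bar>(\<integral>x. L f x \<partial>\<mu>) - (\<integral>x. f x \<partial>\<mu>)\<bar> \<le> 2 * e" if "e > 0" for e
    proof -
      obtain n where n: "\<And>x. \<bar>f x - f (stake n x @- undefined)\<bar> < e"
        using cylinder_approximation[OF cont \<open>e > 0\<close>] by blast
      define g where "g x = f (stake n x @- undefined)" for x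
      obtain N where g: "N-lipschitz_on UNIV g"
        using lipschitz_cylinder_function[OF cont] unfolding g_def by blast
      note cont_g = continuous_on_lipschitz[OF g]
      have fg: "\<bar>f x - g x\<bar> \<le> e" for x
        using n[of x] by (simp add: g_def less_imp_le)
      have "\<bar>L f x - L g x\<bar> \<le> e" for x
        using iter_abs_le[of "\<lambda>x. f x - g x" e 1 x, OF fg] by (simp add: transfer_diff)
      from integral_diff_le[OF int[OF continuous_on_transfer[OF cont]] int[OF continuous_on_transfer[OF cont_g]] this]
        integral_diff_le[OF int[OF cont] int[OF cont_g] fg] lip[OF g]
      show ?thesis by linarith
    qed
    then show ?thesis
      using zero_if_abs_le_double[of "(\<integral>x. L f x \<partial>\<mu>) - (\<integral>x. f x \<partial>\<mu>)"] by simp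
  qed
  then show ?thesis
    using \<mu> J unfolding has_jacobian_def by blast
qed

end

section \<open>Uniqueness, exactness and decay of correlations\<close>

lemma lipschitz_apply_lip: "(norm f)-lipschitz_on UNIV (apply_lip f)"
  unfolding lipschitz_on_real_iff
proof (intro conjI allI)
  fix x y
  have "\<bar>apply_lip f x - apply_lip f y\<bar> / dist x y \<le> norm f"
    using norm_lip_upper(2)[of f x y] norm_lip_upper(1)[of f x] unfolding norm_lip_def by linarith
  then show "\<bar>apply_lip f x - apply_lip f y\<bar> \<le> norm f * dist x y"
    by (cases "x = y") (simp_all add: pos_divide_le_eq)
qed simp

lemma abs_apply_lip_le: "\<bar>apply_lip f x\<bar> \<le> norm f"
  using norm_lip_upper(2)[of f x x] norm_lip_upper(1)[of f x] unfolding norm_lip_def by simp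

lemma stream_measure_eqI:
  fixes M N :: "'a::finite stream measure"
  assumes M: "finite_measure M" "sets M = sets borel" and N: "sets N = sets borel"
    and eq: "\<And>w. emeasure M (cyl w) = emeasure N (cyl w)"
  shows "M = N"
proof (rule measure_eqI_generator_eq[where \<Omega>=UNIV and E="range (cyl) \<union> {{}}" and A="\<lambda>_. UNIV"])
  show "Int_stable (range (cyl) \<union> {{}} :: 'a stream set set)"
    using Int_stable_sstart[of "UNIV :: 'a set"] by (simp add: lists_UNIV)
  have "cyl [] = (UNIV :: 'a stream set)" by simp
  then show "range (\<lambda>_ :: nat. UNIV) \<subseteq> (range (cyl) \<union> {{}} :: 'a stream set set)"
    by blast
  show "emeasure M UNIV \<noteq> \<infinity>"
    using M by (simp add: finite_measure.emeasure_finite)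
qed (use assms sigma_sets_sstart in \<open>auto\<close>)

locale gibbs = jacobian J for J :: "'a::finite lip" +
  fixes \<mu> :: "'a stream measure"
  assumes has_jacobian: "has_jacobian \<mu> J"

sublocale gibbs \<subseteq> prob_space \<mu>
  using has_jacobian by (simp add: has_jacobian_def)

lemma gibbsI: "has_jacobian \<mu> J \<Longrightarrow> gibbs J \<mu>"
  by unfold_locales (simp_all add: has_jacobian_def)

context gibbs
begin

lemma sets_\<mu> [measurable_cong]: "sets \<mu> = sets borel"
  using has_jacobian by (simp add: has_jacobian_def)

lemma space_\<mu> [simp]: "space \<mu> = UNIV"
  using sets_eq_imp_space_eq[OF sets_\<mu>] by simp

lemma prob_UNIV [simp]: "prob UNIV = 1"
  using prob_space by simp

lemma sstart_in_sets [simp]: "cyl w \<in> sets \<mu>"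
  by (simp add: sets_\<mu> open_sstart)

lemma integrable_continuous: "continuous_on UNIV f \<Longrightarrow> integrable \<mu> f" for f :: "'a stream \<Rightarrow> real"
  by (rule integrable_continuous_stream[OF finite_measure_axioms sets_\<mu>])

lemma integral_transfer: "continuous_on UNIV f \<Longrightarrow> (\<integral>x. L f x \<partial>\<mu>) = (\<integral>x. f x \<partial>\<mu>)"
  using has_jacobian by (simp add: has_jacobian_def)

lemma continuous_on_iter: "continuous_on UNIV f \<Longrightarrow> continuous_on UNIV ((L ^^ n) f)"
  by (induction n) (auto intro: continuous_on_transfer)

lemma integral_iter: "continuous_on UNIV f \<Longrightarrow> (\<integral>x. (L ^^ n) f x \<partial>\<mu>) = (\<integral>x. f x \<partial>\<mu>)"
  by (induction n) (auto simp: integral_transfer continuous_on_iter)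

lemma iter_close_to_integral:
  obtains C \<rho> where "0 \<le> C" "0 < \<rho>" "\<rho> < 1"
    "\<And>f M n. M-lipschitz_on UNIV f \<Longrightarrow> (C * \<rho> ^ n * M)-lipschitz_on UNIV ((L ^^ n) f)"
    "\<And>f M n x. M-lipschitz_on UNIV f \<Longrightarrow> \<bar>(L ^^ n) f x - (\<integral>x. f x \<partial>\<mu>)\<bar> \<le> C * \<rho> ^ n * M"
proof -
  obtain C \<rho> where C: "0 \<le> C" "0 < \<rho>" "\<rho> < 1"
    "\<And>f M n. M-lipschitz_on UNIV f \<Longrightarrow> (C * \<rho> ^ n * M)-lipschitz_on UNIV ((L ^^ n) f)"
    using spectral_gap by blast
  have "\<bar>(L ^^ n) f x - (\<integral>x. f x \<partial>\<mu>)\<bar> \<le> C * \<rho> ^ n * M" if f: "M-lipschitz_on UNIV f" for f M n x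
  proof -
    note cont = continuous_on_lipschitz[OF f]
    have "\<bar>(\<integral>y. (L ^^ n) f x \<partial>\<mu>) - (\<integral>y. (L ^^ n) f y \<partial>\<mu>)\<bar> \<le> C * \<rho> ^ n * M"
      by (intro integral_diff_le integrable_continuous continuous_on_iter cont
          lipschitz_stream_osc[OF C(4)[OF f]]) auto
    then show ?thesis by (simp add: integral_iter cont prob_space)
  qed
  with C show ?thesis by (rule that)
qed

lemma measure_sstart_pos: "0 < measure \<mu> (cyl w)"
proof -
  obtain \<delta> where \<delta>: "0 < \<delta>" "\<delta> \<le> 1" "\<And>x. \<delta> \<le> apply_lip J x"
    using J_bounded_below by blast
  have cont: "continuous_on UNIV (indicator (cyl w) :: 'a stream \<Rightarrow> real)"
    by (rule continuous_on_lipschitz[OF lipschitz_indicator_sstart])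
  have le: "\<delta> ^ length w \<le> (L ^^ length w) (indicator (cyl w)) x" for x
    using iter_lower_bound[of \<delta> "indicator (cyl w)" w x] \<delta> shift_in_sstart[of w x] by auto
  have "0 < \<delta> ^ length w" using \<delta> by simp
  also have "\<delta> ^ length w = (\<integral>x. \<delta> ^ length w \<partial>\<mu>)"
    by (simp add: prob_space)
  also have "\<dots> \<le> (\<integral>x. (L ^^ length w) (indicator (cyl w)) x \<partial>\<mu>)"
    by (intro integral_mono integrable_continuous continuous_on_iter cont le) auto
  also have "\<dots> = measure \<mu> (cyl w)"
    by (simp add: integral_iter cont)
  finally show ?thesis .
qed

text \<open>Every cylinder has positive mass, and a continuous function positive at a point is
  bounded below on a cylinder around it. This turns equalities of integrals into pointwise
  identities.\<close>

lemma integral_zero_imp_zero: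
  assumes cont: "continuous_on UNIV f" and nonneg: "\<And>x. 0 \<le> f x" and zero: "(\<integral>x. f x \<partial>\<mu>) \<le> 0"
  shows "f x = (0 :: real)"
proof (rule ccontr)
  assume "f x \<noteq> 0"
  then have pos: "0 < f x" using nonneg[of x] by simp
  have "open {y. f x / 2 < f y}"
    by (intro open_Collect_less cont continuous_intros)
  then obtain n where n: "cyl (stake n x) \<subseteq> {y. f x / 2 < f y}"
    using open_stream_contains_sstart[of "{y. f x / 2 < f y}" x] pos by auto
  have "f x / 2 * measure \<mu> (cyl (stake n x)) = (\<integral>y. f x / 2 * indicator (cyl (stake n x)) y \<partial>\<mu>)"
    by simp
  also have "\<dots> \<le> (\<integral>y. f y \<partial>\<mu>)"
  proof (intro integral_mono integrable_mult_right integrable_real_indicator integrable_continuous cont)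
    fix y show "f x / 2 * indicator (cyl (stake n x)) y \<le> f y"
      using n nonneg[of y] by (cases "y \<in> cyl (stake n x)") auto
  qed (auto simp: emeasure_eq_measure)
  finally have "f x / 2 * measure \<mu> (cyl (stake n x)) \<le> 0"
    using zero by simp
  then show False
    using pos measure_sstart_pos[of "stake n x"] by (simp add: mult_le_0_iff)
qed

text \<open>Under either measure the mass of a cylinder is the limit of the iterates of its
  indicator under \<open>L\<close>, which depends on \<open>J\<close> alone.\<close>

lemma measure_unique:
  assumes "has_jacobian \<nu> J" shows "\<nu> = \<mu>"
proof -
  interpret \<nu>: gibbs J \<nu> by (rule gibbsI[OF assms])
  show ?thesis
  proof (rule stream_measure_eqI)
    fix w
    let ?f = "indicator (cyl w) :: 'a stream \<Rightarrow> real"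
    obtain C \<rho> where C: "0 \<le> C" "0 < \<rho>" "\<rho> < 1"
      "\<And>n x. \<bar>(L ^^ n) ?f x - (\<integral>x. ?f x \<partial>\<mu>)\<bar> \<le> C * \<rho> ^ n * 2 ^ length w"
      using iter_close_to_integral lipschitz_indicator_sstart[of w] by metis
    obtain C' \<rho>' where C': "0 \<le> C'" "0 < \<rho>'" "\<rho>' < 1"
      "\<And>n x. \<bar>(L ^^ n) ?f x - (\<integral>x. ?f x \<partial>\<nu>)\<bar> \<le> C' * \<rho>' ^ n * 2 ^ length w"
      using \<nu>.iter_close_to_integral lipschitz_indicator_sstart[of w] by metis
    have lim: "(\<lambda>n. (L ^^ n) ?f undefined) \<longlonglongrightarrow> c" if "0 < r" "r < 1" "\<And>n. \<bar>(L ^^ n) ?f undefined - c\<bar> \<le> D * r ^ n * K" for D r K c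
    proof -
      from geometric_null[OF that(1,2), of D K]
      have "(\<lambda>n. (L ^^ n) ?f undefined - c) \<longlonglongrightarrow> 0"
        by (rule Lim_null_comparison[rotated]) (use that(3) in auto)
      then show ?thesis by (simp add: LIM_zero_iff)
    qed
    have "(\<integral>x. ?f x \<partial>\<mu>) = (\<integral>x. ?f x \<partial>\<nu>)"
      using lim[OF C(2-4)] lim[OF C'(2-4)] LIMSEQ_unique by blast
    then show "emeasure \<nu> (cyl w) = emeasure \<mu> (cyl w)"
      by (simp add: emeasure_eq_measure \<nu>.emeasure_eq_measure)
  qed (simp_all add: sets_\<mu> \<nu>.sets_\<mu> \<nu>.finite_measure_axioms)
qed

text \<open>Both invariance relations are tested with \<open>f = J - K\<close> itself: their
  difference integrates the sum over \<open>a\<close> of the squares of \<open>f (a ## x)\<close>,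
  which full support forces to vanish.\<close>

lemma jacobian_unique:
  assumes "has_jacobian \<mu> K" shows "K = J"
proof -
  interpret K: gibbs K \<mu> by (rule gibbsI[OF assms])
  define f where "f x = apply_lip J x - apply_lip K x" for x
  have f: "continuous_on UNIV f"
    unfolding f_def by (intro continuous_intros continuous_on_apply_lip)
  have "(\<lambda>x. L f x - transfer_log K f x) = (\<lambda>x. \<Sum>a\<in>UNIV. (f (a ## x))\<^sup>2)"
    by (simp add: fun_eq_iff transfer_log_def f_def power2_eq_square algebra_simps flip: sum_subtractf)
  then have "(\<integral>x. (\<Sum>a\<in>UNIV. (f (a ## x))\<^sup>2) \<partial>\<mu>) = (\<integral>x. L f x - transfer_log K f x \<partial>\<mu>)"
    by simp
  also have "\<dots> = 0"
    using f by (subst Bochner_Integration.integral_diff)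
      (auto intro!: integrable_continuous continuous_on_transfer K.continuous_on_transfer simp: integral_transfer K.integral_transfer)
  finally have "(\<Sum>a\<in>UNIV. (f (a ## x))\<^sup>2) = 0" for x
    by (intro integral_zero_imp_zero) (auto intro!: continuous_intros continuous_on_branch f sum_nonneg)
  then have zero: "f (a ## x) = 0" for a x
    by (simp add: sum_nonneg_eq_0_iff)
  have "f x = 0" for x
    using zero[of "shd x" "stl x"] by simp
  then show ?thesis
    by (intro lip_eqI) (simp add: f_def)
qed

lemma jacobian_of_eq: "jacobian_of \<mu> = J"
  unfolding jacobian_of_def using has_jacobian jacobian_unique by blast

section \<open>Correlations and tail events\<close>

lemma iter_mult_shift: "(L ^^ n) (\<lambda>x. f x * g ((stl ^^ n) x)) = (\<lambda>x. (L ^^ n) f x * g x)"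
proof (induction n arbitrary: f)
  case (Suc n)
  have "L (\<lambda>x. f x * g ((stl ^^ Suc n) x)) = (\<lambda>x. L f x * g ((stl ^^ n) x))"
    by (simp add: transfer_log_def fun_eq_iff sum_distrib_right mult.assoc funpow_swap1)
  with Suc.IH[of "L f"] show ?case
    by (simp only: funpow_Suc_right comp_apply)
qed simp

lemma continuous_on_stl_pow: "continuous_on UNIV (stl ^^ n :: 'a stream \<Rightarrow> _)"
  by (induction n) (auto intro: continuous_on_compose2[OF continuous_on_stl, of UNIV])

lemma integral_mult_shift:
  assumes "continuous_on UNIV f" "continuous_on UNIV g"
  shows "(\<integral>x. f x * g ((stl ^^ n) x) \<partial>\<mu>) = (\<integral>x. (L ^^ n) f x * g x \<partial>\<mu>)"
proof -
  have "continuous_on UNIV (\<lambda>x. f x * g ((stl ^^ n) x))"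
    by (intro continuous_intros assms continuous_on_compose2[OF assms(2) continuous_on_stl_pow]) auto
  from integral_iter[OF this, of n] show ?thesis
    by (simp add: iter_mult_shift)
qed

theorem exp_decay: "exp_decay_of_correlations \<mu>"
proof -
  obtain C \<rho> where C: "0 \<le> C" "0 < \<rho>" "\<rho> < 1"
    "\<And>f M n x. M-lipschitz_on UNIV f \<Longrightarrow> \<bar>(L ^^ n) f x - (\<integral>x. f x \<partial>\<mu>)\<bar> \<le> C * \<rho> ^ n * M"
    using iter_close_to_integral by metis
  have "\<bar>(\<integral>x. apply_lip f x * apply_lip g ((stl ^^ n) x) \<partial>\<mu>) - (\<integral>x. apply_lip f x \<partial>\<mu>) * (\<integral>x. apply_lip g x \<partial>\<mu>)\<bar>
      \<le> C * norm f * norm g * \<rho> ^ n" for f g :: "'a lip" and n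
  proof -
    note f = lipschitz_apply_lip[of f] and g = abs_apply_lip_le[of g]
    note cont = continuous_on_apply_lip[of UNIV f] continuous_on_apply_lip[of UNIV g]
    let ?c = "\<integral>x. apply_lip f x \<partial>\<mu>"
    have int: "integrable \<mu> (\<lambda>x. (L ^^ n) (apply_lip f) x * apply_lip g x)" "integrable \<mu> (\<lambda>x. ?c * apply_lip g x)"
      by (intro integrable_continuous continuous_intros continuous_on_iter cont)+
    have "\<bar>(\<integral>x. (L ^^ n) (apply_lip f) x * apply_lip g x \<partial>\<mu>) - (\<integral>x. ?c * apply_lip g x \<partial>\<mu>)\<bar> \<le> C * \<rho> ^ n * norm f * norm g"
    proof (intro integral_diff_le int)
      fix x
      have "\<bar>(L ^^ n) (apply_lip f) x - ?c\<bar> * \<bar>apply_lip g x\<bar> \<le> C * \<rho> ^ n * norm f * norm g"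
        using C by (intro mult_mono C(4)[OF f] g) auto
      then show "\<bar>(L ^^ n) (apply_lip f) x * apply_lip g x - ?c * apply_lip g x\<bar> \<le> C * \<rho> ^ n * norm f * norm g"
        by (simp add: abs_mult flip: left_diff_distrib)
    qed
    then show ?thesis
      by (simp add: integral_mult_shift cont mult_ac)
  qed
  then show ?thesis
    unfolding exp_decay_of_correlations_def using C by blast
qed

text \<open>Carries the duality of \<open>L^n\<close> and the \<open>n\<close>-fold shift from
  continuous functions to Borel indicators: both sides are finite measures in \<open>B\<close>, and
  they agree on cylinders.\<close>

lemma measure_cylinder_shift:
  assumes B: "B \<in> sets borel"
  shows "measure \<mu> (cyl w \<inter> (stl ^^ n) -` B) = (\<integral>x. (L ^^ n) (indicator (cyl w)) x * indicator B x \<partial>\<mu>)"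
proof -
  let ?f = "indicator (cyl w) :: 'a stream \<Rightarrow> real"
  have cont: "continuous_on UNIV (indicator (cyl w) :: 'a stream \<Rightarrow> real)" for w
    by (rule continuous_on_lipschitz[OF lipschitz_indicator_sstart])
  have stl [measurable]: "stl ^^ n \<in> measurable \<mu> borel"
    using borel_measurable_continuous_onI[OF continuous_on_stl_pow[of n]]
    by (simp cong: measurable_cong_sets add: sets_\<mu>)
  have Lf_nonneg: "0 \<le> (L ^^ n) ?f x" for x
    by (rule iter_ge_const) simp
  have Lf [measurable]: "(L ^^ n) ?f \<in> borel_measurable \<mu>"
    by (rule borel_measurable_integrable[OF integrable_continuous[OF continuous_on_iter[OF cont]]])
  have vimage: "cyl w \<inter> (stl ^^ n) -` B \<in> sets \<mu>" if "B \<in> sets borel" for B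
    using measurable_sets[OF stl that] by (intro sets.Int) simp_all
  have int: "integrable \<mu> (\<lambda>x. (L ^^ n) ?f x * indicator B x)" if "B \<in> sets borel" for B
    using that by (intro integrable_real_mult_indicator
        integrable_continuous continuous_on_iter cont) (auto simp: sets_\<mu>)
  define M where "M = distr (density \<mu> (indicator (cyl w))) borel (stl ^^ n)"
  define N where "N = density \<mu> (\<lambda>x. ennreal ((L ^^ n) ?f x))"
  have M: "emeasure M B = ennreal (measure \<mu> (cyl w \<inter> (stl ^^ n) -` B))" if "B \<in> sets borel" for B
    unfolding M_def using that vimage measurable_sets[OF stl that]
    by (subst emeasure_distr) (auto simp: emeasure_restricted emeasure_eq_measure)
  have N: "emeasure N B = ennreal (\<integral>x. (L ^^ n) ?f x * indicator B x \<partial>\<mu>)" if "B \<in> sets borel" for B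
  proof -
    have "emeasure N B = (\<integral>\<^sup>+ x. ennreal ((L ^^ n) ?f x * indicator B x) \<partial>\<mu>)"
      unfolding N_def using that Lf_nonneg
      by (subst emeasure_density) (auto simp: sets_\<mu> ennreal_mult' ennreal_indicator intro!: nn_integral_cong)
    also have "\<dots> = ennreal (\<integral>x. (L ^^ n) ?f x * indicator B x \<partial>\<mu>)"
      using Lf_nonneg int[OF that] by (intro nn_integral_eq_integral) auto
    finally show ?thesis .
  qed
  have "M = N"
  proof (rule stream_measure_eqI)
    show "finite_measure M"
      by (rule finite_measureI) (use M[of UNIV] in \<open>simp add: M_def\<close>)
    fix v
    have v: "cyl v \<in> sets (borel :: 'a stream measure)" by (simp add: open_sstart)
    have "measure \<mu> (cyl w \<inter> (stl ^^ n) -` cyl v) = (\<integral>x. ?f x * indicator (cyl v) ((stl ^^ n) x) \<partial>\<mu>)"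
      using vimage[OF v] by (simp flip: indicator_inter_arith indicator_vimage)
    also have "\<dots> = (\<integral>x. (L ^^ n) ?f x * indicator (cyl v) x \<partial>\<mu>)"
      by (rule integral_mult_shift[OF cont cont])
    finally show "emeasure M (cyl v) = emeasure N (cyl v)"
      by (simp add: M N v)
  qed (simp_all add: M_def N_def sets_\<mu>)
  then have "ennreal (measure \<mu> (cyl w \<inter> (stl ^^ n) -` B)) = ennreal (\<integral>x. (L ^^ n) ?f x * indicator B x \<partial>\<mu>)"
    using M[OF B] N[OF B] by simp
  then show ?thesis
    using Lf_nonneg by (subst (asm) ennreal_inj) (auto intro!: integral_nonneg)
qed

text \<open>For each \<open>n\<close> a tail event \<open>E\<close> is the preimage of some
  \<open>B n\<close> under the \<open>n\<close>-fold shift, so its mass inside a cylinder is the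
  integral over \<open>B n\<close> of \<open>L^n\<close> applied to the indicator of the cylinder.
  This tends to the product of the masses; \<open>E\<close> is therefore independent of all
  cylinders, hence of itself.\<close>

theorem exact: "exact_measure \<mu>"
  unfolding exact_measure_def
proof
  fix E assume E: "E \<in> (\<Inter>n. sets (vimage_algebra UNIV (stl ^^ n) (borel :: 'a stream measure)))"
  have "\<exists>B. B \<in> sets borel \<and> E = (stl ^^ n) -` B" for n
    using E by (auto simp: sets_vimage_algebra2) blast
  then obtain B where B: "\<And>n. B n \<in> sets borel" "\<And>n. E = (stl ^^ n) -` B n"
    by metis
  have E_meas: "E \<in> sets \<mu>"
    using B(1)[of 0] B(2)[of 0] by (simp add: sets_\<mu>)
  \<comment> \<open>Shift invariance, read off from the empty word, whose cylinder is the whole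
    space.\<close>
  have B_eq: "measure \<mu> (B n) = measure \<mu> E" for n
  proof -
    have "indicator (cyl []) = (\<lambda>_ :: 'a stream. 1 :: real)"
      by (simp add: fun_eq_iff)
    then show ?thesis
      using measure_cylinder_shift[OF B(1)[of n], of "[]" n] B(2)[of n] B(1)[of n]
      by (simp add: iter_const sets_\<mu> del: sstart.simps) simp
  qed
  obtain C \<rho> where C: "0 \<le> C" "0 < \<rho>" "\<rho> < 1"
    "\<And>f M n x. M-lipschitz_on UNIV f \<Longrightarrow> \<bar>(L ^^ n) f x - (\<integral>x. f x \<partial>\<mu>)\<bar> \<le> C * \<rho> ^ n * M"
    using iter_close_to_integral by metis
  have cyl: "measure \<mu> (E \<inter> cyl w) = measure \<mu> E * measure \<mu> (cyl w)" for w
  proof -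
    let ?f = "indicator (cyl w) :: 'a stream \<Rightarrow> real"
    have f: "(2 ^ length w)-lipschitz_on UNIV ?f"
      by (rule lipschitz_indicator_sstart)
    have bound: "\<bar>measure \<mu> (E \<inter> cyl w) - measure \<mu> E * measure \<mu> (cyl w)\<bar> \<le> C * \<rho> ^ n * 2 ^ length w" for n
    proof -
      have Bn: "B n \<in> sets \<mu>" using B by (simp add: sets_\<mu>)
      have int: "integrable \<mu> (\<lambda>x. (L ^^ n) ?f x * indicator (B n) x)" "integrable \<mu> (\<lambda>x. measure \<mu> (cyl w) * indicator (B n) x)"
        by (intro integrable_real_mult_indicator integrable_continuous continuous_on_iter
            continuous_on_lipschitz[OF f] continuous_on_const Bn)+
      have "\<bar>(\<integral>x. (L ^^ n) ?f x * indicator (B n) x \<partial>\<mu>) - (\<integral>x. measure \<mu> (cyl w) * indicator (B n) x \<partial>\<mu>)\<bar> \<le> C * \<rho> ^ n * 2 ^ length w"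
      proof (intro integral_diff_le int)
        fix x
        show "\<bar>(L ^^ n) ?f x * indicator (B n) x - measure \<mu> (cyl w) * indicator (B n) x\<bar> \<le> C * \<rho> ^ n * 2 ^ length w"
          using C(4)[OF f, of n x] C(1,2) by (cases "x \<in> B n") auto
      qed
      then show ?thesis
        using measure_cylinder_shift[OF B(1)[of n], of w n] Bn B_eq[of n]
        by (simp add: B(2)[of n, symmetric] Int_commute mult.commute)
    qed
    have "(\<lambda>n. C * \<rho> ^ n * 2 ^ length w) \<longlonglongrightarrow> 0"
      using C by (intro geometric_null)
    then have "\<bar>measure \<mu> (E \<inter> cyl w) - measure \<mu> E * measure \<mu> (cyl w)\<bar> \<le> 0"
      by (rule LIMSEQ_le_const) (use bound in auto)
    then show ?thesis by simp
  qed
  define M where "M = density \<mu> (indicator E)"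
  define N where "N = density \<mu> (\<lambda>_. ennreal (measure \<mu> E))"
  have M: "emeasure M D = ennreal (measure \<mu> (E \<inter> D))" if "D \<in> sets \<mu>" for D
    using that E_meas by (simp add: M_def emeasure_restricted emeasure_eq_measure)
  have N: "emeasure N D = ennreal (measure \<mu> E * measure \<mu> D)" if "D \<in> sets \<mu>" for D
    using that by (simp add: N_def emeasure_density_const emeasure_eq_measure ennreal_mult)
  have "M = N"
  proof (rule stream_measure_eqI)
    show "finite_measure M"
      by (rule finite_measureI) (use M[of UNIV] in \<open>simp add: M_def sets_\<mu>\<close>)
  qed (simp_all add: M N cyl, simp_all add: M_def N_def sets_\<mu>)
  then have "measure \<mu> E = measure \<mu> E * measure \<mu> E"
    using M[OF E_meas] N[OF E_meas] by simp
  then show "measure \<mu> E = 0 \<or> measure \<mu> E = 1" by simp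
qed

end

section \<open>Additive eigenfunctions of nonlinear averaging operators\<close>

text \<open>Continuity is meant for pointwise convergence of \<open>\<phi>\<close>, the topology of
  Tychonoff's theorem; it holds because only the finitely many coordinates \<open>s a\<close> are
  read.\<close>

lemma continuous_map_nonexpansive:
  fixes F :: "('a::finite \<Rightarrow> real) \<Rightarrow> real" and s :: "'a \<Rightarrow> 'b"
  assumes F: "\<And>v w e. (\<And>a. \<bar>v a - w a\<bar> \<le> e) \<Longrightarrow> \<bar>F v - F w\<bar> \<le> e"
  shows "continuous_on UNIV (\<lambda>\<phi> :: 'b \<Rightarrow> real. F (\<lambda>a. A a + \<phi> (s a)))"
  unfolding continuous_on_def
proof
  fix \<phi>0 :: "'b \<Rightarrow> real"
  have coord: "((\<lambda>\<phi>. \<phi> i) \<longlongrightarrow> \<phi>0 i) (at \<phi>0)" for i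
    using continuous_on_product_coordinates[of i, where 'b=real] unfolding continuous_on_def by blast
  have "((\<lambda>\<phi>. \<Sum>a\<in>UNIV. \<bar>\<phi> (s a) - \<phi>0 (s a)\<bar>) \<longlongrightarrow> (\<Sum>a\<in>UNIV. \<bar>\<phi>0 (s a) - \<phi>0 (s a)\<bar>)) (at \<phi>0)"
    by (intro tendsto_intros coord)
  then have lim: "((\<lambda>\<phi>. \<Sum>a\<in>UNIV. \<bar>\<phi> (s a) - \<phi>0 (s a)\<bar>) \<longlongrightarrow> 0) (at \<phi>0)"
    by simp
  have "\<bar>F (\<lambda>a. A a + \<phi> (s a)) - F (\<lambda>a. A a + \<phi>0 (s a))\<bar> \<le> (\<Sum>a\<in>UNIV. \<bar>\<phi> (s a) - \<phi>0 (s a)\<bar>)" for \<phi>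
  proof (rule F)
    fix a
    have "\<bar>\<phi> (s a) - \<phi>0 (s a)\<bar> \<le> (\<Sum>a\<in>UNIV. \<bar>\<phi> (s a) - \<phi>0 (s a)\<bar>)"
      by (rule member_le_sum) auto
    then show "\<bar>A a + \<phi> (s a) - (A a + \<phi>0 (s a))\<bar> \<le> (\<Sum>a\<in>UNIV. \<bar>\<phi> (s a) - \<phi>0 (s a)\<bar>)"
      by simp
  qed
  then have "((\<lambda>\<phi>. F (\<lambda>a. A a + \<phi> (s a)) - F (\<lambda>a. A a + \<phi>0 (s a))) \<longlongrightarrow> 0) (at \<phi>0)"
    by (intro Lim_null_comparison[OF _ lim] always_eventually) auto
  then show "((\<lambda>\<phi>. F (\<lambda>a. A a + \<phi> (s a))) \<longlongrightarrow> F (\<lambda>a. A a + \<phi>0 (s a))) (at \<phi>0 within UNIV)"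
    by (simp add: LIM_zero_iff)
qed

lemma compact_box_fun: "compact (PiE UNIV (\<lambda>_ :: 'b. {- C..C :: real}))"
proof -
  have "compactin (product_topology (\<lambda>_ :: 'b. euclidean) UNIV) (PiE UNIV (\<lambda>_. {- C..C :: real}))"
    by (subst compactin_PiE) auto
  then show ?thesis
    by (simp add: euclidean_product_topology)
qed

locale soft_max =
  fixes F :: "('a::finite \<Rightarrow> real) \<Rightarrow> real" and g :: "('a \<Rightarrow> real) \<Rightarrow> 'a \<Rightarrow> real"
  assumes g_nonneg: "0 \<le> g v a" and sum_g: "(\<Sum>a\<in>UNIV. g v a) = 1"
    and subgradient: "F v + (\<Sum>a\<in>UNIV. g v a * (w a - v a)) \<le> F w"
begin

lemma weighted_sum_le: "(\<And>a. h a \<le> e) \<Longrightarrow> (\<Sum>a\<in>UNIV. g v a * h a) \<le> e"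
proof -
  assume "\<And>a. h a \<le> e"
  then have "(\<Sum>a\<in>UNIV. g v a * h a) \<le> (\<Sum>a\<in>UNIV. g v a * e)"
    by (intro sum_mono mult_left_mono g_nonneg)
  then show ?thesis by (simp add: sum_g flip: sum_distrib_right)
qed

lemma diff_le: "F w - F v \<le> (\<Sum>a\<in>UNIV. g w a * (w a - v a))"
proof -
  have "(\<Sum>a\<in>UNIV. g w a * (v a - w a)) = - (\<Sum>a\<in>UNIV. g w a * (w a - v a))"
    by (simp add: right_diff_distrib sum_subtractf)
  then show ?thesis using subgradient[of w v] by linarith
qed

lemma nonexpansive:
  assumes "\<And>a. \<bar>v a - w a\<bar> \<le> e" shows "\<bar>F v - F w\<bar> \<le> e"
proof -
  have "F v - F w \<le> e"
    by (rule order.trans[OF diff_le weighted_sum_le]) (use assms in \<open>simp add: abs_le_iff\<close>)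
  moreover have "F w - F v \<le> e"
    by (rule order.trans[OF diff_le weighted_sum_le]) (use assms in \<open>simp add: abs_le_iff\<close>)
  ultimately show ?thesis by linarith
qed

lemma translate: "F (\<lambda>a. v a + t) = F v + t"
proof -
  have "F v + t \<le> F (\<lambda>a. v a + t)"
    using subgradient[of v "\<lambda>a. v a + t"] by (simp add: sum_g flip: sum_distrib_right)
  moreover have "F (\<lambda>a. v a + t) - F v \<le> t"
    using diff_le[of "\<lambda>a. v a + t" v] by (simp add: sum_g flip: sum_distrib_right)
  ultimately show ?thesis by linarith
qed

text \<open>
  Approximate solutions come from the discounted equation; a solution is then a point in the
  intersection of a decreasing sequence of closed subsets of a box, compact by Tychonoff.
\<close>

theorem additive_eigenfunction:
  fixes A :: "'a stream \<Rightarrow> real"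
  assumes A: "C-lipschitz_on UNIV A"
  shows "\<exists>\<phi> c. C-lipschitz_on UNIV \<phi> \<and> (\<forall>x. F (\<lambda>a. A (a ## x) + \<phi> (a ## x)) = \<phi> x + c)"
proof -
  have C: "0 \<le> C" "\<And>x y. \<bar>A x - A y\<bar> \<le> C * dist x y"
    using A by (auto simp: lipschitz_on_real_iff)
  define G where "G \<phi> x = F (\<lambda>a. A (a ## x) + \<phi> (a ## x))" for \<phi> x
  let ?z = "undefined :: 'a stream"
  \<comment> \<open>Candidates for which \<open>G \<phi> - \<phi>\<close> is constant up to
    \<open>e\<close>, compared with its value at \<open>?z\<close>. All conditions are pointwise
    inequalities, hence closed for pointwise convergence.\<close>
  define T where "T e = {\<phi>. (\<forall>x y. \<bar>\<phi> x - \<phi> y\<bar> \<le> C * dist x y) \<and>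
     (\<forall>x. \<bar>(G \<phi> x - \<phi> x) - (G \<phi> ?z - \<phi> ?z)\<bar> \<le> e)}" for e
  define box where "box = PiE UNIV (\<lambda>_ :: 'a stream. {- C..C})"
  have contG: "continuous_on UNIV (\<lambda>\<phi>. G \<phi> x)" for x
    unfolding G_def by (rule continuous_map_nonexpansive) (rule nonexpansive)
  have closed: "closed (T e)" for e
    unfolding T_def
    by (intro closed_Collect_conj closed_Collect_all closed_Collect_le continuous_intros contG continuous_on_product_coordinates)
  have approx: "box \<inter> T e \<noteq> {}" if "0 < e" for e
  proof -
    \<comment> \<open>The discount keeps \<open>(1 - r) C\<close>, the price of returning to the
      undiscounted equation, below \<open>e / 2\<close>; the minimum with \<open>1/2\<close> keeps
      \<open>r\<close> positive.\<close>
    define r where "r = 1 - min (1/2) (e / (2 * (C + 1)))"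
    have r: "0 < r" "r < 1" "(1 - r) * C \<le> e / 2"
    proof -
      have "(1 - r) * C \<le> e / (2 * (C + 1)) * C"
        using C by (intro mult_right_mono) (auto simp: r_def)
      also have "\<dots> \<le> e / 2"
        using C that by (simp add: field_simps)
      finally show "(1 - r) * C \<le> e / 2" .
    qed (use C that in \<open>auto simp: r_def min_def\<close>)
    \<comment> \<open>A late iterate of the discounted operator replaces its fixed point: since
      \<open>r < 1\<close>, successive iterates become arbitrarily close.\<close>
    define u where "u n = ((\<lambda>v. G (\<lambda>x. r * v x)) ^^ n) (\<lambda>_. 0)" for n
    have u_Suc: "u (Suc n) = G (\<lambda>x. r * u n x)" for n
      by (simp add: u_def)
    have lip: "\<bar>u n x - u n y\<bar> \<le> C * dist x y" for n x y
    proof (induction n arbitrary: x y)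
      case (Suc n)
      \<comment> \<open>The halving along a branch balances exactly: \<open>A\<close> and the
        discounted iterate contribute at most half of \<open>C * dist x y\<close> each, so the
        constant \<open>C\<close> reproduces itself.\<close>
      have "\<bar>(A (a ## x) + r * u n (a ## x)) - (A (a ## y) + r * u n (a ## y))\<bar> \<le> C * dist x y" for a
      proof -
        have "r * \<bar>u n (a ## x) - u n (a ## y)\<bar> \<le> 1 * (C * dist (a ## x) (a ## y))"
          using Suc r by (intro mult_mono) auto
        then have "\<bar>r * u n (a ## x) - r * u n (a ## y)\<bar> \<le> C * dist x y / 2"
          using r by (simp add: abs_mult dist_Stream_same flip: right_diff_distrib)
        then show ?thesis
          using C(2)[of "a ## x" "a ## y"] unfolding dist_Stream_same by linarith
      qed
      then show ?case
        unfolding u_Suc G_def by (rule nonexpansive)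
    qed (use C in \<open>simp add: u_def\<close>)
    define K where "K = \<bar>u 1 ?z\<bar> + C"
    have step: "\<bar>u (Suc n) x - u n x\<bar> \<le> r ^ n * K" for n x
    proof (induction n arbitrary: x)
      case 0
      have "\<bar>u 1 x - u 1 ?z\<bar> \<le> C"
        using lip[of 1 x ?z] mult_left_mono[OF dist_stream_le_1[of x ?z] C(1)] by linarith
      then show ?case by (simp add: K_def u_def)
    next
      case (Suc n)
      have "\<bar>(A (a ## x) + r * u (Suc n) (a ## x)) - (A (a ## x) + r * u n (a ## x))\<bar> \<le> r ^ Suc n * K" for a
        using mult_left_mono[OF Suc[of "a ## x"], of r] r
        by (simp add: abs_mult mult.assoc flip: right_diff_distrib)
      then show ?case
        unfolding u_Suc[of "Suc n"] u_Suc[of n, symmetric] by (subst (2) u_Suc) (simp only: G_def nonexpansive)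
    qed
    have "(\<lambda>n. r ^ n * K) \<longlonglongrightarrow> 0"
      using LIMSEQ_realpow_zero[of r] r by (auto intro!: tendsto_mult_left_zero)
    then have "\<forall>\<^sub>F n in sequentially. r ^ n * K < e / 4"
      by (rule order_tendstoD(2)) (use that in simp)
    then obtain n where n: "r ^ n * K < e / 4"
      by (auto simp: eventually_sequentially)
    \<comment> \<open>Vanishing at \<open>?z\<close> puts \<open>\<phi>\<close> into the box, as its
      oscillation is at most \<open>C\<close>; by \<open>translate\<close> the subtraction changes
      \<open>G\<close> only by a constant.\<close>
    define \<phi> where "\<phi> x = r * u n x - r * u n ?z" for x
    have lip_\<phi>: "\<bar>\<phi> x - \<phi> y\<bar> \<le> C * dist x y" for x y
    proof -
      have "\<phi> x - \<phi> y = r * (u n x - u n y)" by (simp add: \<phi>_def algebra_simps)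
      moreover have "r * \<bar>u n x - u n y\<bar> \<le> 1 * (C * dist x y)"
        using lip[of n x y] r by (intro mult_mono) auto
      ultimately show ?thesis using r by (simp add: abs_mult)
    qed
    have "\<bar>\<phi> x\<bar> \<le> C" for x
      using lip_\<phi>[of x ?z] mult_left_mono[OF dist_stream_le_1[of x ?z] C(1)] by (simp add: \<phi>_def)
    then have "\<phi> \<in> box"
      by (auto simp: box_def abs_le_iff minus_le_iff)
    moreover have "\<bar>(G \<phi> x - \<phi> x) - (G \<phi> ?z - \<phi> ?z)\<bar> \<le> e" for x
    proof -
      have G\<phi>: "G \<phi> x = u (Suc n) x - r * u n ?z" for x
        using translate[of "\<lambda>a. A (a ## x) + r * u n (a ## x)" "- (r * u n ?z)"]
        by (simp add: G_def \<phi>_def u_Suc algebra_simps)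
      have "(G \<phi> x - \<phi> x) - (G \<phi> ?z - \<phi> ?z) = (u (Suc n) x - u n x) - (u (Suc n) ?z - u n ?z) + (1 - r) * (u n x - u n ?z)"
        unfolding G\<phi> by (simp add: \<phi>_def algebra_simps)
      moreover have "\<bar>(1 - r) * (u n x - u n ?z)\<bar> \<le> (1 - r) * C"
      proof -
        have "\<bar>u n x - u n ?z\<bar> \<le> C"
          using lip[of n x ?z] mult_left_mono[OF dist_stream_le_1[of x ?z] C(1)] by linarith
        then show ?thesis using r by (simp add: abs_mult)
      qed
      ultimately show ?thesis
        using step[of n x] step[of n ?z] n r(3) by linarith
    qed
    ultimately show ?thesis
      using lip_\<phi> by (auto simp: T_def)
  qed
  have "box \<inter> (\<Inter>n. T (1 / real (Suc n))) \<noteq> {}"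
  proof (rule compact_imp_fip_image)
    show "compact box" unfolding box_def by (rule compact_box_fun)
    fix I :: "nat set" assume I: "finite I"
    have "T (1 / real (Suc (Max (insert 0 I)))) \<subseteq> T (1 / real (Suc n))" if "n \<in> I" for n
    proof -
      have "n \<le> Max (insert 0 I)" using I that by simp
      then have "1 / real (Suc (Max (insert 0 I))) \<le> 1 / real (Suc n)"
        by (intro divide_left_mono) auto
      then show ?thesis by (auto simp: T_def intro: order.trans)
    qed
    moreover have "box \<inter> T (1 / real (Suc (Max (insert 0 I)))) \<noteq> {}"
      by (rule approx) simp
    ultimately show "box \<inter> (\<Inter>n\<in>I. T (1 / real (Suc n))) \<noteq> {}"
      by blast
  qed (rule closed)
  then obtain \<phi> where \<phi>: "\<And>n. \<phi> \<in> T (1 / real (Suc n))" by auto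
  have "C-lipschitz_on UNIV \<phi>"
    using \<phi>[of 0] C(1) by (simp add: T_def lipschitz_on_real_iff)
  moreover have "G \<phi> x = \<phi> x + (G \<phi> ?z - \<phi> ?z)" for x
  proof -
    have "\<bar>(G \<phi> x - \<phi> x) - (G \<phi> ?z - \<phi> ?z)\<bar> \<le> 1 / real (Suc n)" for n
      using \<phi>[of n] by (simp add: T_def)
    moreover have "(\<lambda>n. 1 / real (Suc n)) \<longlonglongrightarrow> 0"
      by (rule LIMSEQ_Suc[OF lim_1_over_n])
    ultimately have "\<bar>(G \<phi> x - \<phi> x) - (G \<phi> ?z - \<phi> ?z)\<bar> \<le> 0"
      by (intro LIMSEQ_le_const[of "\<lambda>n. 1 / real (Suc n)" 0]) auto
    then show ?thesis by simp
  qed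
  ultimately show ?thesis unfolding G_def by blast
qed

end

section \<open>Soft maxima with Lipschitz gradient\<close>

locale smooth_soft_max = soft_max F g for F :: "('a::finite \<Rightarrow> real) \<Rightarrow> real" and g +
  fixes K :: real
  assumes g_lipschitz: "(\<And>a. \<bar>v a - w a\<bar> \<le> e) \<Longrightarrow> \<bar>g v a - g w a\<bar> \<le> K * e"
begin

lemma K_nonneg: "0 \<le> K"
  using g_lipschitz[of "\<lambda>_. 0" "\<lambda>_. 0" 1] by simp

lemma weighted_diff_le:
  assumes "\<And>a. \<bar>v a - w a\<bar> \<le> e" "\<And>a. \<bar>h a\<bar> \<le> H"
  shows "\<bar>(\<Sum>a\<in>UNIV. g v a * h a) - (\<Sum>a\<in>UNIV. g w a * h a)\<bar> \<le> real CARD('a) * K * e * H"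
proof -
  have "\<bar>(\<Sum>a\<in>UNIV. g v a * h a) - (\<Sum>a\<in>UNIV. g w a * h a)\<bar> = \<bar>\<Sum>a\<in>UNIV. (g v a - g w a) * h a\<bar>"
    by (simp add: left_diff_distrib sum_subtractf)
  also have "\<dots> \<le> (\<Sum>a\<in>UNIV. \<bar>(g v a - g w a) * h a\<bar>)"
    by (rule sum_abs)
  also have "\<dots> \<le> (\<Sum>a\<in>(UNIV :: 'a set). K * e * H)"
  proof (rule sum_mono)
    fix a
    have "0 \<le> e" using assms(1)[of a] by linarith
    then show "\<bar>(g v a - g w a) * h a\<bar> \<le> K * e * H"
      unfolding abs_mult using K_nonneg by (intro mult_mono g_lipschitz assms) auto
  qed
  finally show ?thesis by simp
qed

text \<open>The subgradient inequalities at both ends enclose the increment between \<open>s\<close>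
  times the slopes at \<open>t\<close> and at \<open>t + s\<close>; the Lipschitz gradient makes
  these slopes agree in the limit.\<close>

lemma has_derivative_along_line:
  "((\<lambda>t. F (\<lambda>a. v a + t * h a)) has_real_derivative (\<Sum>a\<in>UNIV. g (\<lambda>a. v a + t * h a) a * h a)) (at t)"
proof -
  define H where "H = (\<Sum>a\<in>UNIV. \<bar>h a\<bar>)"
  have H: "\<bar>h a\<bar> \<le> H" for a
    unfolding H_def by (rule member_le_sum) auto
  let ?v = "\<lambda>t a. v a + t * h a"
  let ?D = "\<lambda>t. \<Sum>a\<in>UNIV. g (?v t) a * h a"
  have "\<bar>(F (?v (t + s)) - F (?v t)) / s - ?D t\<bar> \<le> \<bar>s\<bar> * (real CARD('a) * K * H * H)" if "s \<noteq> 0" for s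
  proof -
    have "(\<Sum>a\<in>UNIV. g u a * (?v (t + s) a - ?v t a)) = s * (\<Sum>a\<in>UNIV. g u a * h a)" for u
      by (simp add: sum_distrib_left algebra_simps)
    then have 1: "s * ?D t \<le> F (?v (t + s)) - F (?v t)" "F (?v (t + s)) - F (?v t) \<le> s * ?D (t + s)"
      using subgradient[of "?v t" "?v (t + s)"] diff_le[of "?v (t + s)" "?v t"] by simp_all
    have "\<bar>?v (t + s) a - ?v t a\<bar> \<le> \<bar>s\<bar> * H" for a
      using mult_left_mono[OF H[of a], of "\<bar>s\<bar>"] by (simp add: algebra_simps abs_mult)
    from weighted_diff_le[of "?v (t + s)" "?v t", OF this H] have 2: "\<bar>?D (t + s) - ?D t\<bar> \<le> \<bar>s\<bar> * (real CARD('a) * K * H * H)"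
      by (simp add: mult_ac)
    have "\<bar>F (?v (t + s)) - F (?v t) - s * ?D t\<bar> \<le> \<bar>s * (?D (t + s) - ?D t)\<bar>"
      using 1 by (simp add: algebra_simps abs_le_iff)
    also have "\<dots> \<le> \<bar>s\<bar> * (\<bar>s\<bar> * (real CARD('a) * K * H * H))"
      unfolding abs_mult by (intro mult_left_mono 2) simp
    finally have "\<bar>F (?v (t + s)) - F (?v t) - s * ?D t\<bar> / \<bar>s\<bar> \<le> \<bar>s\<bar> * (real CARD('a) * K * H * H)"
      using that by (simp add: field_simps)
    moreover have "(F (?v (t + s)) - F (?v t)) / s - ?D t = (F (?v (t + s)) - F (?v t) - s * ?D t) / s"
      using that by (simp add: field_simps)
    ultimately show ?thesis by (simp only: abs_divide)
  qed
  then have "\<forall>\<^sub>F s in at 0. norm ((F (?v (t + s)) - F (?v t)) / s - ?D t) \<le> \<bar>s\<bar> * (real CARD('a) * K * H * H)"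
    by (auto simp: eventually_at_filter)
  moreover have "((\<lambda>s :: real. \<bar>s\<bar> * (real CARD('a) * K * H * H)) \<longlongrightarrow> 0) (at 0)"
    by (auto intro!: tendsto_eq_intros)
  ultimately have "((\<lambda>s. (F (?v (t + s)) - F (?v t)) / s - ?D t) \<longlongrightarrow> 0) (at 0)"
    by (rule Lim_null_comparison)
  then show ?thesis
    by (simp add: DERIV_def LIM_zero_iff)
qed

text \<open>The mean value theorem along the segment from \<open>v\<close> to \<open>v'\<close>
  replaces the second difference by a difference of gradients at points \<open>w\<close> apart. The
  bound is a product of the two increments, obtained without a second derivative of
  \<open>F\<close>.\<close>

lemma mixed_difference:
  assumes w: "\<And>a. \<bar>w a\<bar> \<le> E" and v: "\<And>a. \<bar>v' a - v a\<bar> \<le> e"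
  shows "\<bar>(F (\<lambda>a. v' a + w a) - F v') - (F (\<lambda>a. v a + w a) - F v)\<bar> \<le> real CARD('a) * K * E * e"
proof -
  define h where "h a = v' a - v a" for a
  define f where "f t = F (\<lambda>a. v a + w a + t * h a) - F (\<lambda>a. v a + t * h a)" for t
  define f' where "f' t = (\<Sum>a\<in>UNIV. g (\<lambda>a. v a + w a + t * h a) a * h a) - (\<Sum>a\<in>UNIV. g (\<lambda>a. v a + t * h a) a * h a)" for t
  have "(f has_real_derivative f' t) (at t)" for t
    unfolding f_def f'_def by (intro DERIV_diff has_derivative_along_line)
  then obtain t where "f 1 - f 0 = (1 - 0) * f' t"
    using MVT2[of 0 1 f f'] by auto
  moreover have "\<bar>f' t\<bar> \<le> real CARD('a) * K * E * e"
    unfolding f'_def by (rule weighted_diff_le) (use v w in \<open>simp_all add: h_def\<close>)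
  moreover have "f 1 = F (\<lambda>a. v' a + w a) - F v'"
    by (simp add: f_def h_def algebra_simps)
  ultimately show ?thesis
    by (simp add: f_def)
qed

end

section \<open>The power function and normalizability\<close>

text \<open>Convexity of negative powers, reduced by \<open>r = t / s\<close> to the point 1, where
  it follows from \<open>ln r \<le> r - 1\<close> and \<open>1 + y \<le> exp y\<close>.\<close>

lemma powr_minus_tangent:
  fixes s t e :: real
  assumes "0 < s" "0 < t" "0 < e"
  shows "s powr (- e) - e * s powr (- e - 1) * (t - s) \<le> t powr (- e)"
proof -
  define r where "r = t / s"
  have r: "0 < r" "t = s * r" using assms by (auto simp: r_def)
  have "1 - e * (r - 1) \<le> 1 - e * ln r"
    using ln_le_minus_one[OF r(1)] assms by simp
  also have "\<dots> \<le> r powr (- e)"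
    using exp_ge_add_one_self[of "- e * ln r"] r by (simp add: powr_def)
  finally have "s powr (- e) * (1 - e * (r - 1)) \<le> s powr (- e) * r powr (- e)"
    by (intro mult_left_mono) auto
  moreover have "s powr (- e) * r powr (- e) = t powr (- e)"
    using assms r by (simp add: powr_mult)
  moreover have "s powr (- e) = s powr (- e - 1) * s"
    using assms by (simp add: powr_diff)
  ultimately show ?thesis
    unfolding r(2) by (simp add: algebra_simps)
qed

lemma powr_minus_le_1: "1 \<le> s \<Longrightarrow> 0 \<le> e \<Longrightarrow> s powr (- e) \<le> 1" for s e :: real
  using powr_mono[of "- e" 0 s] by simp

lemma powr_minus_lipschitz:
  fixes s t e :: real
  assumes "1 \<le> s" "1 \<le> t" "0 < e"
  shows "\<bar>s powr (- e) - t powr (- e)\<bar> \<le> e * \<bar>s - t\<bar>"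
proof -
  have "s powr (- e) - t powr (- e) \<le> e * \<bar>s - t\<bar>" if "1 \<le> s" "1 \<le> t" for s t
  proof -
    have "s powr (- e) - t powr (- e) \<le> s powr (- (e + 1)) * (e * (t - s))"
      using powr_minus_tangent[of s t e] that assms by (simp add: mult_ac)
    also have "\<dots> \<le> s powr (- (e + 1)) * (e * \<bar>s - t\<bar>)"
      using assms by (intro mult_left_mono) auto
    also have "\<dots> \<le> 1 * (e * \<bar>s - t\<bar>)"
      using that assms by (intro mult_right_mono powr_minus_le_1) auto
    finally show ?thesis by simp
  qed
  from this[OF assms(1,2)] this[OF assms(2,1)] show ?thesis
    by (simp add: abs_le_iff abs_minus_commute)
qed

text \<open>Concavity with its case of equality, which later makes the maximiser unique. After
  scaling it is the weighted arithmetic-geometric inequality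
  \<open>r powr q \<le> 1 - q + q * r\<close>.\<close>

lemma powr_le_tangent:
  fixes q x y :: real
  assumes q: "0 < q" "q < 1" and "0 < x" "0 < y"
  shows "x powr q \<le> y powr q + q * y powr (q - 1) * (x - y)"
    and "x powr q = y powr q + q * y powr (q - 1) * (x - y) \<Longrightarrow> x = y"
proof -
  define r where "r = x / y"
  have r: "0 < r" "x = y * r" using assms by (auto simp: r_def)
  \<comment> \<open>The weighted mean of \<open>r\<close> and 1. Applying
    \<open>ln t \<le> t - 1\<close> to \<open>r / M\<close> and \<open>1 / M\<close> with weights
    \<open>q\<close> and \<open>1 - q\<close> makes the right-hand sides cancel; equality forces
    \<open>r = M\<close>, hence \<open>r = 1\<close>.\<close>
  define M where "M = 1 - q + q * r"
  have M: "0 < M" using q r by (simp add: M_def add_pos_pos)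
  have le: "ln (r / M) \<le> r / M - 1" "ln (1 / M) \<le> 1 / M - 1"
    using r M by (auto intro!: ln_le_minus_one)
  have sum: "q * ln (r / M) + (1 - q) * ln (1 / M) = q * ln r - ln M"
    using r M by (simp add: ln_div algebra_simps)
  have zero: "q * (r / M - 1) + (1 - q) * (1 / M - 1) = 0"
    using M by (simp add: divide_simps) (simp add: M_def algebra_simps)
  have q_le: "q * ln (r / M) \<le> q * (r / M - 1)" "(1 - q) * ln (1 / M) \<le> (1 - q) * (1 / M - 1)"
    using le q by (auto intro!: mult_left_mono simp del: mult_le_cancel_left_pos)
  have eq: "x powr q = y powr q * r powr q" "q * y powr (q - 1) * (x - y) = y powr q * (q * (r - 1))"
  proof -
    have "y powr q = y powr (q - 1) * y" using assms by (simp add: powr_diff)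
    then show "q * y powr (q - 1) * (x - y) = y powr q * (q * (r - 1))"
      unfolding r(2) by (simp add: algebra_simps)
  qed (use r assms in \<open>simp add: powr_mult\<close>)
  have rq: "r powr q = exp (q * ln r)" "M = exp (ln M)" using r M by (simp_all add: powr_def)
  have "q * ln r \<le> ln M" using q_le sum zero by linarith
  then have "r powr q \<le> M" using rq by (metis exp_le_cancel_iff)
  then show "x powr q \<le> y powr q + q * y powr (q - 1) * (x - y)"
    unfolding eq using mult_left_mono[of "r powr q" M "y powr q"] by (simp add: M_def algebra_simps)
  assume "x powr q = y powr q + q * y powr (q - 1) * (x - y)"
  then have "y powr q * r powr q = y powr q * M"
    unfolding eq by (simp add: M_def algebra_simps)
  then have "r powr q = M" using assms by simp
  then have "ln M = q * ln r" using rq by (metis ln_exp)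
  then have "q * ln (r / M) = q * (r / M - 1)" using q_le sum zero by linarith
  then have "ln (r / M) = r / M - 1" using q by simp
  then have "r / M = 1" using r M by (intro ln_eq_minus_one) auto
  then have "r = M" using M by simp
  then have "(1 - q) * (r - 1) = 0" by (simp add: M_def algebra_simps)
  then have "r = 1" using q by simp
  then show "x = y" using r by simp
qed

section \<open>Second-order Taylor remainders of negative powers\<close>

definition powr_remainder :: "real \<Rightarrow> real \<Rightarrow> real \<Rightarrow> real" where
  "powr_remainder e s z = (s + z) powr (- e) - s powr (- e) + e * s powr (- e - 1) * z"

text \<open>Tangents at \<open>s\<close> and at \<open>s + z\<close> enclose the remainder between 0
  and \<open>e * z\<close> times a difference of powers, which is again of order
  \<open>z\<close>.\<close>

lemma powr_remainder_bound:
  assumes "1 \<le> s" "1 \<le> s + z" "0 < e"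
  shows "\<bar>powr_remainder e s z\<bar> \<le> e * (e + 1) * z\<^sup>2"
proof -
  have "0 \<le> powr_remainder e s z"
    using powr_minus_tangent[of s "s + z" e] assms by (simp add: powr_remainder_def)
  moreover have "powr_remainder e s z \<le> e * z * (s powr (- (e + 1)) - (s + z) powr (- (e + 1)))"
  proof -
    have "- (e + 1) = - e - 1" by simp
    then show ?thesis
      using powr_minus_tangent[of "s + z" s e] assms by (simp only: powr_remainder_def) (simp add: algebra_simps)
  qed
  moreover have "e * z * (s powr (- (e + 1)) - (s + z) powr (- (e + 1))) \<le> e * \<bar>z\<bar> * ((e + 1) * \<bar>z\<bar>)"
  proof -
    have "\<bar>e * z * (s powr (- (e + 1)) - (s + z) powr (- (e + 1)))\<bar> \<le> e * \<bar>z\<bar> * ((e + 1) * \<bar>z\<bar>)"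
      unfolding abs_mult using powr_minus_lipschitz[of s "s + z" "e + 1"] assms
      by (intro mult_mono) auto
    then show ?thesis by linarith
  qed
  ultimately show ?thesis
    by (simp add: power2_eq_square mult_ac)
qed

lemma has_derivative_powr_affine:
  assumes "0 < s + t * d"
  shows "((\<lambda>t. (s + t * d) powr r) has_real_derivative (r * (s + t * d) powr (r - 1) * d)) (at t)"
proof -
  have "((\<lambda>t. s + t * d) has_real_derivative d) (at t)"
    by (auto intro!: derivative_eq_intros)
  from DERIV_chain2[OF has_real_derivative_powr[OF assms] this] show ?thesis by simp
qed

text \<open>In \<open>s\<close> the derivative of the remainder is \<open>- e\<close> times the
  remainder with exponent \<open>e + 1\<close>, hence quadratic in \<open>z\<close>; in
  \<open>z\<close> it is a difference of powers, hence linear. This makes the composed remainder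
  quadratically small in the Lipschitz norm as well.\<close>

lemma powr_remainder_lipschitz:
  assumes s: "1 \<le> s" "1 \<le> s + z" "1 \<le> s'" "1 \<le> s' + z'" and e: "0 < e" and Z: "\<bar>z\<bar> \<le> Z" "\<bar>z'\<bar> \<le> Z"
  shows "\<bar>powr_remainder e s' z' - powr_remainder e s z\<bar>
    \<le> e * (e + 1) * (e + 2) * Z\<^sup>2 * \<bar>s' - s\<bar> + e * (e + 1) * Z * \<bar>z' - z\<bar>"
proof -
  define ds where "ds = s' - s"
  define dz where "dz = z' - z"
  define f where "f t = powr_remainder e (s + t * ds) (z + t * dz)" for t
  define f' where "f' t = - e * powr_remainder (e + 1) (s + t * ds) (z + t * dz) * ds
    - e * ((s + t * ds + (z + t * dz)) powr (- (e + 1)) - (s + t * ds) powr (- (e + 1))) * dz" for t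
  \<comment> \<open>The conditions \<open>s \<ge> 1\<close> and \<open>s + z \<ge> 1\<close> persist
    along the segment, so the mean value theorem applies on it.\<close>
  have conv: "1 \<le> x + t * (y - x)" if "1 \<le> x" "1 \<le> y" "0 \<le> t" "t \<le> 1" for x y t :: real
  proof -
    have "x + t * (y - x) = (1 - t) * x + t * y" by (simp add: algebra_simps)
    moreover have "(1 - t) * 1 \<le> (1 - t) * x" "t * 1 \<le> t * y"
      using that by (intro mult_left_mono; simp)+
    ultimately show ?thesis by (simp add: algebra_simps)
  qed
  have path: "1 \<le> s + t * ds" "1 \<le> s + t * ds + (z + t * dz)" if "0 \<le> t" "t \<le> 1" for t
    using conv[OF s(1,3) that] conv[OF s(2,4) that] by (simp_all add: ds_def dz_def algebra_simps)
  have deriv: "(f has_real_derivative f' t) (at t)" if "0 \<le> t" "t \<le> 1" for t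
  proof -
    have "((\<lambda>t. (s + z + t * (ds + dz)) powr (- e)) has_real_derivative (- e * (s + z + t * (ds + dz)) powr (- e - 1) * (ds + dz))) (at t)"
      using path(2)[OF that] by (intro has_derivative_powr_affine) (simp add: algebra_simps)
    moreover have "((\<lambda>t. (s + t * ds) powr (- e)) has_real_derivative (- e * (s + t * ds) powr (- e - 1) * ds)) (at t)"
      "((\<lambda>t. (s + t * ds) powr (- e - 1)) has_real_derivative ((- e - 1) * (s + t * ds) powr (- e - 1 - 1) * ds)) (at t)"
      using path(1)[OF that] by (intro has_derivative_powr_affine; simp)+
    moreover have "((\<lambda>t. z + t * dz) has_real_derivative dz) (at t)"
      by (auto intro!: derivative_eq_intros)
    ultimately have "((\<lambda>t. (s + z + t * (ds + dz)) powr (- e) - (s + t * ds) powr (- e) + e * ((s + t * ds) powr (- e - 1) * (z + t * dz)))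
      has_real_derivative ((- e * (s + z + t * (ds + dz)) powr (- e - 1) * (ds + dz)) - (- e * (s + t * ds) powr (- e - 1) * ds)
        + e * (((- e - 1) * (s + t * ds) powr (- e - 1 - 1) * ds) * (z + t * dz) + dz * (s + t * ds) powr (- e - 1)))) (at t)"
      by (intro DERIV_add DERIV_diff DERIV_cmult DERIV_mult)
    moreover have "(\<lambda>t. (s + z + t * (ds + dz)) powr (- e) - (s + t * ds) powr (- e) + e * ((s + t * ds) powr (- e - 1) * (z + t * dz))) = f"
      by (simp add: f_def powr_remainder_def fun_eq_iff algebra_simps)
    moreover have "(- e * (s + z + t * (ds + dz)) powr (- e - 1) * (ds + dz)) - (- e * (s + t * ds) powr (- e - 1) * ds)
        + e * (((- e - 1) * (s + t * ds) powr (- e - 1 - 1) * ds) * (z + t * dz) + dz * (s + t * ds) powr (- e - 1)) = f' t"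
    proof -
      define P Q R where "P = (s + t * ds + (z + t * dz)) powr (- e - 1)"
        and "Q = (s + t * ds) powr (- e - 1)" and "R = (s + t * ds) powr (- e - 1 - 1)"
      have arg: "s + z + t * (ds + dz) = s + t * ds + (z + t * dz)" by (simp add: algebra_simps)
      have e1: "- (e + 1) = - e - 1" by simp
      show ?thesis
        unfolding f'_def powr_remainder_def arg e1 P_def[symmetric] Q_def[symmetric] R_def[symmetric]
        by (simp add: algebra_simps)
    qed
    ultimately show ?thesis by simp
  qed
  have bound: "\<bar>f' t\<bar> \<le> e * (e + 1) * (e + 2) * Z\<^sup>2 * \<bar>ds\<bar> + e * (e + 1) * Z * \<bar>dz\<bar>" if "0 \<le> t" "t \<le> 1" for t
  proof -
    have "z + t * dz = (1 - t) * z + t * z'" by (simp add: dz_def algebra_simps)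
    moreover have "\<bar>(1 - t) * z\<bar> \<le> (1 - t) * Z" "\<bar>t * z'\<bar> \<le> t * Z"
      using Z that by (auto simp: abs_mult intro!: mult_left_mono)
    ultimately have zeta: "\<bar>z + t * dz\<bar> \<le> Z" by (simp add: algebra_simps)
    have "\<bar>e * powr_remainder (e + 1) (s + t * ds) (z + t * dz) * ds\<bar> \<le> e * ((e + 1) * (e + 2) * Z\<^sup>2) * \<bar>ds\<bar>"
    proof -
      have "\<bar>powr_remainder (e + 1) (s + t * ds) (z + t * dz)\<bar> \<le> (e + 1) * (e + 1 + 1) * (z + t * dz)\<^sup>2"
        using path[OF that] e by (intro powr_remainder_bound) auto
      also have "\<dots> \<le> (e + 1) * (e + 1 + 1) * Z\<^sup>2"
        using zeta e by (intro mult_left_mono) (auto simp: abs_le_square_iff[symmetric])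
      finally have "\<bar>powr_remainder (e + 1) (s + t * ds) (z + t * dz)\<bar> \<le> (e + 1) * (e + 2) * Z\<^sup>2"
        by (simp add: add.assoc)
      then show ?thesis
        unfolding abs_mult using e by (intro mult_right_mono mult_mono) auto
    qed
    moreover have "\<bar>e * ((s + t * ds + (z + t * dz)) powr (- (e + 1)) - (s + t * ds) powr (- (e + 1))) * dz\<bar> \<le> e * ((e + 1) * Z) * \<bar>dz\<bar>"
    proof -
      have "\<bar>(s + t * ds + (z + t * dz)) powr (- (e + 1)) - (s + t * ds) powr (- (e + 1))\<bar> \<le> (e + 1) * \<bar>z + t * dz\<bar>"
        using powr_minus_lipschitz[OF path(2,1)[OF that], of "e + 1"] e by simp
      also have "\<dots> \<le> (e + 1) * Z"
        using zeta e by (intro mult_left_mono) auto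
      finally show ?thesis
        unfolding abs_mult using e by (intro mult_right_mono mult_mono) auto
    qed
    ultimately show ?thesis
      unfolding f'_def by (simp add: mult.assoc)
  qed
  obtain t where t: "0 < t" "t < 1" "f 1 - f 0 = (1 - 0) * f' t"
    using MVT2[of 0 1 f f'] deriv by auto
  have "f 1 = powr_remainder e s' z'" "f 0 = powr_remainder e s z"
    by (simp_all add: f_def ds_def dz_def)
  then show ?thesis
    using t bound[of t] by (simp add: ds_def dz_def)
qed

section \<open>The normalising multiplier of a family of powers\<close>

definition multiplier :: "real \<Rightarrow> real \<Rightarrow> ('a::finite \<Rightarrow> real) \<Rightarrow> real" where
  "multiplier b \<gamma> v = (THE l. (\<forall>a. v a < l) \<and> (\<Sum>a\<in>UNIV. (\<gamma> * (l - v a)) powr (- 1 / b)) = 1)"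

text \<open>The powers \<open>- 1 / b\<close> of the slacks are the entries of a probability vector;
  using slacks instead of these entries keeps every base at least 1.\<close>

definition slack :: "real \<Rightarrow> real \<Rightarrow> ('a::finite \<Rightarrow> real) \<Rightarrow> 'a \<Rightarrow> real" where
  "slack b \<gamma> v a = \<gamma> * (multiplier b \<gamma> v - v a)"

text \<open>Implicit differentiation of the constraint that defines the multiplier.\<close>

definition multiplier_grad :: "real \<Rightarrow> real \<Rightarrow> ('a::finite \<Rightarrow> real) \<Rightarrow> 'a \<Rightarrow> real" where
  "multiplier_grad b \<gamma> v a =
     slack b \<gamma> v a powr (- 1 / b - 1) / (\<Sum>a\<in>UNIV. slack b \<gamma> v a powr (- 1 / b - 1))"

locale power_soft_max =
  fixes b \<gamma> :: real
  assumes b: "0 < b" and \<gamma>: "0 < \<gamma>"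
begin

text \<open>Intermediate value theorem between \<open>M + 1 / \<gamma>\<close>, where a largest
  coordinate alone contributes 1, and \<open>M + d powr b / \<gamma>\<close>, where each of the
  \<open>d\<close> terms is at most \<open>1 / d\<close>. Strict monotonicity gives
  uniqueness.\<close>

lemma multiplier_ex1: "\<exists>!l. (\<forall>a. v a < l) \<and> (\<Sum>a\<in>UNIV. (\<gamma> * (l - v a)) powr (- 1 / b)) = 1"
  for v :: "'a::finite \<Rightarrow> real"
proof -
  define f where "f l = (\<Sum>a\<in>UNIV. (\<gamma> * (l - v a)) powr (- 1 / b))" for l
  define M where "M = Max (range v)"
  define d where "d = real CARD('a)"
  have d: "1 \<le> d" by (simp add: d_def Suc_leI)
  have vM: "v a \<le> M" for a by (simp add: M_def)
  have "M \<in> range v" unfolding M_def by (intro Max_in) auto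
  then obtain a0 where a0: "v a0 = M" by auto
  have d1: "1 \<le> d powr b" using d b by (simp add: ge_one_powr_ge_zero)
  have "\<exists>l\<ge>M + 1 / \<gamma>. l \<le> M + d powr b / \<gamma> \<and> f l = 1"
  proof (rule IVT2')
    show "f (M + d powr b / \<gamma>) \<le> 1"
    proof -
      have "(\<gamma> * (M + d powr b / \<gamma> - v a)) powr (- 1 / b) \<le> 1 / d" for a
      proof -
        have "\<gamma> * (d powr b / \<gamma>) \<le> \<gamma> * (M + d powr b / \<gamma> - v a)"
          using vM[of a] \<gamma> by (intro mult_left_mono) auto
        then have "d powr b \<le> \<gamma> * (M + d powr b / \<gamma> - v a)" using \<gamma> by simp
        then have "(\<gamma> * (M + d powr b / \<gamma> - v a)) powr (- 1 / b) \<le> (d powr b) powr (- 1 / b)"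
          using b d1 by (intro powr_mono2') auto
        also have "\<dots> = 1 / d"
          using b d by (simp add: powr_powr powr_minus_divide)
        finally show ?thesis .
      qed
      then have "f (M + d powr b / \<gamma>) \<le> (\<Sum>a\<in>(UNIV :: 'a set). 1 / d)"
        unfolding f_def by (intro sum_mono)
      then show ?thesis using d by (simp add: d_def)
    qed
    show "1 \<le> f (M + 1 / \<gamma>)"
    proof -
      have "(\<gamma> * (M + 1 / \<gamma> - v a0)) powr (- 1 / b) \<le> f (M + 1 / \<gamma>)"
        unfolding f_def by (rule member_le_sum) auto
      then show ?thesis using \<gamma> by (simp add: a0)
    qed
    show "M + 1 / \<gamma> \<le> M + d powr b / \<gamma>"
      using d1 \<gamma> by (simp add: divide_right_mono)
    have "\<gamma> * (l - v a) \<noteq> 0" if "l \<in> {M + 1 / \<gamma>..M + d powr b / \<gamma>}" for l a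
    proof -
      have "0 < 1 / \<gamma>" using \<gamma> by simp
      then have "v a < l" using that vM[of a] by (simp only: atLeastAtMost_iff) linarith
      then show ?thesis using \<gamma> by simp
    qed
    then show "continuous_on {M + 1 / \<gamma>..M + d powr b / \<gamma>} f"
      unfolding f_def by (intro continuous_intros) auto
  qed
  then obtain l where l: "M + 1 / \<gamma> \<le> l" "f l = 1" by blast
  have "0 < 1 / \<gamma>" using \<gamma> by simp
  then have "\<forall>a. v a < l" using l(1) vM by (meson add_strict_increasing2 less_le_trans linorder_not_le order.strict_trans1 less_add_same_cancel1)
  moreover have False if "\<forall>a. v a < l1" "l1 < l2" "f l1 = 1" "f l2 = 1" for l1 l2
  proof -
    have "f l2 < f l1"
      unfolding f_def using that b \<gamma> by (intro sum_strict_mono powr_less_mono2_neg) auto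
    then show False using that by simp
  qed
  ultimately show ?thesis
    using l(2) unfolding f_def[symmetric] by (metis linorder_neqE)
qed

lemma multiplier:
  fixes v :: "'a::finite \<Rightarrow> real"
  shows "v a < multiplier b \<gamma> v" "(\<Sum>a\<in>UNIV. slack b \<gamma> v a powr (- 1 / b)) = 1"
  using theI'[OF multiplier_ex1[of v]] unfolding multiplier_def[symmetric] by (auto simp: slack_def)

lemma slack_pos: "0 < slack b \<gamma> v a"
  using multiplier(1)[of v a] \<gamma> by (simp add: slack_def)

lemma slack_ge_1: "1 \<le> slack b \<gamma> v a"
proof (rule ccontr)
  assume "\<not> 1 \<le> slack b \<gamma> v a"
  then have "1 powr (- 1 / b) < slack b \<gamma> v a powr (- 1 / b)"
    using slack_pos[of v a] b by (intro powr_less_mono2_neg) auto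
  also have "\<dots> \<le> (\<Sum>a\<in>UNIV. slack b \<gamma> v a powr (- 1 / b))"
    by (rule member_le_sum) auto
  finally show False using multiplier(2)[of v] by simp
qed

lemma sum_slack_pos: "0 < (\<Sum>a\<in>UNIV. slack b \<gamma> v a powr (- 1 / b - 1))"
  using slack_pos[of v] by (intro sum_pos) (auto simp: less_imp_neq[symmetric])

text \<open>Some entry of the probability vector is at least one over the number of letters, and the
  summand is the power \<open>1 + b\<close> of that entry. It keeps the denominator of the gradient
  away from 0 uniformly in \<open>v\<close>.\<close>

lemma sum_slack_bound:
  fixes v :: "'a::finite \<Rightarrow> real"
  shows "(1 / real CARD('a)) powr (1 + b) \<le> (\<Sum>a\<in>UNIV. slack b \<gamma> v a powr (- 1 / b - 1))"
proof -
  have "\<exists>a. 1 / real CARD('a) \<le> slack b \<gamma> v a powr (- 1 / b)"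
  proof (rule ccontr)
    assume "\<not> (\<exists>a. 1 / real CARD('a) \<le> slack b \<gamma> v a powr (- 1 / b))"
    then have "(\<Sum>a\<in>UNIV. slack b \<gamma> v a powr (- 1 / b)) < (\<Sum>a\<in>(UNIV :: 'a set). 1 / real CARD('a))"
      by (intro sum_strict_mono) (auto simp: not_le)
    then show False using multiplier(2)[of v] by simp
  qed
  then obtain a where "1 / real CARD('a) \<le> slack b \<gamma> v a powr (- 1 / b)" by blast
  then have "(1 / real CARD('a)) powr (1 + b) \<le> (slack b \<gamma> v a powr (- 1 / b)) powr (1 + b)"
    using b by (intro powr_mono2) auto
  also have "\<dots> = slack b \<gamma> v a powr (- 1 / b - 1)"
  proof -
    have "- 1 / b * (1 + b) = - 1 / b - 1" using b by (simp add: field_simps)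
    then show ?thesis by (simp only: powr_powr)
  qed
  also have "\<dots> \<le> (\<Sum>a\<in>UNIV. slack b \<gamma> v a powr (- 1 / b - 1))"
    by (rule member_le_sum) auto
  finally show ?thesis .
qed

text \<open>The tangent inequality for powers is summed from the slacks of \<open>v\<close> to those
  of \<open>w\<close>. Both sums of weights are 1 and cancel; up to positive factors the subgradient
  inequality remains.\<close>

sublocale multiplier: soft_max "multiplier b \<gamma>" "multiplier_grad b \<gamma>"
proof
  fix v w :: "'a \<Rightarrow> real" and a
  let ?S = "\<lambda>a. slack b \<gamma> v a powr (- 1 / b - 1)"
  note pos = sum_slack_pos[of v]
  show "0 \<le> multiplier_grad b \<gamma> v a"
    using pos by (simp add: multiplier_grad_def)
  show "(\<Sum>a\<in>UNIV. multiplier_grad b \<gamma> v a) = 1"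
    using pos by (simp add: multiplier_grad_def flip: sum_divide_distrib)
  have "(\<Sum>a\<in>UNIV. slack b \<gamma> v a powr (- 1 / b) - 1 / b * ?S a * (slack b \<gamma> w a - slack b \<gamma> v a))
      \<le> (\<Sum>a\<in>UNIV. slack b \<gamma> w a powr (- 1 / b))"
  proof (rule sum_mono)
    fix a
    show "slack b \<gamma> v a powr (- 1 / b) - 1 / b * ?S a * (slack b \<gamma> w a - slack b \<gamma> v a) \<le> slack b \<gamma> w a powr (- 1 / b)"
      using powr_minus_tangent[of "slack b \<gamma> v a" "slack b \<gamma> w a" "1 / b"] slack_pos[of v a] slack_pos[of w a] b
      by simp
  qed
  then have "0 \<le> 1 / b * (\<Sum>a\<in>UNIV. ?S a * (slack b \<gamma> w a - slack b \<gamma> v a))"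
    using multiplier(2)[of v] multiplier(2)[of w]
    by (simp add: sum_subtractf sum_distrib_left mult.assoc)
  then have "0 \<le> (\<Sum>a\<in>UNIV. ?S a * (slack b \<gamma> w a - slack b \<gamma> v a))"
    using b by (simp add: zero_le_mult_iff zero_le_divide_iff)
  also have "\<dots> = \<gamma> * ((multiplier b \<gamma> w - multiplier b \<gamma> v) * (\<Sum>a\<in>UNIV. ?S a) - (\<Sum>a\<in>UNIV. ?S a * (w a - v a)))"
    by (simp add: slack_def sum_distrib_left sum_subtractf sum.distrib algebra_simps)
  finally have "(\<Sum>a\<in>UNIV. ?S a * (w a - v a)) \<le> (multiplier b \<gamma> w - multiplier b \<gamma> v) * (\<Sum>a\<in>UNIV. ?S a)"
    using \<gamma> by (simp add: zero_le_mult_iff)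
  then have "(\<Sum>a\<in>UNIV. ?S a * (w a - v a)) / (\<Sum>a\<in>UNIV. ?S a) \<le> multiplier b \<gamma> w - multiplier b \<gamma> v"
    using pos by (simp add: pos_divide_le_eq)
  then show "multiplier b \<gamma> v + (\<Sum>a\<in>UNIV. multiplier_grad b \<gamma> v a * (w a - v a)) \<le> multiplier b \<gamma> w"
    by (simp add: multiplier_grad_def sum_divide_distrib)
qed

lemma slack_diff_le:
  assumes "\<And>a. \<bar>v a - w a\<bar> \<le> e"
  shows "\<bar>slack b \<gamma> v a - slack b \<gamma> w a\<bar> \<le> 2 * \<gamma> * e"
proof -
  have "\<bar>(multiplier b \<gamma> v - multiplier b \<gamma> w) - (v a - w a)\<bar> \<le> 2 * e"
    using multiplier.nonexpansive[of v w, OF assms] assms[of a] by linarith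
  then have "\<gamma> * \<bar>(multiplier b \<gamma> v - multiplier b \<gamma> w) - (v a - w a)\<bar> \<le> \<gamma> * (2 * e)"
    using \<gamma> by (intro mult_left_mono) auto
  moreover have "slack b \<gamma> v a - slack b \<gamma> w a = \<gamma> * ((multiplier b \<gamma> v - multiplier b \<gamma> w) - (v a - w a))"
    by (simp add: slack_def algebra_simps)
  ultimately show ?thesis using \<gamma> by (simp add: abs_mult)
qed

text \<open>Quotient rule: with \<open>k = (1 / b + 1) * (2 * \<gamma>)\<close>, numerator and
  denominator of the gradient have Lipschitz constants \<open>k\<close> and \<open>k\<close> times
  the number of letters, and the divisor is the lower bound of the denominator.\<close>

definition grad_const :: "'a::finite itself \<Rightarrow> real" where
  "grad_const _ = (1 + real CARD('a)) * (1 / b + 1) * (2 * \<gamma>) / (1 / real CARD('a)) powr (1 + b)"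

sublocale multiplier: smooth_soft_max "multiplier b \<gamma> :: ('a::finite \<Rightarrow> real) \<Rightarrow> real" "multiplier_grad b \<gamma>" "grad_const TYPE('a)"
proof
  fix v w :: "'a \<Rightarrow> real" and e a
  assume vw: "\<And>a. \<bar>v a - w a\<bar> \<le> e"
  let ?S = "\<lambda>v a. slack b \<gamma> v a powr (- 1 / b - 1)"
  let ?T = "\<lambda>v. \<Sum>a\<in>UNIV. ?S v a"
  let ?c = "(1 / real CARD('a)) powr (1 + b)"
  let ?k = "(1 / b + 1) * (2 * \<gamma> * e)"
  have c: "0 < ?c" by simp
  have e: "0 \<le> e" using vw[of a] by linarith
  have S: "\<bar>?S v a - ?S w a\<bar> \<le> ?k" for a
  proof -
    have "\<bar>?S v a - ?S w a\<bar> \<le> (1 / b + 1) * \<bar>slack b \<gamma> v a - slack b \<gamma> w a\<bar>"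
      using powr_minus_lipschitz[OF slack_ge_1[of v a] slack_ge_1[of w a], of "1 / b + 1"] b
      by (simp add: add_pos_pos)
    also have "\<dots> \<le> ?k"
      using b by (intro mult_left_mono slack_diff_le vw) (auto simp: add_nonneg_nonneg)
    finally show ?thesis .
  qed
  have T: "\<bar>?T v - ?T w\<bar> \<le> real CARD('a) * ?k"
  proof -
    have "\<bar>?T v - ?T w\<bar> \<le> (\<Sum>a\<in>UNIV. \<bar>?S v a - ?S w a\<bar>)"
      by (simp flip: sum_subtractf)
    also have "\<dots> \<le> (\<Sum>a\<in>(UNIV :: 'a set). ?k)"
      by (intro sum_mono S)
    finally show ?thesis by simp
  qed
  have Tv: "?c \<le> ?T v" "0 < ?T v" "0 < ?T w"
    using sum_slack_bound[of v] sum_slack_pos by auto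
  have "multiplier_grad b \<gamma> v a - multiplier_grad b \<gamma> w a
      = ((?S v a - ?S w a) - multiplier_grad b \<gamma> w a * (?T v - ?T w)) / ?T v"
    using Tv by (simp add: multiplier_grad_def field_simps)
  also have "\<bar>\<dots>\<bar> \<le> (?k + real CARD('a) * ?k) / ?c"
  proof -
    have "multiplier_grad b \<gamma> w a \<le> 1"
      using member_le_sum[of a UNIV "multiplier_grad b \<gamma> w"] multiplier.g_nonneg[of w] multiplier.sum_g[of w] by auto
    then have "\<bar>multiplier_grad b \<gamma> w a * (?T v - ?T w)\<bar> \<le> 1 * (real CARD('a) * ?k)"
      unfolding abs_mult using T multiplier.g_nonneg[of w a] by (intro mult_mono) auto
    then have "\<bar>(?S v a - ?S w a) - multiplier_grad b \<gamma> w a * (?T v - ?T w)\<bar> \<le> ?k + real CARD('a) * ?k"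
      using S[of a] by linarith
    then show ?thesis
      unfolding abs_divide using Tv c by (intro frac_le) auto
  qed
  finally show "\<bar>multiplier_grad b \<gamma> v a - multiplier_grad b \<gamma> w a\<bar> \<le> grad_const TYPE('a) * e"
    by (simp add: grad_const_def algebra_simps add_divide_distrib)
qed

end

theorem normalizable_all:
  assumes "0 < q" "q < 1" shows "normalizable q A"
proof -
  interpret power_soft_max "1 - q" "1 - q"
    using assms by unfold_locales auto
  obtain \<phi> c where \<phi>: "(norm A)-lipschitz_on UNIV \<phi>"
    "\<And>x. multiplier (1 - q) (1 - q) (\<lambda>a. apply_lip A (a ## x) + \<phi> (a ## x)) = \<phi> x + c"
    using multiplier.additive_eigenfunction[OF lipschitz_apply_lip] by blast
  have apply_\<phi>: "apply_lip (Lip \<phi>) = \<phi>"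
    using \<phi>(1) by (intro apply_Lip) blast
  \<comment> \<open>The term \<open>1 / (1 - q)\<close> in the constant absorbs the summand 1 of
    \<open>1 + (q - 1) * u x a\<close>, so that this base is exactly a slack.\<close>
  define u where "u x a = apply_lip A (a ## x) + \<phi> (a ## x) - \<phi> x - (c - 1 / (1 - q))" for x a
  have slack: "1 + (q - 1) * u x a = slack (1 - q) (1 - q) (\<lambda>a. apply_lip A (a ## x) + \<phi> (a ## x)) a" for x a
  proof -
    have "(1 - q) * (1 / (1 - q)) = 1" using assms by simp
    then show ?thesis
      unfolding slack_def \<phi>(2) u_def by (simp only: right_diff_distrib left_diff_distrib distrib_left)
  qed
  have exponent: "1 / (q - 1) = - 1 / (1 - q)"
    using assms by (simp add: field_simps)
  show ?thesis
    unfolding normalizable_def exp_2mq_def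
    by (intro exI[of _ "Lip \<phi>"] exI[of _ "c - 1 / (1 - q)"])
      (simp add: apply_\<phi> slack slack_pos exponent multiplier(2)[simplified] flip: u_def)
qed

section \<open>Equilibrium states\<close>

text \<open>Equating all partial derivatives \<open>(1 - b) / b * r a powr (- b) + v a\<close> to
  one multiplier and solving for \<open>r a\<close> gives this formula and the scale
  \<open>b / (1 - b)\<close>.\<close>

definition max_weight :: "real \<Rightarrow> ('a::finite \<Rightarrow> real) \<Rightarrow> 'a \<Rightarrow> real" where
  "max_weight b v a = slack b (b / (1 - b)) v a powr (- 1 / b)"

definition tsallis_max :: "real \<Rightarrow> ('a::finite \<Rightarrow> real) \<Rightarrow> real" where
  "tsallis_max b v = ((\<Sum>a\<in>UNIV. max_weight b v a powr (1 - b)) - 1) / b + (\<Sum>a\<in>UNIV. max_weight b v a * v a)"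

locale tsallis =
  fixes b :: real
  assumes b_pos: "0 < b" and b_less_1: "b < 1"

sublocale tsallis \<subseteq> power_soft_max b "b / (1 - b)"
  using b_pos b_less_1 by unfold_locales auto

context tsallis
begin

abbreviation "\<gamma> \<equiv> b / (1 - b)"

lemma max_weight_pos: "0 < max_weight b v a"
  using slack_pos[of v a] by (simp add: max_weight_def)

lemma sum_max_weight: "(\<Sum>a\<in>UNIV. max_weight b v a) = 1"
  unfolding max_weight_def by (rule multiplier(2))

lemma max_weight_powr: "max_weight b v a powr (- b) = slack b \<gamma> v a"
  using slack_pos[of v a] b_pos by (simp add: max_weight_def powr_powr)

text \<open>In the tangent inequality at \<open>max_weight\<close> the slopes are \<open>b\<close>
  times the multiplier minus \<open>v a\<close>; the multiplier drops out since both vectors have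
  mass 1. The gaps \<open>d a\<close> then add up to \<open>b\<close> times the deficit, so a zero
  deficit closes every gap.\<close>

lemma tsallis_max_variational:
  fixes v r :: "'a::finite \<Rightarrow> real"
  assumes r: "\<And>a. 0 < r a" and sum_r: "(\<Sum>a\<in>UNIV. r a) = 1"
  shows "((\<Sum>a\<in>UNIV. r a powr (1 - b)) - 1) / b + (\<Sum>a\<in>UNIV. r a * v a) \<le> tsallis_max b v"
    and "((\<Sum>a\<in>UNIV. r a powr (1 - b)) - 1) / b + (\<Sum>a\<in>UNIV. r a * v a) = tsallis_max b v \<Longrightarrow> r a = max_weight b v a"
proof -
  let ?p = "max_weight b v"
  define d where "d a = ?p a powr (1 - b) + (1 - b) * ?p a powr (- b) * (r a - ?p a) - r a powr (1 - b)" for a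
  have d: "0 \<le> d a" "d a = 0 \<Longrightarrow> r a = ?p a" for a
    using powr_le_tangent[of "1 - b" "r a" "?p a"] b_pos b_less_1 r[of a] max_weight_pos[of v a]
    by (auto simp: d_def)
  have slack: "(1 - b) * ?p a powr (- b) = b * (multiplier b \<gamma> v - v a)" for a
    using b_less_1 max_weight_powr[of v a] by (simp add: slack_def)
  have "(\<Sum>a\<in>UNIV. d a) = (\<Sum>a\<in>UNIV. ?p a powr (1 - b)) + (\<Sum>a\<in>UNIV. b * (multiplier b \<gamma> v - v a) * (r a - ?p a)) - (\<Sum>a\<in>UNIV. r a powr (1 - b))"
    by (simp add: d_def slack sum_subtractf sum.distrib)
  also have "(\<Sum>a\<in>UNIV. b * (multiplier b \<gamma> v - v a) * (r a - ?p a))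
      = b * (multiplier b \<gamma> v * ((\<Sum>a\<in>UNIV. r a) - (\<Sum>a\<in>UNIV. ?p a)) - ((\<Sum>a\<in>UNIV. r a * v a) - (\<Sum>a\<in>UNIV. ?p a * v a)))"
  proof -
    have "b * (multiplier b \<gamma> v - v a) * (r a - ?p a)
        = b * multiplier b \<gamma> v * r a - b * multiplier b \<gamma> v * ?p a - (b * (r a * v a) - b * (?p a * v a))" for a
      by (simp add: algebra_simps del: times_divide_eq_right times_divide_eq_left)
    then show ?thesis
      by (simp only: sum_subtractf flip: sum_distrib_left)
        (simp add: algebra_simps del: times_divide_eq_right times_divide_eq_left)
  qed
  also have "(\<Sum>a\<in>UNIV. ?p a powr (1 - b)) + \<dots> - (\<Sum>a\<in>UNIV. r a powr (1 - b))
      = b * (tsallis_max b v - (((\<Sum>a\<in>UNIV. r a powr (1 - b)) - 1) / b + (\<Sum>a\<in>UNIV. r a * v a)))"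
    using b_pos by (simp add: tsallis_max_def sum_r sum_max_weight field_simps)
  finally have sum_d: "(\<Sum>a\<in>UNIV. d a) = b * (tsallis_max b v - (((\<Sum>a\<in>UNIV. r a powr (1 - b)) - 1) / b + (\<Sum>a\<in>UNIV. r a * v a)))" .
  have "0 \<le> (\<Sum>a\<in>UNIV. d a)" by (intro sum_nonneg d)
  with sum_d show "((\<Sum>a\<in>UNIV. r a powr (1 - b)) - 1) / b + (\<Sum>a\<in>UNIV. r a * v a) \<le> tsallis_max b v"
    using b_pos by (simp add: zero_le_mult_iff)
  assume "((\<Sum>a\<in>UNIV. r a powr (1 - b)) - 1) / b + (\<Sum>a\<in>UNIV. r a * v a) = tsallis_max b v"
  with sum_d have "(\<Sum>a\<in>UNIV. d a) = 0" by simp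
  then have "d a = 0" using d(1) by (simp add: sum_nonneg_eq_0_iff)
  then show "r a = ?p a" by (rule d(2))
qed

text \<open>The subgradient inequality is the variational principle for \<open>w\<close> tested with
  the maximiser for \<open>v\<close>; the gradient is Lipschitz because the slacks are.\<close>

sublocale tsallis_max: smooth_soft_max "tsallis_max b" "max_weight b" "1 / b * (2 * \<gamma>)"
proof
  fix v w :: "'a \<Rightarrow> real" and a e
  show "0 \<le> max_weight b v a" using max_weight_pos[of v a] by simp
  show "(\<Sum>a\<in>UNIV. max_weight b v a) = 1" by (rule sum_max_weight)
  show "tsallis_max b v + (\<Sum>a\<in>UNIV. max_weight b v a * (w a - v a)) \<le> tsallis_max b w"
    using tsallis_max_variational(1)[OF max_weight_pos sum_max_weight, of v w]
    by (simp add: tsallis_max_def[of b v] right_diff_distrib sum_subtractf)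
  assume vw: "\<And>a. \<bar>v a - w a\<bar> \<le> e"
  have "\<bar>max_weight b v a - max_weight b w a\<bar> \<le> 1 / b * \<bar>slack b \<gamma> v a - slack b \<gamma> w a\<bar>"
    using powr_minus_lipschitz[OF slack_ge_1[of v a] slack_ge_1[of w a], of "1 / b"] b_pos
    by (simp add: max_weight_def)
  also have "\<dots> \<le> 1 / b * (2 * \<gamma> * e)"
    using b_pos by (intro mult_left_mono slack_diff_le vw) auto
  finally show "\<bar>max_weight b v a - max_weight b w a\<bar> \<le> 1 / b * (2 * \<gamma>) * e"
    by (simp only: mult.assoc)
qed

end

lemma lipschitz_on_soft_max:
  fixes u :: "'a::finite stream \<Rightarrow> real"
  assumes "soft_max F g" "C-lipschitz_on UNIV u"
  shows "C-lipschitz_on UNIV (\<lambda>x. F (\<lambda>a. u (a ## x)))"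
  unfolding lipschitz_on_real_iff
proof (intro conjI allI)
  interpret soft_max F g by fact
  show C: "0 \<le> C" using assms(2) by (rule lipschitz_on_nonneg)
  fix x y
  have "\<bar>u (a ## x) - u (a ## y)\<bar> \<le> C * dist x y" for a
  proof -
    have "\<bar>u (a ## x) - u (a ## y)\<bar> \<le> C * dist (a ## x) (a ## y)"
      using assms(2) by (simp only: lipschitz_on_real_iff)
    moreover have "0 \<le> C * dist x y" using C by simp
    ultimately show ?thesis by (simp add: dist_Stream_same)
  qed
  then show "\<bar>F (\<lambda>a. u (a ## x)) - F (\<lambda>a. u (a ## y))\<bar> \<le> C * dist x y"
    by (rule nonexpansive)
qed

lemma lipschitz_on_stl:
  fixes f :: "'a::finite stream \<Rightarrow> real"
  assumes "C-lipschitz_on UNIV f" shows "(C * 2)-lipschitz_on UNIV (\<lambda>x. f (stl x))"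
proof -
  have "2-lipschitz_on UNIV (stl :: 'a stream \<Rightarrow> _)"
    by (rule lipschitz_onI) (auto simp: dist_stl_le)
  then show ?thesis
    using lipschitz_on_compose2[of 2 UNIV stl C f] assms lipschitz_on_subset[OF assms] by auto
qed

section \<open>Pressure bound and equilibrium state from a Bellman solution\<close>

locale bellman = tsallis b for b +
  fixes A :: "'a::finite lip" and \<phi> :: "'a stream \<Rightarrow> real" and c :: real
  assumes lip_\<phi>: "(norm A)-lipschitz_on UNIV \<phi>"
    and bellman: "tsallis_max b (\<lambda>a. apply_lip A (a ## x) + \<phi> (a ## x)) = \<phi> x + c"
begin

definition "u x = apply_lip A x + \<phi> x"
definition "lam x = multiplier b \<gamma> (\<lambda>a. u (a ## x))"
text \<open>The slack of the first letter of \<open>x\<close> over the base point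
  \<open>stl x\<close>, made a function on the whole shift.\<close>

definition "s x = \<gamma> * (lam (stl x) - u x)"
definition "J = Lip (\<lambda>x. s x powr (- 1 / b))"

lemma bellman_u: "tsallis_max b (\<lambda>a. u (a ## x)) = \<phi> x + c"
  unfolding u_def by (rule bellman)

lemma s_Stream: "s (a ## x) = slack b \<gamma> (\<lambda>a. u (a ## x)) a"
  by (simp add: s_def lam_def slack_def)

lemma s_ge_1: "1 \<le> s x"
  using s_Stream[of "shd x" "stl x"] slack_ge_1[of "\<lambda>a. u (a ## stl x)" "shd x"] by simp

lemma lip_u: "(norm A + norm A)-lipschitz_on UNIV u"
  unfolding u_def by (intro lipschitz_on_add lipschitz_apply_lip lip_\<phi>)

lemma lip_lam: "(norm A + norm A)-lipschitz_on UNIV lam"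
  unfolding lam_def by (rule lipschitz_on_soft_max[OF multiplier.soft_max_axioms lip_u])

text \<open>Both \<open>u\<close> and \<open>lam\<close> have constant \<open>2 * norm A\<close>,
  and composition with the shift doubles that of \<open>lam\<close>:
  \<open>4 + 2 = 6\<close>.\<close>

lemma lip_s: "(6 * \<gamma> * norm A)-lipschitz_on UNIV s"
proof -
  have "(\<bar>\<gamma>\<bar> * ((norm A + norm A) * 2 + (norm A + norm A)))-lipschitz_on UNIV (\<lambda>x. \<gamma> *\<^sub>R (lam (stl x) - u x))"
    by (intro lipschitz_on_cmult lipschitz_on_diff lipschitz_on_stl lip_lam lip_u)
  moreover have "\<bar>\<gamma>\<bar> = \<gamma>" using b_pos b_less_1 by simp
  moreover have "g * ((n + n) * 2 + (n + n)) = 6 * g * n" for g n :: real by simp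
  moreover have "(\<lambda>x. \<gamma> *\<^sub>R (lam (stl x) - u x)) = s" by (simp add: fun_eq_iff s_def)
  ultimately show ?thesis by (simp only:)
qed

lemma lip_s_powr:
  assumes "0 < e"
  shows "(e * (6 * \<gamma> * norm A))-lipschitz_on UNIV (\<lambda>x. s x powr (- e))"
  unfolding lipschitz_on_real_iff
proof (intro conjI allI)
  show "0 \<le> e * (6 * \<gamma> * norm A)" using assms b_pos b_less_1 by simp
  fix x y
  have "\<bar>s x powr (- e) - s y powr (- e)\<bar> \<le> e * \<bar>s x - s y\<bar>"
    by (rule powr_minus_lipschitz[OF s_ge_1 s_ge_1 assms])
  also have "\<dots> \<le> e * (6 * \<gamma> * norm A * dist x y)"
    using lip_s assms unfolding lipschitz_on_real_iff by (intro mult_left_mono) auto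
  finally show "\<bar>s x powr (- e) - s y powr (- e)\<bar> \<le> e * (6 * \<gamma> * norm A) * dist x y"
    by (simp add: mult.assoc)
qed

lemma apply_J: "apply_lip J x = s x powr (- 1 / b)"
  unfolding J_def using lip_s_powr[of "1 / b"] b_pos by (subst apply_Lip) auto

lemma apply_J_Stream: "apply_lip J (a ## x) = max_weight b (\<lambda>a. u (a ## x)) a"
  by (simp add: apply_J s_Stream max_weight_def)

lemma is_jacobian_J: "is_jacobian J"
  unfolding is_jacobian_def
proof (intro conjI allI)
  fix x show "0 < apply_lip J x"
    using apply_J_Stream[of "shd x" "stl x"] max_weight_pos by simp
qed (simp add: apply_J_Stream sum_max_weight)

text \<open>Invariance replaces the integrand by its average over preimages, which is
  \<open>c - h\<close> plus the difference of \<open>\<phi>\<close> and its average under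
  \<open>K\<close>, of integral 0. As \<open>h\<close> is nonnegative and continuous, equality makes
  it vanish everywhere, and uniqueness of the maximiser identifies \<open>K\<close>.\<close>

lemma pressure_le:
  assumes "has_jacobian \<nu> K"
  shows "pressure_functional (1 - b) A \<nu> \<le> c"
    and "pressure_functional (1 - b) A \<nu> = c \<longleftrightarrow> K = J"
proof -
  interpret K: gibbs K \<nu> by (rule gibbsI[OF assms])
  note K_pos = K.J_pos
  have contK: "continuous_on UNIV (\<lambda>x. apply_lip K x powr r)" for r
  proof -
    have "apply_lip K x \<noteq> 0" for x using K_pos[of x] by simp
    then show ?thesis
      by (intro continuous_on_powr continuous_on_apply_lip continuous_on_const) blast
  qed
  have cont\<phi>: "continuous_on UNIV \<phi>" by (rule continuous_on_lipschitz[OF lip_\<phi>])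
  have contu: "continuous_on UNIV u" by (rule continuous_on_lipschitz[OF lip_u])
  define k where "k x a = apply_lip K (a ## x)" for x a
  have k: "0 < k x a" "(\<Sum>a\<in>UNIV. k x a) = 1" for x a
    using K_pos K.sum_J by (simp_all add: k_def)
  \<comment> \<open>The amount by which the branch probabilities of \<open>K\<close> fall short of
    the maximum at \<open>x\<close>.\<close>
  define h where "h x = \<phi> x + c - (((\<Sum>a\<in>UNIV. k x a powr (1 - b)) - 1) / b + (\<Sum>a\<in>UNIV. k x a * u (a ## x)))" for x
  have h: "0 \<le> h x" "h x = 0 \<Longrightarrow> k x a = max_weight b (\<lambda>a. u (a ## x)) a" for x a
  proof -
    note var = tsallis_max_variational[OF k(1)[of x] k(2)[of x], of "\<lambda>a. u (a ## x)", unfolded bellman_u]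
    show "0 \<le> h x" using var(1) by (simp add: h_def)
    show "k x a = max_weight b (\<lambda>a. u (a ## x)) a" if "h x = 0"
      by (rule var(2)) (use that in \<open>simp add: h_def\<close>)
  qed
  have conth: "continuous_on UNIV h"
    unfolding h_def k_def using b_pos
    by (intro continuous_intros cont\<phi> continuous_on_branch[OF contK] continuous_on_branch[OF contu]
        continuous_on_branch[OF continuous_on_apply_lip]) auto
  define f where "f x = (apply_lip K x powr (- b) - 1) / b + apply_lip A x" for x
  have contf: "continuous_on UNIV f"
    unfolding f_def using b_pos by (intro continuous_intros contK continuous_on_apply_lip) auto
  have log: "log_q (1 - b) (1 / apply_lip K x) = (apply_lip K x powr (- b) - 1) / b" for x
    using K_pos[of x] by (simp add: log_q_def powr_divide powr_minus_divide)
  have "pressure_functional (1 - b) A \<nu> = (\<integral>x. (apply_lip K x powr (- b) - 1) / b \<partial>\<nu>) + (\<integral>x. apply_lip A x \<partial>\<nu>)"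
    by (simp add: pressure_functional_def entropy_q_def K.jacobian_of_eq log)
  also have "\<dots> = (\<integral>x. f x \<partial>\<nu>)"
    unfolding f_def using b_pos
    by (intro Bochner_Integration.integral_add[symmetric] K.integrable_continuous)
      (auto intro!: continuous_intros contK continuous_on_apply_lip)
  also have "\<dots> = (\<integral>x. transfer_log K f x \<partial>\<nu>)"
    by (rule K.integral_transfer[OF contf, symmetric])
  also have "transfer_log K f = (\<lambda>x. \<phi> x + c - h x - transfer_log K \<phi> x)"
  proof
    fix x
    have "k x a powr (1 - b) = k x a * k x a powr (- b)" for a
      using k(1)[of x a] powr_add[of "k x a" 1 "- b"] by simp
    then have "(\<Sum>a\<in>UNIV. k x a powr (1 - b)) = (\<Sum>a\<in>UNIV. k x a * k x a powr (- b))" by simp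
    moreover have "transfer_log K f x = ((\<Sum>a\<in>UNIV. k x a * k x a powr (- b)) - (\<Sum>a\<in>UNIV. k x a)) / b + (\<Sum>a\<in>UNIV. k x a * apply_lip A (a ## x))"
      by (simp add: transfer_log_def f_def k_def sum_divide_distrib sum.distrib sum_subtractf algebra_simps diff_divide_distrib)
    moreover have "transfer_log K \<phi> x = (\<Sum>a\<in>UNIV. k x a * u (a ## x)) - (\<Sum>a\<in>UNIV. k x a * apply_lip A (a ## x))"
      by (simp add: transfer_log_def k_def u_def algebra_simps sum.distrib)
    ultimately show "transfer_log K f x = \<phi> x + c - h x - transfer_log K \<phi> x"
      by (simp add: h_def k(2))
  qed
  also have "(\<integral>x. \<phi> x + c - h x - transfer_log K \<phi> x \<partial>\<nu>) = (\<integral>x. \<phi> x \<partial>\<nu>) + c - (\<integral>x. h x \<partial>\<nu>) - (\<integral>x. \<phi> x \<partial>\<nu>)"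
    using cont\<phi> conth K.continuous_on_transfer[OF cont\<phi>]
    by (simp add: K.integrable_continuous K.integral_transfer)
  finally have P: "pressure_functional (1 - b) A \<nu> = c - (\<integral>x. h x \<partial>\<nu>)" by simp
  show "pressure_functional (1 - b) A \<nu> \<le> c"
    unfolding P using h(1) by (simp add: integral_nonneg)
  show "pressure_functional (1 - b) A \<nu> = c \<longleftrightarrow> K = J"
  proof
    assume "pressure_functional (1 - b) A \<nu> = c"
    then have "h x = 0" for x
      using P by (intro K.integral_zero_imp_zero conth h(1)) simp
    then have "apply_lip K (a ## x) = apply_lip J (a ## x)" for a x
      using h(2)[of x a] by (simp add: k_def apply_J_Stream)
    then have "apply_lip K x = apply_lip J x" for x
      by (metis stream.collapse)
    then show "K = J" by (rule lip_eqI)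
  next
    assume "K = J"
    then have "k x = max_weight b (\<lambda>a. u (a ## x))" for x
      by (simp add: k_def fun_eq_iff apply_J_Stream)
    then have "h x = 0" for x
      using bellman_u[of x] by (simp add: h_def tsallis_max_def)
    then show "pressure_functional (1 - b) A \<nu> = c" by (simp add: P)
  qed
qed

lemma equilibrium_state_iff: "equilibrium_state (1 - b) A \<mu> \<longleftrightarrow> has_jacobian \<mu> J"
proof -
  interpret jacobian J by unfold_locales (rule is_jacobian_J)
  obtain \<mu>0 where \<mu>0: "has_jacobian \<mu>0 J" using has_jacobian_exists by blast
  have "(SUP \<nu>\<in>jacobian_measures. ereal (pressure_functional (1 - b) A \<nu>)) = ereal c"
  proof (rule antisym)
    show "(SUP \<nu>\<in>jacobian_measures. ereal (pressure_functional (1 - b) A \<nu>)) \<le> ereal c"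
      using pressure_le(1) by (intro SUP_least) (auto simp: jacobian_measures_def)
    have "ereal c = ereal (pressure_functional (1 - b) A \<mu>0)"
      using pressure_le(2)[OF \<mu>0] by simp
    also have "\<dots> \<le> (SUP \<nu>\<in>jacobian_measures. ereal (pressure_functional (1 - b) A \<nu>))"
      using \<mu>0 by (intro SUP_upper) (auto simp: jacobian_measures_def)
    finally show "ereal c \<le> (SUP \<nu>\<in>jacobian_measures. ereal (pressure_functional (1 - b) A \<nu>))" .
  qed
  then show ?thesis
    using pressure_le(2) by (auto simp: equilibrium_state_def jacobian_measures_def)
qed

lemma ex1_equilibrium_state: "\<exists>!\<mu>. equilibrium_state (1 - b) A \<mu>"
proof -
  interpret jacobian J by unfold_locales (rule is_jacobian_J)
  obtain \<mu>0 where \<mu>0: "has_jacobian \<mu>0 J" using has_jacobian_exists by blast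
  interpret gibbs J \<mu>0 by (rule gibbsI[OF \<mu>0])
  show ?thesis
    unfolding equilibrium_state_iff using \<mu>0 measure_unique by blast
qed

lemma has_jacobian_the_equilibrium_state: "has_jacobian (the_equilibrium_state (1 - b) A) J"
  using theI'[OF ex1_equilibrium_state]
  by (simp add: the_equilibrium_state_def equilibrium_state_iff)

lemma jacobian_of_the_equilibrium_state: "jacobian_of (the_equilibrium_state (1 - b) A) = J"
  by (rule gibbs.jacobian_of_eq[OF gibbsI[OF has_jacobian_the_equilibrium_state]])

end

lemma (in tsallis) bellman_exists: "\<exists>\<phi> c. bellman b A \<phi> c"
proof -
  obtain \<phi> c where "(norm A)-lipschitz_on UNIV \<phi>"
    "\<And>x. tsallis_max b (\<lambda>a. apply_lip A (a ## x) + \<phi> (a ## x)) = \<phi> x + c"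
    using tsallis_max.additive_eigenfunction[OF lipschitz_apply_lip] by blast
  then show ?thesis
    by (intro exI[of _ \<phi>] exI[of _ c]) unfold_locales
qed

section \<open>Poisson equation and Lipschitz bounds\<close>

context gibbs
begin

text \<open>Neumann series for the inverse of \<open>1 - L\<close> on functions of mean 0;
  subtracting the mean makes it converge, and constants are sent to 0.\<close>

definition poisson :: "('a stream \<Rightarrow> real) \<Rightarrow> 'a stream \<Rightarrow> real" where
  "poisson f x = (\<Sum>n. (L ^^ n) f x - (\<integral>y. f y \<partial>\<mu>))"

lemma summable_poisson:
  assumes "M-lipschitz_on UNIV f"
  shows "summable (\<lambda>n. (L ^^ n) f x - (\<integral>y. f y \<partial>\<mu>))"
proof -
  obtain C \<rho> where C: "0 \<le> C" "0 < \<rho>" "\<rho> < 1"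
    "\<And>n. \<bar>(L ^^ n) f x - (\<integral>y. f y \<partial>\<mu>)\<bar> \<le> C * \<rho> ^ n * M"
    using iter_close_to_integral assms by metis
  have "summable (\<lambda>n. C * \<rho> ^ n * M)"
    using C by (intro summable_mult2 summable_mult summable_geometric) auto
  then show ?thesis
    by (rule summable_comparison_test'[where N=0]) (use C in auto)
qed

lemma poisson_add:
  assumes "M-lipschitz_on UNIV f" "N-lipschitz_on UNIV g"
  shows "poisson (\<lambda>x. f x + g x) x = poisson f x + poisson g x"
proof -
  have int: "integrable \<mu> f" "integrable \<mu> g"
    using assms by (auto intro: integrable_continuous continuous_on_lipschitz)
  show ?thesis
    unfolding poisson_def suminf_add[OF summable_poisson[OF assms(1)] summable_poisson[OF assms(2)]]
    by (simp add: iter_add int algebra_simps)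
qed

lemma poisson_cmult:
  assumes "M-lipschitz_on UNIV f"
  shows "poisson (\<lambda>x. r * f x) x = r * poisson f x"
  unfolding poisson_def suminf_mult[OF summable_poisson[OF assms], symmetric]
  by (simp add: iter_cmult algebra_simps)

lemma poisson_const: "poisson (\<lambda>_. r) x = 0"
  by (simp add: poisson_def iter_const)

lemma poisson_lipschitz:
  obtains C where "0 \<le> C" "\<And>f M. M-lipschitz_on UNIV f \<Longrightarrow> (C * M)-lipschitz_on UNIV (poisson f)"
proof -
  obtain C \<rho> where C: "0 \<le> C" "0 < \<rho>" "\<rho> < 1"
    "\<And>f M n. M-lipschitz_on UNIV f \<Longrightarrow> (C * \<rho> ^ n * M)-lipschitz_on UNIV ((L ^^ n) f)"
    using spectral_gap by blast
  have geo: "(\<lambda>n. C * \<rho> ^ n) sums (C * (1 / (1 - \<rho>)))"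
    using C by (intro sums_mult geometric_sums) auto
  have "(C * (1 / (1 - \<rho>)) * M)-lipschitz_on UNIV (poisson f)" if f: "M-lipschitz_on UNIV f" for f M
    unfolding lipschitz_on_real_iff
  proof (intro conjI allI)
    show "0 \<le> C * (1 / (1 - \<rho>)) * M"
      using C lipschitz_on_nonneg[OF f] by simp
    fix x y :: "'a stream"
    have sums: "(\<lambda>n. C * \<rho> ^ n * (M * dist x y)) sums (C * (1 / (1 - \<rho>)) * (M * dist x y))"
      by (rule sums_mult2[OF geo])
    have "poisson f x - poisson f y = (\<Sum>n. (L ^^ n) f x - (L ^^ n) f y)"
      unfolding poisson_def suminf_diff[OF summable_poisson[OF f] summable_poisson[OF f]] by simp
    also have "\<bar>\<dots>\<bar> \<le> (\<Sum>n. C * \<rho> ^ n * (M * dist x y))"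
    proof (rule norm_suminf_le[where 'a=real, unfolded real_norm_def])
      show "\<bar>(L ^^ n) f x - (L ^^ n) f y\<bar> \<le> C * \<rho> ^ n * (M * dist x y)" for n
        using C(4)[OF f, of n] by (simp add: lipschitz_on_real_iff mult.assoc)
    qed (rule sums_summable[OF sums])
    also have "\<dots> = C * (1 / (1 - \<rho>)) * M * dist x y"
      using sums_unique[OF sums] by (simp only: mult.assoc)
    finally show "\<bar>poisson f x - poisson f y\<bar> \<le> C * (1 / (1 - \<rho>)) * M * dist x y" .
  qed
  then show ?thesis
    using C by (intro that[of "C * (1 / (1 - \<rho>))"]) auto
qed

text \<open>The function \<open>h - L h\<close> has mean 0 and its iterates telescope, the iterates
  of \<open>h\<close> tending to its integral.\<close>

lemma poisson_solves:
  assumes h: "M-lipschitz_on UNIV h"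
  shows "poisson (\<lambda>x. h x - L h x) x = h x - (\<integral>y. h y \<partial>\<mu>)"
proof -
  note cont = continuous_on_lipschitz[OF h]
  obtain C \<rho> where C: "0 \<le> C" "0 < \<rho>" "\<rho> < 1"
    "\<And>n. \<bar>(L ^^ n) h x - (\<integral>y. h y \<partial>\<mu>)\<bar> \<le> C * \<rho> ^ n * M"
    using iter_close_to_integral h by metis
  have "(\<lambda>n. C * \<rho> ^ n * M) \<longlonglongrightarrow> 0"
    using C by (intro geometric_null)
  then have "(\<lambda>n. (L ^^ n) h x - (\<integral>y. h y \<partial>\<mu>)) \<longlonglongrightarrow> 0"
    by (rule Lim_null_comparison[rotated]) (use C in auto)
  then have "(\<lambda>n. (L ^^ n) h x) \<longlonglongrightarrow> (\<integral>y. h y \<partial>\<mu>)"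
    by (simp add: LIM_zero_iff)
  from telescope_sums'[OF this]
  have "(\<lambda>n. (L ^^ n) h x - (L ^^ Suc n) h x) sums (h x - (\<integral>y. h y \<partial>\<mu>))"
    by simp
  moreover have "(\<integral>y. h y - L h y \<partial>\<mu>) = 0"
    using cont by (simp add: integrable_continuous continuous_on_transfer integral_transfer)
  moreover have "(L ^^ n) (L h) = (L ^^ Suc n) h" for n
    by (simp add: funpow_swap1)
  ultimately show ?thesis
    unfolding poisson_def by (simp add: iter_diff sums_unique[symmetric])
qed

end

text \<open>One constant for both seminorms, on plain functions, so that intermediate quantities
  need no embedding into the type \<open>lip\<close>.\<close>

definition lip_bound :: "real \<Rightarrow> ('a::finite stream \<Rightarrow> real) \<Rightarrow> bool" where
  "lip_bound M f \<longleftrightarrow> (\<forall>x. \<bar>f x\<bar> \<le> M) \<and> M-lipschitz_on UNIV f"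

lemma lip_boundI:
  assumes "\<And>x. \<bar>f x\<bar> \<le> M" "\<And>x y. \<bar>f x - f y\<bar> \<le> M * dist x y" shows "lip_bound M f"
  using order.trans[OF abs_ge_zero assms(1)] assms by (auto simp: lip_bound_def lipschitz_on_real_iff)

lemma lip_boundD:
  assumes "lip_bound M f" shows "0 \<le> M" "\<bar>f x\<bar> \<le> M" "\<bar>f x - f y\<bar> \<le> M * dist x y" "M-lipschitz_on UNIV f"
  using assms by (auto simp: lip_bound_def lipschitz_on_real_iff)

lemma norm_lip_le:
  assumes "lip_bound M (apply_lip f)" shows "norm f \<le> 2 * M"
proof -
  have "norm f \<le> M + M"
  proof (rule norm_lip_least)
    fix x y
    show "\<bar>apply_lip f x\<bar> \<le> M" using lip_boundD(2)[OF assms] .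
    show "\<bar>apply_lip f x - apply_lip f y\<bar> / dist x y \<le> M"
      using lip_boundD(1,3)[OF assms] by (cases "x = y") (simp_all add: pos_divide_le_eq)
  qed
  then show ?thesis by simp
qed

lemma lip_bound_add: "lip_bound M f \<Longrightarrow> lip_bound N g \<Longrightarrow> lip_bound (M + N) (\<lambda>x. f x + g x)"
  unfolding lip_bound_def by (auto intro!: lipschitz_on_add order.trans[OF abs_triangle_ineq] add_mono)

lemma lip_bound_diff: "lip_bound M f \<Longrightarrow> lip_bound N g \<Longrightarrow> lip_bound (M + N) (\<lambda>x. f x - g x)"
  unfolding lip_bound_def by (auto intro!: lipschitz_on_diff order.trans[OF abs_triangle_ineq4] add_mono)

lemma lip_bound_const: "\<bar>r\<bar> \<le> M \<Longrightarrow> lip_bound M (\<lambda>_. r)"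
  by (rule lip_boundI) auto

lemma lip_bound_mult:
  assumes f: "lip_bound M f" and g: "lip_bound N g" shows "lip_bound (2 * M * N) (\<lambda>x. f x * g x)"
proof (rule lip_boundI)
  fix x y
  have MN: "0 \<le> M" "0 \<le> N" using lip_boundD(1) f g by blast+
  have "\<bar>f x\<bar> * \<bar>g x\<bar> \<le> M * N"
    using MN by (intro mult_mono lip_boundD(2)[OF f] lip_boundD(2)[OF g]) auto
  moreover have "0 \<le> M * N" using MN by simp
  ultimately show "\<bar>f x * g x\<bar> \<le> 2 * M * N"
    unfolding abs_mult by linarith
  have "\<bar>f x * (g x - g y)\<bar> \<le> M * (N * dist x y)"
    unfolding abs_mult using MN by (intro mult_mono lip_boundD(2)[OF f] lip_boundD(3)[OF g]) auto
  moreover have "\<bar>(f x - f y) * g y\<bar> \<le> (M * dist x y) * N"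
    unfolding abs_mult using MN by (intro mult_mono lip_boundD(3)[OF f] lip_boundD(2)[OF g]) auto
  moreover have "f x * g x - f y * g y = f x * (g x - g y) + (f x - f y) * g y"
    by (simp add: algebra_simps)
  ultimately show "\<bar>f x * g x - f y * g y\<bar> \<le> 2 * M * N * dist x y"
    by (simp add: mult_ac)
qed

lemma lip_bound_cmult: "lip_bound M f \<Longrightarrow> lip_bound (\<bar>r\<bar> * M) (\<lambda>x. r * f x)"
  by (rule lip_boundI) (auto simp: abs_mult mult.assoc lip_boundD intro!: mult_left_mono simp flip: right_diff_distrib)

lemma lip_bound_branch:
  fixes f :: "'a::finite stream \<Rightarrow> real"
  assumes "lip_bound M f" shows "lip_bound M (\<lambda>x. f (a ## x))"
proof (rule lip_boundI)
  fix x y :: "'a stream"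
  have "0 \<le> M * dist x y" using lip_boundD(1)[OF assms] by simp
  then show "\<bar>f (a ## x) - f (a ## y)\<bar> \<le> M * dist x y"
    using lip_boundD(3)[OF assms, of "a ## x" "a ## y"] by (simp add: dist_Stream_same)
qed (rule lip_boundD(2)[OF assms])

lemma lip_bound_stl: "lip_bound M f \<Longrightarrow> lip_bound (2 * M) (\<lambda>x. f (stl x))"
  using lipschitz_on_stl[of M f] lip_boundD(1)[of M f] lip_boundD(2)[of M f]
  by (auto simp: lip_bound_def mult.commute intro: order.trans[of _ M])

lemma lip_bound_sum:
  "finite S \<Longrightarrow> (\<And>i. i \<in> S \<Longrightarrow> lip_bound M (f i)) \<Longrightarrow> lip_bound (real (card S) * M) (\<lambda>x. \<Sum>i\<in>S. f i x)"
proof (induction S rule: finite_induct)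
  case (insert i S)
  then have "lip_bound (M + real (card S) * M) (\<lambda>x. f i x + (\<Sum>i\<in>S. f i x))"
    by (intro lip_bound_add) auto
  with insert show ?case by (simp add: algebra_simps)
qed (simp add: lip_bound_const)

lemma lip_bound_sum_branches:
  fixes f :: "'a::finite stream \<Rightarrow> real"
  assumes "lip_bound M f"
  shows "lip_bound (real CARD('a) * M) (\<lambda>x. \<Sum>a\<in>UNIV. f (a ## x))"
  using assms by (intro lip_bound_sum lip_bound_branch) auto

lemma lip_bound_inverse:
  fixes f :: "'a::finite stream \<Rightarrow> real"
  assumes f: "M-lipschitz_on UNIV f" and m: "0 < m" "\<And>x. m \<le> f x"
  shows "\<exists>N. lip_bound N (\<lambda>x. 1 / f x)"
proof
  show "lip_bound (1 / m + M / (m * m)) (\<lambda>x. 1 / f x)"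
  proof (rule lip_boundI)
    fix x y
    have pos: "0 < f x" for x using m(1) m(2)[of x] by linarith
    have M: "0 \<le> M" using f by (rule lipschitz_on_nonneg)
    have "\<bar>1 / f x\<bar> \<le> 1 / m"
      using m(1) m(2)[of x] pos[of x] by (simp add: frac_le)
    moreover have "0 \<le> M / (m * m)" using M m by simp
    ultimately show "\<bar>1 / f x\<bar> \<le> 1 / m + M / (m * m)" by linarith
    have "\<bar>1 / f x - 1 / f y\<bar> = \<bar>f x - f y\<bar> / (f x * f y)"
      using pos[of x] pos[of y] by (simp add: divide_simps abs_mult abs_minus_commute)
    also have "\<dots> \<le> (M * dist x y) / (m * m)"
      using f m pos M unfolding lipschitz_on_real_iff by (intro frac_le mult_mono) (auto simp: less_imp_le)
    also have "\<dots> \<le> (1 / m + M / (m * m)) * dist x y"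
      using m by (simp add: algebra_simps)
    finally show "\<bar>1 / f x - 1 / f y\<bar> \<le> (1 / m + M / (m * m)) * dist x y" .
  qed
qed

text \<open>The form in which Taylor errors enter the derivative: quadratic in \<open>Z\<close> for
  the uniform and for the Lipschitz seminorm at once.\<close>

lemma lip_bound_powr_remainder:
  assumes s: "S-lipschitz_on UNIV s" and z: "lip_bound Z z" and e: "0 < e"
    and "\<And>x. 1 \<le> s x" "\<And>x. 1 \<le> s x + z x"
  shows "lip_bound (e * (e + 1) * ((e + 2) * S + 1) * Z\<^sup>2) (\<lambda>x. powr_remainder e (s x) (z x))"
proof (rule lip_boundI)
  have S: "0 \<le> S" using s by (rule lipschitz_on_nonneg)
  have Z: "0 \<le> Z" using z by (rule lip_boundD)
  fix x y
  have "\<bar>powr_remainder e (s x) (z x)\<bar> \<le> e * (e + 1) * (z x)\<^sup>2"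
    by (rule powr_remainder_bound) (use assms in auto)
  also have "\<dots> \<le> e * (e + 1) * Z\<^sup>2"
    using e lip_boundD(2)[OF z, of x] Z by (intro mult_left_mono) (auto simp flip: abs_le_square_iff)
  also have "\<dots> \<le> e * (e + 1) * ((e + 2) * S + 1) * Z\<^sup>2"
  proof -
    have "0 \<le> e * (e + 1) * ((e + 2) * S) * Z\<^sup>2" using e S by simp
    then show ?thesis by (simp add: algebra_simps)
  qed
  finally show "\<bar>powr_remainder e (s x) (z x)\<bar> \<le> e * (e + 1) * ((e + 2) * S + 1) * Z\<^sup>2" .
  have "\<bar>powr_remainder e (s x) (z x) - powr_remainder e (s y) (z y)\<bar>
      \<le> e * (e + 1) * (e + 2) * Z\<^sup>2 * \<bar>s x - s y\<bar> + e * (e + 1) * Z * \<bar>z x - z y\<bar>"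
    by (rule powr_remainder_lipschitz) (use assms lip_boundD(2)[OF z] in auto)
  also have "\<dots> \<le> e * (e + 1) * (e + 2) * Z\<^sup>2 * (S * dist x y) + e * (e + 1) * Z * (Z * dist x y)"
    using s lip_boundD(3)[OF z, of x y] e Z unfolding lipschitz_on_real_iff
    by (intro add_mono mult_left_mono) auto
  also have "\<dots> = e * (e + 1) * ((e + 2) * S + 1) * Z\<^sup>2 * dist x y"
    by (simp add: algebra_simps power2_eq_square)
  finally show "\<bar>powr_remainder e (s x) (z x) - powr_remainder e (s y) (z y)\<bar>
    \<le> e * (e + 1) * ((e + 2) * S + 1) * Z\<^sup>2 * dist x y" .
qed

text \<open>A nonlinear Lasota-Yorke estimate. Varying \<open>w\<close> at fixed \<open>v\<close>
  gives \<open>W / 2\<close> by nonexpansiveness; varying \<open>v\<close> at fixed \<open>w\<close>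
  is a mixed difference. Constants pass through \<open>F\<close>, so the size of \<open>w\<close>
  enters only through its oscillation \<open>E\<close>.\<close>

lemma (in smooth_soft_max) increment_lipschitz:
  fixes v w :: "'a stream \<Rightarrow> real"
  assumes v: "V-lipschitz_on UNIV v" and w: "W-lipschitz_on UNIV w" and E: "\<And>x y. \<bar>w x - w y\<bar> \<le> E"
  shows "(W / 2 + real CARD('a) * K * E * V / 2)-lipschitz_on UNIV
    (\<lambda>x. F (\<lambda>a. v (a ## x) + w (a ## x)) - F (\<lambda>a. v (a ## x)))"
  unfolding lipschitz_on_real_iff
proof (intro conjI allI)
  have nonneg: "0 \<le> V" "0 \<le> W" "0 \<le> E"
    using v w E[of undefined undefined] by (auto intro: lipschitz_on_nonneg)
  then show "0 \<le> W / 2 + real CARD('a) * K * E * V / 2"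
    using K_nonneg by simp
  fix x y :: "'a stream"
  let ?z = "undefined :: 'a stream"
  define w0 where "w0 x a = w (a ## x) - w ?z" for x a
  define v0 where "v0 x a = v (a ## x)" for x a
  have shift: "F (\<lambda>a. v (a ## x) + w (a ## x)) = F (\<lambda>a. v0 x a + w0 x a) + w ?z" for x
    using translate[of "\<lambda>a. v0 x a + w0 x a" "w ?z"] by (simp add: v0_def w0_def)
  have "\<bar>F (\<lambda>a. v0 x a + w0 x a) - F (\<lambda>a. v0 x a + w0 y a)\<bar> \<le> W * (dist x y / 2)"
  proof (rule nonexpansive)
    fix a
    have "\<bar>w (a ## x) - w (a ## y)\<bar> \<le> W * dist (a ## x) (a ## y)"
      using w by (simp only: lipschitz_on_real_iff)
    then show "\<bar>v0 x a + w0 x a - (v0 x a + w0 y a)\<bar> \<le> W * (dist x y / 2)"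
      by (simp add: w0_def dist_Stream_same)
  qed
  moreover have "\<bar>(F (\<lambda>a. v0 x a + w0 y a) - F (v0 x)) - (F (\<lambda>a. v0 y a + w0 y a) - F (v0 y))\<bar>
      \<le> real CARD('a) * K * E * (V * (dist x y / 2))"
  proof (rule mixed_difference)
    fix a
    show "\<bar>w0 y a\<bar> \<le> E" unfolding w0_def by (rule E)
    have "\<bar>v (a ## x) - v (a ## y)\<bar> \<le> V * dist (a ## x) (a ## y)"
      using v by (simp only: lipschitz_on_real_iff)
    then show "\<bar>v0 x a - v0 y a\<bar> \<le> V * (dist x y / 2)"
      by (simp add: v0_def dist_Stream_same)
  qed
  ultimately have "\<bar>(F (\<lambda>a. v0 x a + w0 x a) - F (v0 x)) - (F (\<lambda>a. v0 y a + w0 y a) - F (v0 y))\<bar>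
      \<le> W * (dist x y / 2) + real CARD('a) * K * E * (V * (dist x y / 2))"
    by linarith
  then show "\<bar>F (\<lambda>a. v (a ## x) + w (a ## x)) - F (\<lambda>a. v (a ## x)) - (F (\<lambda>a. v (a ## y) + w (a ## y)) - F (\<lambda>a. v (a ## y)))\<bar>
      \<le> (W / 2 + real CARD('a) * K * E * V / 2) * dist x y"
    unfolding shift by (simp add: v0_def[abs_def] algebra_simps)
qed

lemma (in soft_max) increment_close:
  assumes "\<And>a. \<bar>w a - t\<bar> \<le> E"
  shows "\<bar>F (\<lambda>a. v a + w a) - F v - t\<bar> \<le> E"
proof -
  have "\<bar>F (\<lambda>a. v a + w a) - F (\<lambda>a. v a + t)\<bar> \<le> E"
    by (rule nonexpansive) (use assms in auto)
  then show ?thesis by (simp add: translate)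
qed

section \<open>Differentiability of the equilibrium state\<close>

sublocale bellman \<subseteq> eq: gibbs J "the_equilibrium_state (1 - b) A"
  by (rule gibbsI[OF has_jacobian_the_equilibrium_state])

context bellman
begin

text \<open>
  For the increment \<open>h\<close> of the eigenfunction, convexity gives \<open>h \<ge> L h - 2 \<parallel>B - A\<parallel>\<close>, so a nearly
  minimal value of \<open>h\<close> propagates to all its preimages; this bounds the oscillation of \<open>h\<close> by a small
  multiple of its Lipschitz constant plus a multiple of \<open>\<parallel>B - A\<parallel>\<close>. The mixed difference estimate
  returns a bound of the Lipschitz constant by the oscillation.
\<close>

lemma increment_lipschitz:
  obtains C where "0 \<le> C"
    "\<And>B \<phi>' c'. bellman b B \<phi>' c' \<Longrightarrow> (C * norm (B - A))-lipschitz_on UNIV (\<lambda>x. bellman.u B \<phi>' x - u x)"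
proof -
  obtain \<delta> where \<delta>: "0 < \<delta>" "\<delta> \<le> 1" "\<And>x. \<delta> \<le> apply_lip J x"
    using eq.J_bounded_below by blast
  \<comment> \<open>Coefficient of the oscillation in the increment estimate for the maximum, with
    the constant \<open>2 * norm A\<close> of \<open>u\<close> inserted.\<close>
  define P where "P = real CARD('a) * (1 / b * (2 * \<gamma>)) * (norm A + norm A) / 2"
  have P: "0 \<le> P" using b_pos b_less_1 by (simp add: P_def)
  \<comment> \<open>The Lipschitz part of the oscillation bound must return at most
    \<open>1/4\<close> of \<open>H\<close>; together with \<open>1/2\<close> from the branches this
    leaves the factor \<open>3/4\<close>.\<close>
  obtain n where "(1/2 :: real) ^ n < 1 / (4 * (P + 1))"
    using real_arch_pow_inv[of "1 / (4 * (P + 1))" "1/2"] P by auto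
  then have n: "P * (1/2) ^ n \<le> 1/4"
  proof -
    have "P * (1/2) ^ n \<le> (P + 1) * (1/2) ^ n" by (intro mult_right_mono) auto
    also have "\<dots> \<le> (P + 1) * (1 / (4 * (P + 1)))"
      using P \<open>(1/2) ^ n < _\<close> by (intro mult_left_mono) auto
    also have "\<dots> = 1/4" using P by (simp add: field_simps)
    finally show ?thesis .
  qed
  define N where "N = 2 * real n / \<delta> ^ n"
  have N: "0 \<le> N" using \<delta> by (simp add: N_def)
  define C1 where "C1 = 1/2 + P * (1 + N)"
  have C1: "0 \<le> C1" using P N by (simp add: C1_def)
  have "((1 + 4 * C1) * norm (B - A))-lipschitz_on UNIV (\<lambda>x. bellman.u B \<phi>' x - u x)"
    if B: "bellman b B \<phi>' c'" for B \<phi>' c'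
  proof -
    interpret Y: bellman b B \<phi>' c' by (rule B)
    define \<kappa> where "\<kappa> = norm (B - A)"
    have \<kappa>: "0 \<le> \<kappa>" by (simp add: \<kappa>_def)
    define k where "k = apply_lip (B - A)"
    have k: "\<kappa>-lipschitz_on UNIV k" "\<bar>k x\<bar> \<le> \<kappa>" for x
      unfolding k_def \<kappa>_def by (rule lipschitz_apply_lip, rule abs_apply_lip_le)
    define h where "h x = \<phi>' x - \<phi> x" for x
    define D where "D = c' - c"
    define w where "w x = Y.u x - u x" for x
    have w_eq: "w x = k x + h x" for x
      by (simp add: w_def k_def h_def u_def Y.u_def)
    have F_increment: "tsallis_max b (\<lambda>a. u (a ## x) + w (a ## x)) - tsallis_max b (\<lambda>a. u (a ## x)) = h x + D" for x
      using Y.bellman_u[of x] bellman_u[of x] by (simp add: w_def h_def D_def)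
    \<comment> \<open>Convexity at both ends: the increment of the maximum lies between the averages
      of \<open>w\<close> under the old and the new Jacobian.\<close>
    have lower: "eq.L w x \<le> h x + D" for x
      using tsallis_max.subgradient[of "\<lambda>a. u (a ## x)" "\<lambda>a. Y.u (a ## x)"]
      by (simp add: bellman_u Y.bellman_u transfer_log_def apply_J_Stream w_def h_def D_def)
    have upper: "h x + D \<le> Y.eq.L w x" for x
      using tsallis_max.diff_le[of "\<lambda>a. Y.u (a ## x)" "\<lambda>a. u (a ## x)"]
      by (simp add: bellman_u Y.bellman_u transfer_log_def Y.apply_J_Stream w_def h_def D_def)
    define H0 where "H0 = norm B + norm A"
    have H0: "H0-lipschitz_on UNIV h"
      unfolding h_def H0_def by (intro lipschitz_on_diff Y.lip_\<phi> lip_\<phi>)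
    obtain S where S: "\<And>x. \<bar>h x\<bar> \<le> S"
      using bounded_continuous_stream[OF continuous_on_lipschitz[OF H0]] by blast
    have bdd: "bdd_above (range h)" "bdd_below (range h)"
      using S by (auto intro!: bdd_aboveI2[of _ _ S] bdd_belowI2[of _ "- S"] simp: abs_le_iff minus_le_iff)
    define M where "M = Sup (range h)"
    define m where "m = Inf (range h)"
    have M: "h x \<le> M" and m: "m \<le> h x" for x
      unfolding M_def m_def using bdd by (auto intro: cSUP_upper cINF_lower)
    \<comment> \<open>On taking suprema in \<open>upper\<close>, the supremum of \<open>h\<close>
      cancels.\<close>
    have D: "D \<le> \<kappa>"
    proof -
      have "h x \<le> \<kappa> + M - D" for x
      proof -
        have "w y \<le> \<kappa> + M" for y using k(2)[of y] M[of y] by (simp add: w_eq abs_le_iff add_mono)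
        then have "Y.eq.L w x \<le> \<kappa> + M"
          using Y.eq.iter_le_const[of w "\<kappa> + M" 1 x] by simp
        then show ?thesis using upper[of x] by linarith
      qed
      then have "M \<le> \<kappa> + M - D"
        unfolding M_def by (intro cSUP_least) auto
      then show ?thesis by simp
    qed
    have super: "eq.L h x \<le> h x + 2 * \<kappa>" for x
    proof -
      have "h y - \<kappa> \<le> w y" for y using k(2)[of y] by (simp add: w_eq abs_le_iff)
      then have "eq.L (\<lambda>y. h y - \<kappa>) x \<le> eq.L w x" by (rule eq.transfer_mono)
      then show ?thesis using lower[of x] D by (simp add: eq.transfer_diff eq.transfer_const)
    qed
    have super_iter: "(eq.L ^^ n) h x \<le> h x + 2 * real n * \<kappa>" for n x
    proof (induction n arbitrary: x)
      case (Suc n)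
      have "(eq.L ^^ Suc n) h x \<le> eq.L (\<lambda>y. h y + 2 * real n * \<kappa>) x"
        by (simp add: eq.transfer_mono Suc.IH)
      also have "\<dots> = eq.L h x + 2 * real n * \<kappa>"
        by (simp add: eq.transfer_add eq.transfer_const)
      finally show ?case using super[of x] by (simp add: algebra_simps)
    qed simp
    have osc: "\<bar>h y - h x\<bar> \<le> H * (1/2) ^ n + N * \<kappa>" if H: "H-lipschitz_on UNIV h" for H x y
    proof -
      have "h y - h x \<le> H * (1/2) ^ n + N * \<kappa>" for x y
      proof -
        have \<delta>n: "0 < \<delta> ^ n" using \<delta> by simp
        have "\<delta> ^ n * (h y - H * (1/2) ^ n - m) + m - 2 * real n * \<kappa> \<le> h z" for z
        proof -
          have "\<bar>h y - h (stake n y @- z)\<bar> \<le> H * dist y (stake n y @- z)"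
            using H by (simp add: lipschitz_on_real_iff)
          also have "\<dots> \<le> H * (1/2) ^ n"
            using lipschitz_on_nonneg[OF H] by (intro mult_left_mono) (simp_all add: dist_stream_le_iff stake_shift)
          finally have "\<delta> ^ n * (h y - H * (1/2) ^ n - m) \<le> \<delta> ^ n * (h (stake n y @- z) - m)"
            using \<delta>n by (intro mult_left_mono) auto
          also have "\<dots> \<le> (eq.L ^^ n) (\<lambda>x. h x - m) z"
            using eq.iter_lower_bound[of \<delta> "\<lambda>x. h x - m" "stake n y" z] \<delta> m by simp
          also have "\<dots> = (eq.L ^^ n) h z - m"
            by (simp add: eq.iter_diff eq.iter_const)
          finally show ?thesis using super_iter[of n z] by linarith
        qed
        then have "\<delta> ^ n * (h y - H * (1/2) ^ n - m) + m - 2 * real n * \<kappa> \<le> m"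
          unfolding m_def by (intro cINF_greatest) auto
        then have "\<delta> ^ n * (h y - H * (1/2) ^ n - m) \<le> 2 * real n * \<kappa>" by linarith
        then have "h y - H * (1/2) ^ n - m \<le> 2 * real n * \<kappa> / \<delta> ^ n"
          using \<delta>n by (simp add: pos_le_divide_eq mult.commute)
        then show ?thesis using m[of x] by (simp add: N_def)
      qed
      from this[of x y] this[of y x] show ?thesis by (simp add: abs_le_iff)
    qed
    have improve: "(3/4 * H + C1 * \<kappa>)-lipschitz_on UNIV h" if H: "H-lipschitz_on UNIV h" for H
    proof -
      have H_nonneg: "0 \<le> H" using H by (rule lipschitz_on_nonneg)
      define E where "E = \<kappa> + (H * (1/2) ^ n + N * \<kappa>)"
      have "(\<kappa> + H)-lipschitz_on UNIV w"
        unfolding w_eq by (intro lipschitz_on_add k H)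
      moreover have "\<bar>w x - w y\<bar> \<le> E" for x y
        using lipschitz_stream_osc[OF k(1), of x y] osc[OF H, of x y] unfolding w_eq E_def by linarith
      ultimately have "((\<kappa> + H) / 2 + real CARD('a) * (1 / b * (2 * \<gamma>)) * E * (norm A + norm A) / 2)-lipschitz_on UNIV
          (\<lambda>x. tsallis_max b (\<lambda>a. u (a ## x) + w (a ## x)) - tsallis_max b (\<lambda>a. u (a ## x)))"
        by (intro tsallis_max.increment_lipschitz lip_u)
      then have "((\<kappa> + H) / 2 + P * E)-lipschitz_on UNIV (\<lambda>x. h x + D)"
        unfolding F_increment by (simp add: P_def mult_ac)
      then have "((\<kappa> + H) / 2 + P * E)-lipschitz_on UNIV h"
        by (simp add: lipschitz_on_real_iff)
      moreover have "(\<kappa> + H) / 2 + P * E \<le> 3/4 * H + C1 * \<kappa>"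
      proof -
        have "P * E = (P * (1/2) ^ n) * H + P * (1 + N) * \<kappa>"
          by (simp add: E_def algebra_simps)
        moreover have "(P * (1/2) ^ n) * H \<le> 1/4 * H"
          by (intro mult_right_mono n H_nonneg)
        moreover have "C1 * \<kappa> = 1/2 * \<kappa> + P * (1 + N) * \<kappa>"
          by (simp add: C1_def algebra_simps)
        moreover have "(\<kappa> + H) / 2 + e \<le> 3/4 * H + f" if "e = x + y" "x \<le> 1/4 * H" "f = 1/2 * \<kappa> + y" for e f x y
          using that by (simp add: field_simps)
        ultimately show ?thesis by blast
      qed
      ultimately show ?thesis
        by (rule lipschitz_on_le)
    qed
    \<comment> \<open>The a priori constant \<open>H0\<close> is not small with
      \<open>\<kappa>\<close>; repeated improvement drives its share to 0, and
      \<open>4 * C1 * \<kappa>\<close> is the fixed point of the map taking \<open>H\<close> to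
      \<open>3/4 * H + C1 * \<kappa>\<close>.\<close>
    have iterate: "((3/4) ^ j * H0 + 4 * C1 * \<kappa>)-lipschitz_on UNIV h" for j
    proof (induction j)
      case 0
      then show ?case using H0 C1 \<kappa> by (elim lipschitz_on_mono) auto
    next
      case (Suc j)
      then show ?case using improve[OF Suc] by (simp add: algebra_simps)
    qed
    have h: "(4 * C1 * \<kappa>)-lipschitz_on UNIV h"
      unfolding lipschitz_on_real_iff
    proof (intro conjI allI)
      show "0 \<le> 4 * C1 * \<kappa>" using C1 \<kappa> by simp
      fix x y :: "'a stream"
      have "(\<lambda>j. (3/4 :: real) ^ j) \<longlonglongrightarrow> 0"
        by (rule LIMSEQ_realpow_zero) auto
      from tendsto_mult[OF tendsto_add[OF tendsto_mult[OF this tendsto_const] tendsto_const] tendsto_const]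
      have "(\<lambda>j. ((3/4) ^ j * H0 + 4 * C1 * \<kappa>) * dist x y) \<longlonglongrightarrow> (0 * H0 + 4 * C1 * \<kappa>) * dist x y" .
      then have "\<bar>h x - h y\<bar> \<le> (0 * H0 + 4 * C1 * \<kappa>) * dist x y"
        by (rule LIMSEQ_le_const) (use iterate in \<open>auto simp: lipschitz_on_real_iff\<close>)
      then show "\<bar>h x - h y\<bar> \<le> 4 * C1 * \<kappa> * dist x y" by simp
    qed
    have "(\<kappa> + 4 * C1 * \<kappa>)-lipschitz_on UNIV w"
      unfolding w_eq by (intro lipschitz_on_add k h)
    then show ?thesis
      by (simp add: w_def[abs_def] \<kappa>_def algebra_simps)
  qed
  then show ?thesis
    using C1 by (intro that[of "1 + 4 * C1"]) auto
qed

text \<open>The multiplier is itself a soft maximum with Lipschitz gradient, so the increment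
  estimate applies to \<open>lam\<close>. A uniform bound is possible although \<open>w\<close> may
  be large: only \<open>l (stl x) - w x\<close> enters, which does not change when a constant is
  added to \<open>w\<close>.\<close>

lemma s_increment_bound:
  obtains C where "0 \<le> C"
    "\<And>B \<phi>' c'. bellman b B \<phi>' c' \<Longrightarrow> lip_bound (C * norm (B - A)) (\<lambda>x. bellman.s b B \<phi>' x - s x)"
proof -
  obtain C where C: "0 \<le> C"
    "\<And>B \<phi>' c'. bellman b B \<phi>' c' \<Longrightarrow> (C * norm (B - A))-lipschitz_on UNIV (\<lambda>x. bellman.u B \<phi>' x - u x)"
    using increment_lipschitz by blast
  define Cl where "Cl = C / 2 + real CARD('a) * grad_const TYPE('a) * C * (norm A + norm A) / 2"
  have Cl: "0 \<le> Cl" using C(1) multiplier.K_nonneg[where 'a='a] by (simp add: Cl_def)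
  have \<gamma>0: "0 < \<gamma>" using b_pos b_less_1 by simp
  have "lip_bound ((\<gamma> * (2 * Cl + C)) * norm (B - A)) (\<lambda>x. bellman.s b B \<phi>' x - s x)"
    if B: "bellman b B \<phi>' c'" for B \<phi>' c'
  proof -
    interpret Y: bellman b B \<phi>' c' by (rule B)
    define \<kappa> where "\<kappa> = norm (B - A)"
    have \<kappa>: "0 \<le> \<kappa>" by (simp add: \<kappa>_def)
    define w where "w x = Y.u x - u x" for x
    have w: "(C * \<kappa>)-lipschitz_on UNIV w"
      using C(2)[OF B] by (simp add: w_def[abs_def] \<kappa>_def)
    define l where "l x = Y.lam x - lam x" for x
    have l_eq: "l = (\<lambda>x. multiplier b \<gamma> (\<lambda>a. u (a ## x) + w (a ## x)) - multiplier b \<gamma> (\<lambda>a. u (a ## x)))"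
      by (simp add: fun_eq_iff l_def lam_def Y.lam_def w_def)
    have "((C * \<kappa>) / 2 + real CARD('a) * grad_const TYPE('a) * (C * \<kappa>) * (norm A + norm A) / 2)-lipschitz_on UNIV l"
      unfolding l_eq by (intro multiplier.increment_lipschitz lip_u w lipschitz_stream_osc[OF w])
    then have l: "(Cl * \<kappa>)-lipschitz_on UNIV l"
      by (simp add: Cl_def algebra_simps)
    have close: "\<bar>l (stl x) - w x\<bar> \<le> C * \<kappa>" for x
      unfolding l_eq by (rule multiplier.increment_close) (rule lipschitz_stream_osc[OF w])
    have z_eq: "Y.s x - s x = \<gamma> * (l (stl x) - w x)" for x
      by (simp only: Y.s_def s_def l_def w_def right_diff_distrib)
    have "lip_bound ((2 * Cl + C) * \<kappa>) (\<lambda>x. l (stl x) - w x)"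
    proof (rule lip_boundI)
      fix x y
      have "C * \<kappa> \<le> (2 * Cl + C) * \<kappa>" using Cl \<kappa> by (simp add: distrib_right)
      with close[of x] show "\<bar>l (stl x) - w x\<bar> \<le> (2 * Cl + C) * \<kappa>" by linarith
      have "((Cl * \<kappa>) * 2 + C * \<kappa>)-lipschitz_on UNIV (\<lambda>x. l (stl x) - w x)"
        by (intro lipschitz_on_diff lipschitz_on_stl l w)
      then show "\<bar>(l (stl x) - w x) - (l (stl y) - w y)\<bar> \<le> (2 * Cl + C) * \<kappa> * dist x y"
        by (simp add: lipschitz_on_real_iff algebra_simps)
    qed
    from lip_bound_cmult[OF this, of \<gamma>] show ?thesis
      unfolding z_eq using \<gamma>0 by (simp only: abs_of_pos \<kappa>_def mult.assoc)
  qed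
  moreover have "0 \<le> \<gamma> * (2 * Cl + C)"
    using \<gamma>0 C(1) Cl by (intro mult_nonneg_nonneg add_nonneg_nonneg) simp_all
  ultimately show ?thesis
    using that[of "\<gamma> * (2 * Cl + C)"] by blast
qed

section \<open>Linearisation at a Bellman solution\<close>

definition avg :: "('a stream \<Rightarrow> real) \<Rightarrow> 'a stream \<Rightarrow> real" where
  "avg w x = (\<Sum>a\<in>UNIV. multiplier_grad b \<gamma> (\<lambda>a. u (a ## x)) a * w (a ## x))"

lemma avg_add: "avg (\<lambda>x. f x + g x) x = avg f x + avg g x"
  by (simp add: avg_def distrib_left sum.distrib)

lemma avg_cmult: "avg (\<lambda>x. r * f x) x = r * avg f x"
  by (simp add: avg_def sum_distrib_left mult_ac)

lemma avg_const: "avg (\<lambda>_. r) x = r"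
  by (simp add: avg_def multiplier.sum_g flip: sum_distrib_right)

text \<open>As \<open>avg w\<close> is the first variation of \<open>lam\<close> when
  \<open>u\<close> varies by \<open>w\<close>, \<open>\<gamma>\<close> times this is the first
  variation of \<open>s\<close>. Constants are annihilated, which removes the free additive constant
  of \<open>\<phi>\<close>.\<close>

definition defect :: "('a stream \<Rightarrow> real) \<Rightarrow> 'a stream \<Rightarrow> real" where
  "defect w x = avg w (stl x) - w x"

lemma defect_add: "defect (\<lambda>x. f x + g x) x = defect f x + defect g x"
  by (simp add: defect_def avg_add)

lemma defect_cmult: "defect (\<lambda>x. r * f x) x = r * defect f x"
  by (simp add: defect_def avg_cmult right_diff_distrib)

lemma defect_const: "defect (\<lambda>_. r) x = 0"
  by (simp add: defect_def avg_const)

lemma defect_bound: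
  obtains C where "0 \<le> C" "\<And>w M. M-lipschitz_on UNIV w \<Longrightarrow> lip_bound (C * M) (defect w)"
proof -
  define C where "C = 2 * (1/2 + real CARD('a) * grad_const TYPE('a) * ((norm A + norm A) / 2)) + 1"
  have C1: "1 \<le> C" using multiplier.K_nonneg[where 'a='a] by (simp add: C_def)
  have "lip_bound (C * M) (defect w)" if w: "M-lipschitz_on UNIV w" for w M
  proof (rule lip_boundI)
    have M: "0 \<le> M" using w by (rule lipschitz_on_nonneg)
    fix x y :: "'a stream"
    have "defect w x = avg (\<lambda>y. w y + (- w x)) (stl x)"
      unfolding avg_add avg_const by (simp add: defect_def)
    also have "\<bar>\<dots>\<bar> \<le> M"
    proof -
      have "avg (\<lambda>y. w y + (- w x)) (stl x) \<le> M"
        unfolding avg_def using lipschitz_stream_osc[OF w, of _ x]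
        by (intro multiplier.weighted_sum_le) (simp add: abs_le_iff)
      moreover have "avg (\<lambda>y. (-1) * (w y + (- w x))) (stl x) \<le> M"
        unfolding avg_def using lipschitz_stream_osc[OF w, of _ x]
        by (intro multiplier.weighted_sum_le) (simp add: abs_le_iff)
      ultimately show ?thesis
        unfolding avg_cmult by (simp add: abs_le_iff)
    qed
    also have "M \<le> C * M" using C1 M mult_right_mono[of 1 C M] by simp
    finally show "\<bar>defect w x\<bar> \<le> C * M" .
    have avg_lip: "(M / 2 + real CARD('a) * grad_const TYPE('a) * ((norm A + norm A) / 2) * M)-lipschitz_on UNIV (avg w)"
      unfolding lipschitz_on_real_iff
    proof (intro conjI allI)
      show "0 \<le> M / 2 + real CARD('a) * grad_const TYPE('a) * ((norm A + norm A) / 2) * M"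
        using M multiplier.K_nonneg[where 'a='a] by simp
      fix x y :: "'a stream"
      let ?g = "\<lambda>x. multiplier_grad b \<gamma> (\<lambda>a. u (a ## x))"
      let ?z = "undefined :: 'a stream"
      have "\<bar>w (a ## x) - w (a ## y)\<bar> \<le> M * dist (a ## x) (a ## y)" for a
        using w by (simp only: lipschitz_on_real_iff)
      then have wd: "\<bar>w (a ## x) - w (a ## y)\<bar> \<le> M * (dist x y / 2)" for a
        by (simp add: dist_Stream_same)
      have "(\<Sum>a\<in>UNIV. ?g x a * (w (a ## x) - w (a ## y))) \<le> M * (dist x y / 2)"
        "(\<Sum>a\<in>UNIV. ?g x a * - (w (a ## x) - w (a ## y))) \<le> M * (dist x y / 2)"
        by (rule multiplier.weighted_sum_le, use wd in \<open>simp only: abs_le_iff\<close>)+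
      then have 1: "\<bar>\<Sum>a\<in>UNIV. ?g x a * (w (a ## x) - w (a ## y))\<bar> \<le> M * (dist x y / 2)"
        unfolding mult_minus_right sum_negf by (simp add: abs_le_iff)
      have "\<bar>u (a ## x) - u (a ## y)\<bar> \<le> (norm A + norm A) * dist (a ## x) (a ## y)" for a
        using lip_u by (simp only: lipschitz_on_real_iff)
      then have ud: "\<bar>u (a ## x) - u (a ## y)\<bar> \<le> (norm A + norm A) / 2 * dist x y" for a
        by (simp add: dist_Stream_same)
      have 2: "\<bar>(\<Sum>a\<in>UNIV. ?g x a * (w (a ## y) - w ?z)) - (\<Sum>a\<in>UNIV. ?g y a * (w (a ## y) - w ?z))\<bar>
          \<le> real CARD('a) * grad_const TYPE('a) * ((norm A + norm A) / 2 * dist x y) * M"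
        by (rule multiplier.weighted_diff_le[OF ud lipschitz_stream_osc[OF w]])
      have "avg w x - avg w y = (\<Sum>a\<in>UNIV. ?g x a * (w (a ## x) - w (a ## y)))
          + ((\<Sum>a\<in>UNIV. ?g x a * (w (a ## y) - w ?z)) - (\<Sum>a\<in>UNIV. ?g y a * (w (a ## y) - w ?z)))"
        by (simp add: avg_def right_diff_distrib sum_subtractf multiplier.sum_g flip: sum_distrib_right)
      then show "\<bar>avg w x - avg w y\<bar> \<le> (M / 2 + real CARD('a) * grad_const TYPE('a) * ((norm A + norm A) / 2) * M) * dist x y"
        using 1 2 by (simp add: algebra_simps)
    qed
    have "((M / 2 + real CARD('a) * grad_const TYPE('a) * ((norm A + norm A) / 2) * M) * 2 + M)-lipschitz_on UNIV (defect w)"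
      unfolding defect_def[abs_def] by (intro lipschitz_on_diff lipschitz_on_stl avg_lip w)
    then show "\<bar>defect w x - defect w y\<bar> \<le> C * M * dist x y"
      by (simp add: lipschitz_on_real_iff C_def algebra_simps)
  qed
  then show ?thesis using C1 by (intro that[of C]) auto
qed

text \<open>Inserting \<open>u (a ## x) = lam x - (1 - b) / b * s (a ## x)\<close> rewrites the
  maximum through the multiplier and powers of slacks, to which the Taylor remainder
  applies.\<close>

lemma bellman_lam: "\<phi> x + c = lam x + (\<Sum>a\<in>UNIV. s (a ## x) powr (- (1 / b - 1))) - 1 / b"
proof -
  let ?F = "\<Sum>a\<in>UNIV. s (a ## x) powr (- (1 / b - 1))"
  have pos: "0 < s y" for y using s_ge_1[of y] by simp
  have J_powr: "apply_lip J y powr (1 - b) = s y powr (- (1 / b - 1))" for y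
    unfolding apply_J powr_powr using b_pos by (simp add: field_simps)
  have J_s: "apply_lip J y * s y = s y powr (- (1 / b - 1))" for y
    using pos[of y] powr_add[of "s y" "- 1 / b" 1] by (simp add: apply_J)
  have "\<gamma> * ((1 - b) / b) = 1" using b_pos b_less_1 by simp
  then have u_eq: "u (a ## x) = lam x - (1 - b) / b * s (a ## x)" for a
  proof -
    have "(1 - b) / b * s (a ## x) = (\<gamma> * ((1 - b) / b)) * (lam x - u (a ## x))"
      by (simp only: s_def stream.sel mult_ac)
    then show ?thesis
      unfolding \<open>\<gamma> * ((1 - b) / b) = 1\<close> by simp
  qed
  have "(\<Sum>a\<in>UNIV. apply_lip J (a ## x) * u (a ## x))
      = (\<Sum>a\<in>UNIV. apply_lip J (a ## x) * lam x - (1 - b) / b * s (a ## x) powr (- (1 / b - 1)))"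
    by (intro sum.cong refl) (simp only: u_eq J_s[symmetric], simp add: algebra_simps)
  also have "\<dots> = lam x - (1 - b) / b * ?F"
    by (simp only: sum_subtractf eq.sum_J mult_1 flip: sum_distrib_right sum_distrib_left)
  finally have "\<phi> x + c = (?F - 1) / b + (lam x - (1 - b) / b * ?F)"
    using bellman_u[of x] by (simp add: tsallis_max_def J_powr flip: apply_J_Stream)
  moreover have "(f - 1) / b + (t - (1 - b) / b * f) = t + f - 1 / b" for f t
    using b_pos by (simp add: field_simps)
  ultimately show ?thesis by (simp only:)
qed

text \<open>Minus the derivative of \<open>s powr (- 1 / b)\<close>, the Jacobian, with respect to
  \<open>s\<close>.\<close>

definition "\<eta> x = 1 / b * s x powr (- 1 / b - 1)"

text \<open>First variation of \<open>u\<close> up to constants: \<open>k\<close> from the potential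
  itself, and the linearised increment of \<open>\<phi>\<close> from the Poisson equation.\<close>

definition potential_derivative :: "'a lip \<Rightarrow> 'a stream \<Rightarrow> real" where
  "potential_derivative k x = apply_lip k x + eq.poisson (eq.L (apply_lip k)) x"

text \<open>Chain rule: \<open>- \<eta>\<close> from the power, \<open>\<gamma>\<close> times the
  defect from the slack.\<close>

definition jacobian_derivative :: "'a lip \<Rightarrow> 'a stream \<Rightarrow> real" where
  "jacobian_derivative k x = - (\<gamma> * \<eta> x) * defect (potential_derivative k) x"

lemma lip_bound_\<eta>: "\<exists>M. lip_bound M (\<lambda>x. \<gamma> * \<eta> x)"
proof -
  have e: "0 < 1 / b + 1" using b_pos by (simp add: add_pos_pos)
  have lb: "lip_bound (1 + (1 / b + 1) * (6 * \<gamma> * norm A)) (\<lambda>x. s x powr (- (1 / b + 1)))"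
  proof (rule lip_boundI)
    fix x y
    have nonneg: "0 \<le> (1 / b + 1) * (6 * \<gamma> * norm A)"
      using lipschitz_on_nonneg[OF lip_s_powr[OF e]] .
    show "\<bar>s x powr (- (1 / b + 1))\<bar> \<le> 1 + (1 / b + 1) * (6 * \<gamma> * norm A)"
      using powr_minus_le_1[OF s_ge_1[of x], of "1 / b + 1"] e nonneg powr_ge_zero[of "s x" "- (1 / b + 1)"] by linarith
    have "\<bar>s x powr (- (1 / b + 1)) - s y powr (- (1 / b + 1))\<bar> \<le> (1 / b + 1) * (6 * \<gamma> * norm A) * dist x y"
      using lip_s_powr[OF e] by (simp only: lipschitz_on_real_iff)
    then show "\<bar>s x powr (- (1 / b + 1)) - s y powr (- (1 / b + 1))\<bar> \<le> (1 + (1 / b + 1) * (6 * \<gamma> * norm A)) * dist x y"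
      unfolding distrib_right[of 1] using zero_le_dist[of x y] by linarith
  qed
  have exponent: "- 1 / b - 1 = - (1 / b + 1)" by simp
  from lip_bound_cmult[OF lb, of "\<gamma> * (1 / b)"]
  have "lip_bound (\<bar>\<gamma> * (1 / b)\<bar> * (1 + (1 / b + 1) * (6 * \<gamma> * norm A))) (\<lambda>x. \<gamma> * \<eta> x)"
    unfolding \<eta>_def exponent mult.assoc[of \<gamma>, symmetric] .
  then show ?thesis by blast
qed

lemma sum_\<eta>: "(\<Sum>a\<in>UNIV. \<eta> (a ## x)) = 1 / b * (\<Sum>a\<in>UNIV. slack b \<gamma> (\<lambda>a. u (a ## x)) a powr (- 1 / b - 1))"
  by (simp add: \<eta>_def s_Stream sum_distrib_left)

lemma sum_\<eta>_pos: "0 < (\<Sum>a\<in>UNIV. \<eta> (a ## x))"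
  unfolding sum_\<eta> by (intro mult_pos_pos sum_slack_pos) (use b_pos in simp)

lemma avg_eq: "avg w x = (\<Sum>a\<in>UNIV. \<eta> (a ## x) * w (a ## x)) / (\<Sum>a\<in>UNIV. \<eta> (a ## x))"
proof -
  let ?S = "\<lambda>a. slack b \<gamma> (\<lambda>a. u (a ## x)) a powr (- 1 / b - 1)"
  have num: "(\<Sum>a\<in>UNIV. \<eta> (a ## x) * w (a ## x)) = 1 / b * (\<Sum>a\<in>UNIV. ?S a * w (a ## x))"
    by (simp only: \<eta>_def s_Stream sum_distrib_left mult.assoc)
  have "1 / b \<noteq> 0" using b_pos by simp
  then have "(\<Sum>a\<in>UNIV. \<eta> (a ## x) * w (a ## x)) / (\<Sum>a\<in>UNIV. \<eta> (a ## x)) = (\<Sum>a\<in>UNIV. ?S a * w (a ## x)) / (\<Sum>a\<in>UNIV. ?S a)"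
    unfolding num sum_\<eta> by (rule mult_divide_mult_cancel_left)
  then show ?thesis
    by (simp add: avg_def multiplier_grad_def sum_divide_distrib)
qed

lemma potential_derivative_lipschitz:
  obtains C where "0 \<le> C" "\<And>k. (C * norm k)-lipschitz_on UNIV (potential_derivative k)"
    "\<And>k. \<exists>M. M-lipschitz_on UNIV (eq.L (apply_lip k))"
proof -
  obtain C1 \<rho> where C1: "0 \<le> C1" "0 < \<rho>" "\<rho> < 1"
    "\<And>f M n. M-lipschitz_on UNIV f \<Longrightarrow> (C1 * \<rho> ^ n * M)-lipschitz_on UNIV ((eq.L ^^ n) f)"
    using eq.spectral_gap by blast
  obtain C2 where C2: "0 \<le> C2" "\<And>f M. M-lipschitz_on UNIV f \<Longrightarrow> (C2 * M)-lipschitz_on UNIV (eq.poisson f)"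
    using eq.poisson_lipschitz by blast
  have L: "(C1 * \<rho> * norm k)-lipschitz_on UNIV (eq.L (apply_lip k))" for k
    using C1(4)[OF lipschitz_apply_lip[of k], of 1] by simp
  have "(norm k + C2 * (C1 * \<rho> * norm k))-lipschitz_on UNIV (potential_derivative k)" for k
    unfolding potential_derivative_def[abs_def] by (intro lipschitz_on_add lipschitz_apply_lip C2(2) L)
  moreover have "norm k + C2 * (C1 * \<rho> * norm k) = (1 + C2 * (C1 * \<rho>)) * norm k" for k :: "'a lip"
    by (simp add: algebra_simps)
  ultimately show ?thesis
    using L by (intro that[of "1 + C2 * (C1 * \<rho>)"]) (use C1(1,2) C2(1) in \<open>auto intro!: add_nonneg_nonneg mult_nonneg_nonneg simp only: zero_le_one less_imp_le\<close>)
qed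

lemma bounded_linear_jacobian_derivative:
  "bounded_linear (\<lambda>k. Lip (jacobian_derivative k))"
  "apply_lip (Lip (jacobian_derivative k)) = jacobian_derivative k"
proof -
  obtain C1 where C1: "0 \<le> C1" "\<And>k. (C1 * norm k)-lipschitz_on UNIV (potential_derivative k)"
    "\<And>k. \<exists>M. M-lipschitz_on UNIV (eq.L (apply_lip k))"
    using potential_derivative_lipschitz by blast
  obtain C2 where C2: "0 \<le> C2" "\<And>w M. M-lipschitz_on UNIV w \<Longrightarrow> lip_bound (C2 * M) (defect w)"
    using defect_bound by blast
  obtain M where M: "lip_bound M (\<lambda>x. \<gamma> * \<eta> x)" using lip_bound_\<eta> by blast
  have bound: "lip_bound (2 * M * (C2 * (C1 * norm k))) (jacobian_derivative k)" for k
  proof -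
    have "lip_bound (\<bar>-1\<bar> * (2 * M * (C2 * (C1 * norm k)))) (\<lambda>x. (-1) * ((\<gamma> * \<eta> x) * defect (potential_derivative k) x))"
      by (intro lip_bound_cmult lip_bound_mult M C2(2) C1(2))
    then show ?thesis by (simp add: jacobian_derivative_def[abs_def])
  qed
  have apply_D: "apply_lip (Lip (jacobian_derivative k)) = jacobian_derivative k" for k
    using lip_boundD(4)[OF bound[of k]] by (intro apply_Lip) blast
  then show "apply_lip (Lip (jacobian_derivative k)) = jacobian_derivative k" .
  show "bounded_linear (\<lambda>k. Lip (jacobian_derivative k))"
  proof (rule bounded_linear_intro[where K="4 * M * (C2 * C1)"])
    fix k k' :: "'a lip" and r
    obtain N N' where N: "N-lipschitz_on UNIV (eq.L (apply_lip k))" "N'-lipschitz_on UNIV (eq.L (apply_lip k'))"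
      using C1(3) by blast
    have "potential_derivative (k + k') = (\<lambda>x. potential_derivative k x + potential_derivative k' x)"
      by (simp add: fun_eq_iff potential_derivative_def plus_lip.rep_eq eq.transfer_add eq.poisson_add[OF N])
    then show "Lip (jacobian_derivative (k + k')) = Lip (jacobian_derivative k) + Lip (jacobian_derivative k')"
      by (intro lip_eqI) (simp add: apply_D jacobian_derivative_def defect_add algebra_simps)
    have "potential_derivative (r *\<^sub>R k) = (\<lambda>x. r * potential_derivative k x)"
      by (simp add: fun_eq_iff potential_derivative_def scaleR_lip.rep_eq eq.transfer_cmult eq.poisson_cmult[OF N(1)] algebra_simps)
    then show "Lip (jacobian_derivative (r *\<^sub>R k)) = r *\<^sub>R Lip (jacobian_derivative k)"
      by (intro lip_eqI) (simp add: apply_D jacobian_derivative_def defect_cmult)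
    show "norm (Lip (jacobian_derivative k)) \<le> norm k * (4 * M * (C2 * C1))"
      using norm_lip_le[of "2 * M * (C2 * (C1 * norm k))" "Lip (jacobian_derivative k)"] bound[of k]
      by (simp add: apply_D mult_ac)
  qed
qed

text \<open>Three errors add up in \<open>C\<close>: the Taylor remainder of the power defining the
  Jacobian, the error in solving for the change of \<open>lam\<close>, and the error of the
  linearised Bellman equation after inversion of \<open>1 - L\<close>. Each is quadratic in
  \<open>norm (B - A)\<close>.\<close>

lemma jacobian_remainder:
  obtains C where "0 \<le> C"
    "\<And>B \<phi>' c'. bellman b B \<phi>' c' \<Longrightarrow>
      lip_bound (C * (norm (B - A))\<^sup>2) (\<lambda>x. apply_lip (bellman.J b B \<phi>') x - apply_lip J x - jacobian_derivative (B - A) x)"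
proof -
  obtain Cz where Cz: "0 \<le> Cz"
    "\<And>B \<phi>' c'. bellman b B \<phi>' c' \<Longrightarrow> lip_bound (Cz * norm (B - A)) (\<lambda>x. bellman.s b B \<phi>' x - s x)"
    using s_increment_bound by blast
  obtain Cp where Cp: "0 \<le> Cp" "\<And>f M. M-lipschitz_on UNIV f \<Longrightarrow> (Cp * M)-lipschitz_on UNIV (eq.poisson f)"
    using eq.poisson_lipschitz by blast
  obtain Cd where Cd: "0 \<le> Cd" "\<And>w M. M-lipschitz_on UNIV w \<Longrightarrow> lip_bound (Cd * M) (defect w)"
    using defect_bound by blast
  obtain M where M: "lip_bound M (\<lambda>x. \<gamma> * \<eta> x)" using lip_bound_\<eta> by blast
  have \<gamma>0: "0 < \<gamma>" using b_pos b_less_1 by simp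
  define T where "T x = (\<Sum>a\<in>UNIV. \<gamma> * \<eta> (a ## x))" for x
  have T_eq: "T x = \<gamma> * (\<Sum>a\<in>UNIV. \<eta> (a ## x))" for x
    by (simp only: T_def sum_distrib_left)
  have T_pos: "0 < T x" for x
    unfolding T_eq using \<gamma>0 sum_\<eta>_pos by (rule mult_pos_pos)
  have "\<gamma> * (1 / b * (1 / real CARD('a)) powr (1 + b)) \<le> T x" for x
    unfolding T_eq sum_\<eta> using \<gamma>0 b_pos by (intro mult_left_mono sum_slack_bound) auto
  moreover have "0 < \<gamma> * (1 / b * (1 / real CARD('a)) powr (1 + b))"
    using \<gamma>0 b_pos by (intro mult_pos_pos) auto
  moreover have "(real CARD('a) * M)-lipschitz_on UNIV T"
    unfolding T_def[abs_def] by (rule lip_boundD(4)[OF lip_bound_sum_branches[OF M]])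
  ultimately obtain N where N: "lip_bound N (\<lambda>x. 1 / T x)"
    using lip_bound_inverse by metis
  \<comment> \<open>The exponent occurring in \<open>bellman_lam\<close>: the derivative of
    \<open>s powr (- \<epsilon>)\<close> in \<open>s\<close> is \<open>- \<epsilon>\<close> times
    the Jacobian, and \<open>\<epsilon> * \<gamma> = 1\<close> removes the factor.\<close>
  define \<epsilon> where "\<epsilon> = 1 / b - 1"
  have \<epsilon>: "0 < \<epsilon>" "\<epsilon> * \<gamma> = 1" using b_pos b_less_1 by (simp_all add: \<epsilon>_def field_simps)
  define S where "S = 6 * \<gamma> * norm A"
  define q where "q e = e * (e + 1) * ((e + 2) * S + 1) * Cz\<^sup>2" for e
  have S: "0 \<le> S" unfolding S_def by (rule lipschitz_on_nonneg[OF lip_s])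
  have q: "0 \<le> q e" if "0 < e" for e using that S by (simp add: q_def)
  define d where "d = real CARD('a)"
  have MN: "0 \<le> M" "0 \<le> N" using lip_boundD(1) M N by blast+
  define C where "C = q (1 / b) + 2 * M * (2 * (2 * (d * q (1 / b)) * N)) + 2 * M * (Cd * (Cp * (d * q \<epsilon>)))"
  have C: "0 \<le> C"
    unfolding C_def using q[of "1 / b"] q[of \<epsilon>] b_pos \<epsilon> MN Cd(1) Cp(1)
    by (intro add_nonneg_nonneg mult_nonneg_nonneg) (auto simp: d_def)
  have "lip_bound (C * (norm (B - A))\<^sup>2) (\<lambda>x. apply_lip (bellman.J b B \<phi>') x - apply_lip J x - jacobian_derivative (B - A) x)"
    if B: "bellman b B \<phi>' c'" for B \<phi>' c'
  proof -
    interpret Y: bellman b B \<phi>' c' by (rule B)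
    define \<kappa> where "\<kappa> = norm (B - A)"
    define k where "k = apply_lip (B - A)"
    define h where "h x = \<phi>' x - \<phi> x" for x
    define D where "D = c' - c"
    define w where "w x = Y.u x - u x" for x
    define l where "l x = Y.lam x - lam x" for x
    define z where "z x = Y.s x - s x" for x
    have w_eq: "w x = k x + h x" for x
      by (simp add: w_def k_def h_def u_def Y.u_def)
    have z_eq: "z x = \<gamma> * (l (stl x) - w x)" for x
      by (simp only: Y.s_def s_def l_def w_def z_def right_diff_distrib)
    have z: "lip_bound (Cz * \<kappa>) z"
      using Cz(2)[OF B] by (simp add: z_def[abs_def] \<kappa>_def)
    define rem where "rem e x = powr_remainder e (s x) (z x)" for e x
    have rem: "lip_bound (q e * \<kappa>\<^sup>2) (rem e)" if "0 < e" for e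
    proof -
      have "lip_bound (e * (e + 1) * ((e + 2) * S + 1) * (Cz * \<kappa>)\<^sup>2) (rem e)"
        unfolding rem_def[abs_def] S_def
        by (rule lip_bound_powr_remainder[OF lip_s z that s_ge_1]) (use Y.s_ge_1 in \<open>simp add: z_def\<close>)
      then show ?thesis by (simp add: q_def power_mult_distrib mult.assoc)
    qed
    have b1: "0 < 1 / b" using b_pos by simp
    have j_eq: "apply_lip Y.J x - apply_lip J x = rem (1 / b) x - \<eta> x * z x" for x
      by (simp add: apply_J Y.apply_J rem_def powr_remainder_def \<eta>_def z_def)
    define e2 where "e2 x = (\<Sum>a\<in>UNIV. rem (1 / b) (a ## x)) * (1 / T x)" for x
    \<comment> \<open>Both Jacobians have branch sums 1, so the sum of their differences vanishes;
      solving its linear part for \<open>l\<close> divides by \<open>T\<close>, which is bounded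
      below.\<close>
    have l_eq: "l x = avg w x + e2 x" for x
    proof -
      have "(\<Sum>a\<in>UNIV. rem (1 / b) (a ## x) - \<eta> (a ## x) * z (a ## x)) = 0"
        unfolding j_eq[symmetric] by (simp add: sum_subtractf eq.sum_J Y.eq.sum_J)
      then have "(\<Sum>a\<in>UNIV. rem (1 / b) (a ## x)) = (\<Sum>a\<in>UNIV. \<eta> (a ## x) * (\<gamma> * (l x - w (a ## x))))"
        by (simp add: sum_subtractf z_eq)
      also have "\<dots> = T x * l x - \<gamma> * (\<Sum>a\<in>UNIV. \<eta> (a ## x) * w (a ## x))"
        unfolding T_def sum_distrib_left sum_distrib_right sum_subtractf[symmetric]
        by (intro sum.cong refl) (simp add: algebra_simps del: times_divide_eq_left times_divide_eq_right)
      finally have "T x * l x = (\<Sum>a\<in>UNIV. rem (1 / b) (a ## x)) + \<gamma> * (\<Sum>a\<in>UNIV. \<eta> (a ## x) * w (a ## x))"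
        by simp
      moreover have "avg w x = \<gamma> * (\<Sum>a\<in>UNIV. \<eta> (a ## x) * w (a ## x)) / T x"
        unfolding avg_eq T_eq using \<gamma>0 by (simp only: mult_divide_mult_cancel_left)
      moreover have "m = a + R * (1 / t)" if "t * m = R + G" "a = G / t" "0 < t" for t m R G a :: real
        using that by (simp add: field_simps)
      ultimately show ?thesis
        unfolding e2_def using T_pos[of x] by blast
    qed
    define r where "r x = (\<Sum>a\<in>UNIV. rem \<epsilon> (a ## x))" for x
    \<comment> \<open>Envelope effect: the first-order change of the power sum is
      \<open>eq.L w x - l x\<close>, which cancels the change \<open>l x\<close> of the multiplier
      and leaves \<open>eq.L w x\<close>.\<close>
    have h_eq: "h x + D = eq.L w x + r x" for x
    proof -
      let ?dF = "(\<Sum>a\<in>UNIV. Y.s (a ## x) powr (- \<epsilon>)) - (\<Sum>a\<in>UNIV. s (a ## x) powr (- \<epsilon>))"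
      have exponent: "- \<epsilon> - 1 = - 1 / b" by (simp add: \<epsilon>_def)
      have "rem \<epsilon> (a ## x) = (Y.s (a ## x) powr (- \<epsilon>) - s (a ## x) powr (- \<epsilon>)) + apply_lip J (a ## x) * (l x - w (a ## x))" for a
      proof -
        have "\<epsilon> * apply_lip J (a ## x) * (\<gamma> * (l x - w (a ## x))) = (\<epsilon> * \<gamma>) * (apply_lip J (a ## x) * (l x - w (a ## x)))"
          by (simp only: mult_ac)
        also have "\<dots> = apply_lip J (a ## x) * (l x - w (a ## x))"
          unfolding \<epsilon>(2) by simp
        finally have "\<epsilon> * apply_lip J (a ## x) * z (a ## x) = apply_lip J (a ## x) * (l x - w (a ## x))"
          by (simp only: z_eq stream.sel)
        then show ?thesis
          unfolding rem_def powr_remainder_def exponent apply_J[symmetric] by (simp add: z_def)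
      qed
      then have "r x = ?dF + (\<Sum>a\<in>UNIV. apply_lip J (a ## x) * l x - apply_lip J (a ## x) * w (a ## x))"
        by (simp add: r_def sum.distrib sum_subtractf right_diff_distrib)
      also have "\<dots> = ?dF + (l x - eq.L w x)"
        by (simp add: sum_subtractf transfer_log_def eq.sum_J flip: sum_distrib_right)
      finally have "r x = ?dF + (l x - eq.L w x)" .
      moreover have "h x + D = l x + ?dF"
        using bellman_lam[of x] Y.bellman_lam[of x] by (simp add: h_def D_def l_def \<epsilon>_def)
      ultimately show ?thesis by simp
    qed
    have r: "lip_bound (d * (q \<epsilon> * \<kappa>\<^sup>2)) r"
      unfolding r_def[abs_def] d_def by (rule lip_bound_sum_branches[OF rem[OF \<epsilon>(1)]])
    define e4 where "e4 = eq.poisson r"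
    have e4: "(Cp * (d * (q \<epsilon> * \<kappa>\<^sup>2)))-lipschitz_on UNIV e4"
      unfolding e4_def by (rule Cp(2)[OF lip_boundD(4)[OF r]])
    define t where "t = (\<integral>y. h y \<partial>(the_equilibrium_state (1 - b) A))"
    have h_lip: "(norm B + norm A)-lipschitz_on UNIV h"
      unfolding h_def by (intro lipschitz_on_diff Y.lip_\<phi> lip_\<phi>)
    obtain NL where NL: "NL-lipschitz_on UNIV (eq.L k)"
      unfolding k_def using potential_derivative_lipschitz by metis
    have "(\<lambda>x. h x - eq.L h x) = (\<lambda>x. (eq.L k x + r x) + (- D))"
    proof
      fix x
      have "eq.L w x = eq.L k x + eq.L h x"
        using eq.transfer_add[of k h] by (simp add: w_eq[abs_def])
      then show "h x - eq.L h x = (eq.L k x + r x) + (- D)"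
        using h_eq[of x] by linarith
    qed
    \<comment> \<open>The change \<open>D\<close> of the additive eigenvalue is a constant and
      disappears under \<open>poisson\<close>.\<close>
    then have "h x - t = eq.poisson (\<lambda>x. (eq.L k x + r x) + (- D)) x" for x
      using eq.poisson_solves[OF h_lip, of x] by (simp add: t_def)
    also have "eq.poisson (\<lambda>x. (eq.L k x + r x) + (- D)) x = eq.poisson (eq.L k) x + e4 x" for x
      using eq.poisson_add[OF lipschitz_on_add[OF NL lip_boundD(4)[OF r]] lipschitz_on_constant[of UNIV "- D"], of x]
        eq.poisson_add[OF NL lip_boundD(4)[OF r], of x]
      by (simp add: eq.poisson_const e4_def)
    finally have h_sol: "h x - t = eq.poisson (eq.L k) x + e4 x" for x .
    have "w = (\<lambda>x. (potential_derivative (B - A) x + e4 x) + t)"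
      using h_sol by (simp add: fun_eq_iff w_eq potential_derivative_def k_def algebra_simps)
    then have defect_w: "defect w x = defect (potential_derivative (B - A)) x + defect e4 x" for x
      by (simp only: defect_add defect_const)
    have "z x = \<gamma> * (defect w x + e2 (stl x))" for x
      by (simp only: z_eq l_eq defect_def) (simp add: algebra_simps)
    then have eq: "apply_lip Y.J x - apply_lip J x - jacobian_derivative (B - A) x
        = (rem (1 / b) x - (\<gamma> * \<eta> x) * e2 (stl x)) - (\<gamma> * \<eta> x) * defect e4 x" for x
      unfolding j_eq jacobian_derivative_def defect_w
      by (simp add: algebra_simps del: times_divide_eq_left times_divide_eq_right)
    have "lip_bound (q (1 / b) * \<kappa>\<^sup>2 + 2 * M * (2 * (2 * (d * (q (1 / b) * \<kappa>\<^sup>2)) * N)) + 2 * M * (Cd * (Cp * (d * (q \<epsilon> * \<kappa>\<^sup>2)))))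
        (\<lambda>x. (rem (1 / b) x - (\<gamma> * \<eta> x) * e2 (stl x)) - (\<gamma> * \<eta> x) * defect e4 x)"
      unfolding e2_def d_def
      by (intro lip_bound_diff lip_bound_mult lip_bound_stl[of _ "\<lambda>x. (\<Sum>a\<in>UNIV. rem (1 / b) (a ## x)) * (1 / T x)"]
          lip_bound_sum_branches rem M N b1 Cd(2) e4[unfolded d_def])
    moreover have "q (1 / b) * \<kappa>\<^sup>2 + 2 * M * (2 * (2 * (d * (q (1 / b) * \<kappa>\<^sup>2)) * N)) + 2 * M * (Cd * (Cp * (d * (q \<epsilon> * \<kappa>\<^sup>2)))) = C * \<kappa>\<^sup>2"
      by (simp add: C_def algebra_simps)
    ultimately show ?thesis
      unfolding eq by (simp only: \<kappa>_def)
  qed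
  with C show ?thesis by (rule that)
qed

text \<open>The quadratic remainder is divided by \<open>norm (B - A)\<close>. Any Bellman solution
  for \<open>B\<close> may be used, since its Jacobian is that of the equilibrium state.\<close>

lemma has_derivative_jacobian:
  "((\<lambda>B. jacobian_of (the_equilibrium_state (1 - b) B)) has_derivative (\<lambda>k. Lip (jacobian_derivative k))) (at A within X)"
proof -
  obtain C where C: "0 \<le> C"
    "\<And>B \<phi>' c'. bellman b B \<phi>' c' \<Longrightarrow>
      lip_bound (C * (norm (B - A))\<^sup>2) (\<lambda>x. apply_lip (bellman.J b B \<phi>') x - apply_lip J x - jacobian_derivative (B - A) x)"
    using jacobian_remainder by blast
  show ?thesis
  proof (rule has_derivativeI_sandwich[of 1])
    fix B assume "B \<in> X" "B \<noteq> A"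
    obtain \<phi>' c' where B: "bellman b B \<phi>' c'" using bellman_exists by blast
    interpret Y: bellman b B \<phi>' c' by (rule B)
    have "norm (Y.J - J - Lip (jacobian_derivative (B - A))) \<le> 2 * (C * (norm (B - A))\<^sup>2)"
      by (rule norm_lip_le) (use C(2)[OF B] in \<open>simp add: bounded_linear_jacobian_derivative(2)\<close>)
    then have "norm (Y.J - J - Lip (jacobian_derivative (B - A))) / norm (B - A) \<le> 2 * C * norm (B - A)"
      using \<open>B \<noteq> A\<close> by (simp add: pos_divide_le_eq power2_eq_square mult.assoc)
    then show "norm (jacobian_of (the_equilibrium_state (1 - b) B) - jacobian_of (the_equilibrium_state (1 - b) A)
        - Lip (jacobian_derivative (B - A))) / norm (B - A) \<le> 2 * C * norm (B - A)"
      by (simp add: jacobian_of_the_equilibrium_state Y.jacobian_of_the_equilibrium_state)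
  next
    have "((\<lambda>B. 2 * C * norm (B - A)) \<longlongrightarrow> 2 * C * norm (A - A)) (at A within X)"
      by (intro tendsto_intros)
    then show "((\<lambda>B. 2 * C * norm (B - A)) \<longlongrightarrow> 0) (at A within X)" by simp
  qed (simp_all add: bounded_linear_jacobian_derivative(1))
qed

end

theorem corollary5p5:
  fixes q :: real and A :: "'a::finite lip"
  assumes "0 < q" and "q < 1" and "normalizable q A"
  shows "(\<exists>!\<mu>. equilibrium_state q A \<mu>) \<and>
    exact_measure (the_equilibrium_state q A) \<and>
    exp_decay_of_correlations (the_equilibrium_state q A) \<and>
    A \<in> interior {B. normalizable q B} \<and>
    (\<lambda>B. jacobian_of (the_equilibrium_state q B)) differentiable (at A within {B. normalizable q B})"
proof -
  interpret tsallis "1 - q" using assms by unfold_locales auto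
  obtain \<phi> c where "bellman (1 - q) A \<phi> c" using bellman_exists by blast
  then interpret bellman "1 - q" A \<phi> c .
  have q: "1 - (1 - q) = q" by simp
  \<comment> \<open>The interior is then the whole space, and the derivative within the set is the
    derivative without restriction.\<close>
  have "{B. normalizable q B} = (UNIV :: 'a lip set)"
    using normalizable_all[OF assms(1,2)] by auto
  then show ?thesis
    using ex1_equilibrium_state eq.exact eq.exp_decay has_derivative_jacobian[of UNIV]
    unfolding q differentiable_def by auto
qed

end
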